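(* Fix $p > 4$, $n\geq1$ and let $a_1, \dots, a_n, b_1, \dots, b_n > 0$ be such that for each $j=1,\dots,n$, \[ 3^{1/2}(p+1)^{-1/p} \leq \frac{b_j}{a_j} \leq 2^{-1/2}\Gamma(p+1)^{1/p}. \] Then \[ \inf\ \mathbb{E}\left|\sum_{j=1}^n X_j\right|^p = \mathbb{E}\left|\sum_{j=1}^n {\bf X}_j^-\right|^p \qquad \text{and} \qquad \sup\ \mathbb{E}\left|\sum_{j=1}^n X_j\right|^p = \mathbb{E}\left|\sum_{j=1}^n {\bf X}_j^+\right|^p, \] where the infimum (respectively supremum) is taken over all sequences $(X_1,\dots,X_n)$ of independent symmetric log-concave random variables with $\mathbb{E} X_j^2 = a_j^2$ and $\mathbb{E}|X_j|^p = b_j^p$ for $j=1,\dots,n$, and where ${\bf X}_1^-,\dots,{\bf X}_n^-$ (respectively ${\bf X}_1^+,\dots,{\bf X}_n^+$) are independent random variables such that ${\bf X}_j^-$ (respectively ${\bf X}_j^+$) has the unique density from $\mathcal{F}^-$ (respectively $\mathcal{F}^+$) that satisfies the same constraints, namely second moment $a_j^2$ and $p$-th absolute moment $b_j^p$.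
   Context: A random variable is log-concave if it has a density of the form $e^{-\phi}$ for a convex function $\phi\colon\mathbb{R}\to(-\infty,+\infty]$; it is symmetric if $X$ and $-X$ have the same distribution. Write $t_+=\max(t,0)$. For $\alpha \in [0,+\infty)$ and $\gamma \in (0,+\infty]$ define the density \[ f_{\alpha,\gamma}(x) = \frac{1}{2(\alpha+1/\gamma)}\exp\left\{-\gamma(|x|-\alpha)_+\right\}, \] with the convention that $\gamma = +\infty$, $\alpha > 0$ gives the uniform density on $[-\alpha,\alpha]$ and that $\alpha = 0$, $\gamma < +\infty$ gives the two-sided exponential density $\frac{\gamma}{2}e^{-\gamma|x|}$. For $\alpha \in (0,+\infty]$ and $\gamma \in [0,+\infty)$ define the density \[ g_{\alpha,\gamma}(x) = \frac{\gamma}{2(1-e^{-\alpha\gamma})}\exp\left\{-\gamma|x|\right\}\mathbf{1}_{\{|x| \leq \alpha\}}, \] with the convention that $\gamma = 0$, $0<\alpha<+\infty$ gives the uniform density on $[-\alpha,\alpha]$ and that $\alpha = +\infty$, $\gamma > 0$ gives the two-sided exponential density $\frac{\gamma}{2}e^{-\gamma|x|}$. Set $\mathcal{F}^- = \{f_{\alpha,\gamma}: \alpha \in [0,+\infty), \gamma \in (0,+\infty]\}$ and $\mathcal{F}^+ = \{g_{\alpha,\gamma}: \alpha \in (0,+\infty], \gamma \in [0,+\infty)\}$, where the degenerate pairs $(\alpha,\gamma)=(0,+\infty)$ for $\mathcal{F}^-$ and $(\alpha,\gamma)=(+\infty,0)$ for $\mathcal{F}^+$, which do not define densities, are excluded.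 *)

theory Defs
  imports "HOL-Probability.Probability"
begin

definition convex_ereal :: "(real \<Rightarrow> ereal) \<Rightarrow> bool" where
  "convex_ereal \<phi> \<longleftrightarrow> (\<forall>x. \<phi> x \<noteq> -\<infinity>) \<and>
     (\<forall>x y t. 0 \<le> t \<longrightarrow> t \<le> 1 \<longrightarrow>
        \<phi> ((1 - t) * x + t * y) \<le> ereal (1 - t) * \<phi> x + ereal t * \<phi> y)"

text \<open>\<open>exp(-\<phi>)\<close> with \<open>exp(-\<infinity>) = 0\<close>.\<close>

definition exp_neg :: "ereal \<Rightarrow> real" where
  "exp_neg u = (if u = \<infinity> then 0 else exp (- real_of_ereal u))"

definition log_concave_rv :: "'w measure \<Rightarrow> ('w \<Rightarrow> real) \<Rightarrow> bool" where
  "log_concave_rv M X \<longleftrightarrow>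
     (\<exists>\<phi>. convex_ereal \<phi> \<and> distributed M lborel X (\<lambda>x. ennreal (exp_neg (\<phi> x))))"

definition symmetric_rv :: "'w measure \<Rightarrow> ('w \<Rightarrow> real) \<Rightarrow> bool" where
  "symmetric_rv M X \<longleftrightarrow> distr M borel X = distr M borel (\<lambda>\<omega>. - X \<omega>)"

text \<open>Expectations of nonnegative quantities are taken in \<open>[0,\<infinity>]\<close>, so that a moment
  condition with a finite right-hand side includes integrability, and infima and suprema
  of moments are taken in a complete lattice.\<close>

definition abs_moment :: "'w measure \<Rightarrow> real \<Rightarrow> ('w \<Rightarrow> real) \<Rightarrow> ennreal" where
  "abs_moment M p X = (\<integral>\<^sup>+ \<omega>. ennreal (\<bar>X \<omega>\<bar> powr p) \<partial>M)"

definition second_moment :: "'w measure \<Rightarrow> ('w \<Rightarrow> real) \<Rightarrow> ennreal" where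
  "second_moment M X = (\<integral>\<^sup>+ \<omega>. ennreal ((X \<omega>)\<^sup>2) \<partial>M)"

definition admissible ::
  "real \<Rightarrow> nat \<Rightarrow> (nat \<Rightarrow> real) \<Rightarrow> (nat \<Rightarrow> real) \<Rightarrow> 'w measure \<Rightarrow> (nat \<Rightarrow> 'w \<Rightarrow> real) \<Rightarrow> bool" where
  "admissible p n a b M X \<longleftrightarrow>
     prob_space M \<and> prob_space.indep_vars M (\<lambda>_. borel) X {1..n} \<and>
     (\<forall>j\<in>{1..n}. symmetric_rv M (X j) \<and> log_concave_rv M (X j) \<and>
        second_moment M (X j) = ennreal ((a j)\<^sup>2) \<and>
        abs_moment M p (X j) = ennreal (b j powr p))"

text \<open>The values of \<open>E|X\<^sub>1 + \<dots> + X\<^sub>n|\<^sup>p\<close> over all admissible sequences. A set cannot range over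
  sample spaces of all types, so the sample space is \<open>nat \<Rightarrow> real\<close> with an arbitrary
  \<open>\<sigma>\<close>-algebra and probability; \<open>admissible_in_sum_moments\<close> below shows that other sample
  spaces contribute no further values.\<close>

definition sum_moments ::
  "real \<Rightarrow> nat \<Rightarrow> (nat \<Rightarrow> real) \<Rightarrow> (nat \<Rightarrow> real) \<Rightarrow> ennreal set" where
  "sum_moments p n a b =
     {abs_moment M p (\<lambda>\<omega>. \<Sum>j\<in>{1..n}. X j \<omega>) |
        (M :: (nat \<Rightarrow> real) measure) X. admissible p n a b M X}"

definition f_dens :: "real \<Rightarrow> ereal \<Rightarrow> real \<Rightarrow> real" where
  "f_dens \<alpha> \<gamma> x =
     (if \<gamma> = \<infinity> then 1 / (2 * \<alpha>) * indicator {-\<alpha>..\<alpha>} x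
      else 1 / (2 * (\<alpha> + 1 / real_of_ereal \<gamma>)) *
        exp (- (real_of_ereal \<gamma> * max (\<bar>x\<bar> - \<alpha>) 0)))"

definition F_minus :: "(real \<Rightarrow> real) set" where
  "F_minus = {f_dens \<alpha> \<gamma> | \<alpha> \<gamma>. 0 \<le> \<alpha> \<and> 0 < \<gamma> \<and> (\<alpha>, \<gamma>) \<noteq> (0, \<infinity>)}"

definition g_dens :: "ereal \<Rightarrow> real \<Rightarrow> real \<Rightarrow> real" where
  "g_dens \<alpha> \<gamma> x =
     (if \<alpha> = \<infinity> then \<gamma> / 2 * exp (- (\<gamma> * \<bar>x\<bar>))
      else if \<gamma> = 0 then
        1 / (2 * real_of_ereal \<alpha>) * indicator {- real_of_ereal \<alpha>..real_of_ereal \<alpha>} x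
      else \<gamma> / (2 * (1 - exp (- (real_of_ereal \<alpha> * \<gamma>)))) *
        exp (- (\<gamma> * \<bar>x\<bar>)) * indicator {x. \<bar>x\<bar> \<le> real_of_ereal \<alpha>} x)"

definition F_plus :: "(real \<Rightarrow> real) set" where
  "F_plus = {g_dens \<alpha> \<gamma> | \<alpha> \<gamma>. 0 < \<alpha> \<and> 0 \<le> \<gamma> \<and> (\<alpha>, \<gamma>) \<noteq> (\<infinity>, 0)}"

definition density_moments :: "real \<Rightarrow> real \<Rightarrow> real \<Rightarrow> (real \<Rightarrow> real) \<Rightarrow> bool" where
  "density_moments p s t f \<longleftrightarrow>
     (\<integral>\<^sup>+ x. ennreal (x\<^sup>2 * f x) \<partial>lborel) = ennreal (s\<^sup>2) \<and>
     (\<integral>\<^sup>+ x. ennreal (\<bar>x\<bar> powr p * f x) \<partial>lborel) = ennreal (t powr p)"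

text \<open>Transfer to the joint law on \<open>nat \<Rightarrow> real\<close>.\<close>

lemma admissible_in_sum_moments:
  fixes M :: "'w measure"
  assumes n: "n \<ge> 1" and adm: "admissible p n a b M X"
  shows "abs_moment M p (\<lambda>\<omega>. \<Sum>j\<in>{1..n}. X j \<omega>) \<in> sum_moments p n a b"
proof -
  let ?I = "{1..n}"
  let ?P = "\<Pi>\<^sub>M i\<in>?I. (borel :: real measure)"
  let ?J = "\<lambda>\<omega>. \<lambda>j\<in>?I. X j \<omega>"
  let ?L = "distr M ?P ?J"
  let ?Z = "\<lambda>j (x :: nat \<Rightarrow> real). x j"
  interpret prob_space M using adm by (simp add: admissible_def)
  have ind: "indep_vars (\<lambda>_. borel) X ?I" using adm by (simp add: admissible_def)
  have rv [measurable]: "X j \<in> borel_measurable M" if "j \<in> ?I" for j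
    using ind that by (auto simp: indep_vars_def)
  have J [measurable]: "?J \<in> measurable M ?P"
    by (rule measurable_restrict) (use rv in auto)
  have Z: "?Z j \<in> borel_measurable ?P" if "j \<in> ?I" for j
    using that by (rule measurable_component_singleton)
  have comp: "(\<lambda>\<omega>. h (?J \<omega> j)) = (\<lambda>\<omega>. h (X j \<omega>))" if "j \<in> ?I" for j and h :: "real \<Rightarrow> 'z"
    using that by auto
  have law: "distr ?L N (\<lambda>x. h (?Z j x)) = distr M N (\<lambda>\<omega>. h (X j \<omega>))"
    if "j \<in> ?I" "h \<in> measurable borel N" for j h and N :: "real measure"
    using that Z[OF that(1)] J
    by (subst distr_distr) (auto simp: o_def comp intro: measurable_compose)
  have nn: "(\<integral>\<^sup>+ x. h (?Z j x) \<partial>?L) = (\<integral>\<^sup>+ \<omega>. h (X j \<omega>) \<partial>M)"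
    if "j \<in> ?I" "h \<in> borel_measurable borel" for j and h :: "real \<Rightarrow> ennreal"
    using that Z[OF that(1)] J
    by (subst nn_integral_distr) (auto simp: comp intro: measurable_compose)
  have ps: "prob_space ?L" by (rule prob_space_distr) (rule J)
  interpret L: prob_space ?L by (rule ps)
  have indL: "L.indep_vars (\<lambda>_. borel) ?Z ?I"
  proof (subst L.indep_vars_iff_distr_eq_PiM')
    show "?I \<noteq> {}" using n by auto
    show "L.random_variable borel (?Z i)" if "i \<in> ?I" for i using Z[OF that] by simp
    have "distr ?L ?P (\<lambda>x. \<lambda>i\<in>?I. ?Z i x) = distr M ?P ?J"
      by (subst distr_distr) (auto simp: o_def intro!: distr_cong measurable_restrict Z)
    also have "\<dots> = (\<Pi>\<^sub>M i\<in>?I. distr M borel (X i))"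
      using indep_vars_iff_distr_eq_PiM'[of ?I X "\<lambda>_. borel"] ind n rv by auto
    also have "\<dots> = (\<Pi>\<^sub>M i\<in>?I. distr ?L borel (?Z i))"
      using law[of _ "\<lambda>x. x" borel] by (intro PiM_cong) auto
    finally show "distr ?L ?P (\<lambda>x. \<lambda>i\<in>?I. ?Z i x) = (\<Pi>\<^sub>M i\<in>?I. distr ?L borel (?Z i))" .
  qed
  have "admissible p n a b ?L ?Z"
    unfolding admissible_def
  proof (intro conjI ballI ps indL)
    fix j assume j: "j \<in> ?I"
    note A = adm[unfolded admissible_def, THEN conjunct2, THEN conjunct2, rule_format, OF j]
    show "symmetric_rv ?L (?Z j)"
      using A law[OF j, of "\<lambda>x. x" borel] law[OF j, of uminus borel]
      by (simp add: symmetric_rv_def)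
    have "?Z j \<in> borel_measurable ?L" using Z[OF j] by simp
    then show "log_concave_rv ?L (?Z j)"
      using A law[OF j, of "\<lambda>x. x" lborel]
      by (auto simp: log_concave_rv_def distributed_def)
    show "second_moment ?L (?Z j) = ennreal ((a j)\<^sup>2)"
      using A nn[OF j, of "\<lambda>x. ennreal (x\<^sup>2)"] by (simp add: second_moment_def)
    show "abs_moment ?L p (?Z j) = ennreal (b j powr p)"
      using A nn[OF j, of "\<lambda>x. ennreal (\<bar>x\<bar> powr p)"] by (simp add: abs_moment_def)
  qed
  moreover have "abs_moment ?L p (\<lambda>x. \<Sum>j\<in>?I. ?Z j x) =
      abs_moment M p (\<lambda>\<omega>. \<Sum>j\<in>?I. X j \<omega>)"
  proof -
    have "(\<lambda>x. ennreal (\<bar>\<Sum>j\<in>?I. ?Z j x\<bar> powr p)) \<in> borel_measurable ?P"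
      using Z by measurable
    then show ?thesis
      unfolding abs_moment_def by (subst nn_integral_distr[OF J]) (auto intro!: nn_integral_cong)
  qed
  ultimately show ?thesis
    unfolding sum_moments_def by (auto intro!: exI[of _ ?L] exI[of _ ?Z])
qed

end

theory Submission
  imports Defs
begin

text \<open>
  It suffices to compare one summand at a time: for a fixed real \<open>s\<close>, the quantity
  \<open>E|X + s|\<^sup>p\<close> is minimal for the density in \<open>F_minus\<close> and maximal for the density in \<open>F_plus\<close>
  with the same moments; then the summands are replaced successively by Fubini's theorem.

  For even \<open>X\<close> one integrates \<open>(|x + s|\<^sup>p + |x - s|\<^sup>p) / 2\<close>. Its interpolant at three points
  \<open>t1 < t2 < t3\<close> in the span of \<open>1\<close>, \<open>x\<^sup>2\<close>, \<open>x\<^sup>p\<close> leaves an error with signs \<open>+ - + -\<close> on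
  \<open>(0, \<infinity>)\<close> when \<open>p > 4\<close>. On the other hand, minus the logarithm of a log-concave density is
  convex, while for the extremal densities it is piecewise affine with a single break, so the
  difference of the two densities has the same signs with at most three changes. The error is
  integrated against this difference, which is orthogonal to \<open>1\<close>, \<open>x\<^sup>2\<close>, \<open>x\<^sup>p\<close>. With fewer
  sign changes the difference vanishes almost everywhere; this also gives the uniqueness
  of the extremal densities, and their existence follows from the intermediate value theorem.
\<close>

section \<open>Interpolation by \<open>1\<close>, \<open>x\<^sup>2\<close> and \<open>x\<^sup>p\<close>\<close>

text \<open>Both comparisons use one sign pattern with the roles exchanged: competitor minus
  extremal density has the signs + - + - for \<open>F_minus\<close>, extremal minus competitor has
  them for \<open>F_plus\<close>. This decides which family minimises and which maximises. The
  threshold 4 enters through the monotonicity of \<open>curv\<close>, whose derivative has the sign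
  of an elementary inequality with exponent q = p - 3 > 1. Two obstacles shape the rest. Signs are
  compared at points, whereas a law determines its density only almost everywhere; hence competitors
  are replaced by densities that are even at every point, and the uniqueness claim, which is about
  functions, needs a separate passage from almost every point to all points. Moreover the three sign
  changes may collide or sit at 0, where no interpolant with three positive nodes exists; every such
  degeneration leaves at most two changes.\<close>

lemma has_real_derivative_abs_powr:
  fixes z p :: real
  assumes "p > 1"
  shows "((\<lambda>z. \<bar>z\<bar> powr p) has_real_derivative p * (sgn z * \<bar>z\<bar> powr (p - 1))) (at z)"
proof -
  consider "z > 0" | "z < 0" | "z = 0" by linarith
  then show ?thesis
  proof cases
    case 1
    have "((\<lambda>z. z powr p) has_real_derivative p * (sgn z * \<bar>z\<bar> powr (p - 1))) (at z)"
      using 1 by (auto intro!: derivative_eq_intros)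
    then show ?thesis
      by (rule DERIV_cong_ev[THEN iffD1, rotated -1])
        (use 1 in \<open>auto intro: eventually_mono[OF eventually_gt_at_top[of 0]]
          simp: eventually_nhds intro!: exI[of _ "{0<..}"]\<close>)
  next
    case 2
    have "((\<lambda>z. (-z) powr p) has_real_derivative p * (sgn z * \<bar>z\<bar> powr (p - 1))) (at z)"
      using 2 by (auto intro!: derivative_eq_intros)
    then show ?thesis
      by (rule DERIV_cong_ev[THEN iffD1, rotated -1])
        (use 2 in \<open>auto simp: eventually_nhds intro!: exI[of _ "{..<0}"]\<close>)
  next
    case 3
    \<comment> \<open>At 0 the difference quotient has absolute value |h| powr (p - 1), which tends
      to 0 because p > 1.\<close>
    have "((\<lambda>h. \<bar>h\<bar> powr (p - 1)) \<longlongrightarrow> 0) (at (0::real))"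
      using assms by (auto intro!: tendsto_eq_intros)
    then have "((\<lambda>h. \<bar>\<bar>h\<bar> powr p / h\<bar>) \<longlongrightarrow> 0) (at (0::real))"
      by (rule Lim_transform_eventually) (auto simp: eventually_at_filter powr_diff)
    then have "((\<lambda>h. \<bar>h\<bar> powr p / h) \<longlongrightarrow> 0) (at (0::real))"
      by (rule tendsto_rabs_zero_cancel)
    then show ?thesis using 3 by (simp add: DERIV_def)
  qed
qed

lemma has_real_derivative_sgn_abs_powr:
  fixes z p :: real
  assumes "p > 1"
  shows "((\<lambda>z. sgn z * \<bar>z\<bar> powr p) has_real_derivative p * \<bar>z\<bar> powr (p - 1)) (at z)"
proof -
  consider "z > 0" | "z < 0" | "z = 0" by linarith
  then show ?thesis
  proof cases
    case 1
    have "((\<lambda>z. z powr p) has_real_derivative p * \<bar>z\<bar> powr (p - 1)) (at z)"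
      using 1 by (auto intro!: derivative_eq_intros)
    then show ?thesis
      by (rule DERIV_cong_ev[THEN iffD1, rotated -1])
        (use 1 in \<open>auto simp: eventually_nhds intro!: exI[of _ "{0<..}"]\<close>)
  next
    case 2
    have "((\<lambda>z. - ((-z) powr p)) has_real_derivative p * \<bar>z\<bar> powr (p - 1)) (at z)"
      using 2 by (auto intro!: derivative_eq_intros)
    then show ?thesis
      by (rule DERIV_cong_ev[THEN iffD1, rotated -1])
        (use 2 in \<open>auto simp: eventually_nhds intro!: exI[of _ "{..<0}"]\<close>)
  next
    case 3
    have "((\<lambda>h. \<bar>h\<bar> powr (p - 1)) \<longlongrightarrow> 0) (at (0::real))"
      using assms by (auto intro!: tendsto_eq_intros)
    then have "((\<lambda>h. sgn h * \<bar>h\<bar> powr p / h) \<longlongrightarrow> 0) (at (0::real))"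
      by (rule Lim_transform_eventually)
        (auto simp: eventually_at_filter powr_diff sgn_if)
    then show ?thesis using 3 assms by (simp add: DERIV_def)
  qed
qed

lemma has_real_derivative_abs_powr_comp:
  fixes p :: real
  assumes "p > 1" "(g has_real_derivative g') (at x)" "p * (sgn (g x) * \<bar>g x\<bar> powr (p - 1)) * g' = D"
  shows "((\<lambda>x. \<bar>g x\<bar> powr p) has_real_derivative D) (at x)"
  using DERIV_chain2[OF has_real_derivative_abs_powr[OF assms(1)] assms(2)] assms(3) by simp

lemma has_real_derivative_sgn_abs_powr_comp:
  fixes p :: real
  assumes "p > 1" "(g has_real_derivative g') (at x)" "p * \<bar>g x\<bar> powr (p - 1) * g' = D"
  shows "((\<lambda>x. sgn (g x) * \<bar>g x\<bar> powr p) has_real_derivative D) (at x)"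
  using DERIV_chain2[OF has_real_derivative_sgn_abs_powr[OF assms(1)] assms(2)] assms(3) by simp

text \<open>For q = p - 3 this is the sign of the derivative of \<open>curv\<close>, so q > 1 is
  where p > 4 is spent. For u < 1 it is the product of (1 - u) powr (q - 1) <= (1 + u) powr (q - 1)
  with (1 - u) (q + u) < (1 + u) (q - u), whose gap is 2 u (q - 1). For u > 1 the left side is
  negative, but for u > q so is the right side, and the sizes have to be compared.\<close>

lemma powr_ratio_less:
  fixes q u :: real
  assumes q: "q > 1" and u: "u > 0"
  shows "sgn (1 - u) * \<bar>1 - u\<bar> powr q * (q + u) < (1 + u) powr q * (q - u)"
proof -
  consider "u < 1" | "u = 1" | "u > 1" by linarith
  then show ?thesis
  proof cases
    case 1
    have a: "(1 - u) * (q + u) < (1 + u) * (q - u)"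
    proof -
      have "(1 + u) * (q - u) - (1 - u) * (q + u) = 2 * u * (q - 1)" by algebra
      also have "\<dots> > 0" using q u by simp
      finally show ?thesis by simp
    qed
    have b: "(1 - u) powr (q - 1) \<le> (1 + u) powr (q - 1)"
      using 1 u q by (intro powr_mono2) auto
    have c: "(1 - u) powr (q - 1) > 0" using 1 by simp
    have "0 \<le> (1 - u) * (q + u)" using 1 u q by simp
    from mult_le_less_imp_less[OF b a c this] show ?thesis using 1 u by (simp add: powr_diff)
  next
    case 2
    then show ?thesis using q by simp
  next
    case 3
    define v where "v = 1 / u"
    have v: "0 < v" "v < 1" using 3 by (auto simp: v_def)
    \<comment> \<open>Dividing the claim by \<open>u powr (q + 1)\<close> turns it into \<open>F 0 < F v\<close>.\<close>
    let ?F = "\<lambda>v. (1 + v) powr q * (q * v - 1) + (1 - v) powr q * (q * v + 1)"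
    have "?F 0 < ?F v"
    proof (rule DERIV_pos_imp_increasing_open[OF v(1)])
      fix x assume x: "0 < x" "x < v"
      let ?d = "q * (q + 1) * x * ((1 + x) powr (q - 1) - (1 - x) powr (q - 1))"
      have "(1 - x) powr (q - 1) < (1 + x) powr (q - 1)"
        using x v q by (intro powr_less_mono2) auto
      then have "?d > 0" using x q by simp
      moreover have "(?F has_real_derivative ?d) (at x)"
      proof -
        have e: "(1 + x) powr q = (1 + x) * (1 + x) powr (q - 1)"
          "(1 - x) powr q = (1 - x) * (1 - x) powr (q - 1)"
          using x v by (simp_all add: powr_diff)
        show ?thesis
          using x v by (auto intro!: derivative_eq_intros simp: e algebra_simps)
      qed
      ultimately show "\<exists>y. (?F has_real_derivative y) (at x) \<and> 0 < y" by blast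
    next
      show "continuous_on {0..v} ?F" using v
        by (intro continuous_intros) auto
    qed
    then have "0 < ?F v" by simp
    moreover have "(1 + v) = (1 + u) / u" "1 - v = (u - 1) / u" using u by (auto simp: v_def field_simps)
    ultimately have "0 < ((1 + u) / u) powr q * (q / u - 1) + ((u - 1) / u) powr q * (q / u + 1)"
      by (simp add: v_def)
    also have "\<dots> = ((1 + u) powr q * (q - u) + (u - 1) powr q * (q + u)) / (u powr q * u)"
      using 3 by (simp add: powr_divide field_simps)
    finally have "0 < (1 + u) powr q * (q - u) + (u - 1) powr q * (q + u)"
      using 3 by (simp add: zero_less_divide_iff mult_less_0_iff)
    then show ?thesis using 3 by simp
  qed
qed

section \<open>The symmetrised shifted power and its curvature\<close>

definition sympow :: "real \<Rightarrow> real \<Rightarrow> real \<Rightarrow> real" where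
  "sympow p s x = (\<bar>x + s\<bar> powr p + \<bar>x - s\<bar> powr p) / 2"

definition sympow_d1 :: "real \<Rightarrow> real \<Rightarrow> real \<Rightarrow> real" where
  "sympow_d1 p s x = p / 2 * (sgn (x + s) * \<bar>x + s\<bar> powr (p - 1) + sgn (x - s) * \<bar>x - s\<bar> powr (p - 1))"

definition sympow_d2 :: "real \<Rightarrow> real \<Rightarrow> real \<Rightarrow> real" where
  "sympow_d2 p s x = p * (p - 1) / 2 * (\<bar>x + s\<bar> powr (p - 2) + \<bar>x - s\<bar> powr (p - 2))"

lemma has_real_derivative_sympow:
  assumes "p > 1"
  shows "(sympow p s has_real_derivative sympow_d1 p s x) (at x)"
  unfolding sympow_def[abs_def] sympow_d1_def
  by (rule has_real_derivative_abs_powr_comp[OF assms] derivative_eq_intros refl)+ (simp_all add: algebra_simps)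

lemma has_real_derivative_sympow_d1:
  assumes "p > 2"
  shows "(sympow_d1 p s has_real_derivative sympow_d2 p s x) (at x)"
proof -
  have p: "p - 1 > 1" using assms by simp
  show ?thesis
    unfolding sympow_d1_def[abs_def] sympow_d2_def
    by (rule has_real_derivative_sgn_abs_powr_comp[OF p] derivative_eq_intros refl)+ (simp_all add: field_simps)
qed

text \<open>The operator x S'' - S' kills 1 and x^2, maps x powr p to p (p - 2) x powr (p - 1), and
  is x^2 times the derivative of S' / x. Applied to \<open>sympow p s\<close> it gives a function of
  x and s that is homogeneous of degree p - 1; \<open>curv\<close> is its profile in u = s /
  x.\<close>

definition curv :: "real \<Rightarrow> real \<Rightarrow> real" where
  "curv p u = p / 2 * ((p - 1) * (\<bar>1 + u\<bar> powr (p - 2) + \<bar>1 - u\<bar> powr (p - 2))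
     - sgn (1 + u) * \<bar>1 + u\<bar> powr (p - 1) - sgn (1 - u) * \<bar>1 - u\<bar> powr (p - 1))"

text \<open>Once every power is reduced to the exponent p - 3, the derivative is p (p - 1) / 2 times
  the difference of the two sides of \<open>powr_ratio_less\<close> for q = p - 3.\<close>

lemma curv_strict_mono:
  assumes p: "p > 4" and uv: "0 < u" "u < v"
  shows "curv p u < curv p v"
proof (rule DERIV_pos_imp_increasing[OF uv(2)])
  fix x assume x: "u \<le> x" "x \<le> v"
  have p': "p - 2 > 1" "p - 1 > 1" using p by auto
  have x0: "x > 0" using x uv by simp
  let ?d = "p / 2 * ((p - 1) * ((p - 2) * (sgn (1 + x) * \<bar>1 + x\<bar> powr (p - 3)) -
      (p - 2) * (sgn (1 - x) * \<bar>1 - x\<bar> powr (p - 3)))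
      - (p - 1) * \<bar>1 + x\<bar> powr (p - 2) + (p - 1) * \<bar>1 - x\<bar> powr (p - 2))"
  have "(curv p has_real_derivative ?d) (at x)"
    unfolding curv_def[abs_def]
    by (rule has_real_derivative_abs_powr_comp[OF p'(1)]
        has_real_derivative_sgn_abs_powr_comp[OF p'(2)] derivative_eq_intros refl)+
      (simp add: algebra_simps)
  moreover have "?d > 0"
  proof -
    have a: "\<bar>1 + x\<bar> powr (p - 2) = (1 + x) * (1 + x) powr (p - 3)"
      using x0 powr_add[of "1 + x" 1 "p - 3"] by simp
    have b: "\<bar>1 - x\<bar> powr (p - 2) = (1 - x) * (sgn (1 - x) * \<bar>1 - x\<bar> powr (p - 3))"
      using powr_add[of "\<bar>1 - x\<bar>" 1 "p - 3"] by (auto simp: sgn_if abs_if)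
    have "?d = p * (p - 1) / 2 * ((1 + x) powr (p - 3) * (p - 3 - x) -
        sgn (1 - x) * \<bar>1 - x\<bar> powr (p - 3) * (p - 3 + x))"
    proof -
      define A B where "A = (1 + x) powr (p - 3)" and "B = sgn (1 - x) * \<bar>1 - x\<bar> powr (p - 3)"
      have "sgn (1 + x) * \<bar>1 + x\<bar> powr (p - 3) = A" using x0 by (simp add: A_def)
      then show ?thesis unfolding a b unfolding A_def[symmetric] B_def[symmetric]
        by (simp add: field_simps)
    qed
    also have "\<dots> > 0"
      using powr_ratio_less[of "p - 3" x] p x0 by (intro mult_pos_pos) auto
    finally show ?thesis .
  qed
  ultimately show "\<exists>y. (curv p has_real_derivative y) (at x) \<and> 0 < y" by blast
qed

lemma sympow_curv:
  assumes x: "x > 0"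
  shows "x * sympow_d2 p s x - sympow_d1 p s x = x powr (p - 1) * curv p (s / x)"
proof -
  define u where "u = s / x"
  have e: "x * x powr (p - 2) = x powr (p - 1)" using x powr_add[of x 1 "p - 2"] by simp
  have s: "x + s = x * (1 + u)" "x - s = x * (1 - u)" using x by (auto simp: u_def field_simps)
  have s1: "\<bar>x + s\<bar> powr r = x powr r * \<bar>1 + u\<bar> powr r"
    "\<bar>x - s\<bar> powr r = x powr r * \<bar>1 - u\<bar> powr r" for r
    unfolding s using x by (simp_all add: abs_mult powr_mult)
  have s2: "sgn (x + s) = sgn (1 + u)" "sgn (x - s) = sgn (1 - u)"
    unfolding s using x by (simp_all add: sgn_mult)
  show ?thesis
    unfolding sympow_d1_def sympow_d2_def curv_def s1 s2 u_def[symmetric] e[symmetric]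
    by algebra
qed

lemma Rolle_pos:
  fixes g g' :: "real \<Rightarrow> real"
  assumes "0 < x" "x < y" "g x = g y"
    and der: "\<And>x. x > 0 \<Longrightarrow> (g has_real_derivative g' x) (at x)"
  shows "\<exists>z. x < z \<and> z < y \<and> g' z = 0"
proof -
  have "\<exists>z. x < z \<and> z < y \<and> g y - g x = (y - x) * g' z"
    using assms by (intro MVT2) auto
  then show ?thesis using assms by auto
qed

lemma deriv_pos_less:
  fixes g g' :: "real \<Rightarrow> real"
  assumes "0 < x" "x < y" and der: "\<And>x. x > 0 \<Longrightarrow> (g has_real_derivative g' x) (at x)"
    and "\<And>z. x < z \<Longrightarrow> z < y \<Longrightarrow> 0 < g' z"
  shows "g x < g y"
proof -
  have "\<exists>z. x < z \<and> z < y \<and> g y - g x = (y - x) * g' z"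
    using assms by (intro MVT2) auto
  then obtain z where "x < z" "z < y" "g y - g x = (y - x) * g' z" by blast
  then have "g y - g x > 0" using assms by simp
  then show ?thesis by simp
qed

lemma deriv_nonneg_le:
  fixes g g' :: "real \<Rightarrow> real"
  assumes "0 < x" "x \<le> y" and der: "\<And>x. x > 0 \<Longrightarrow> (g has_real_derivative g' x) (at x)"
    and "\<And>z. x < z \<Longrightarrow> z < y \<Longrightarrow> 0 \<le> g' z"
  shows "g x \<le> g y"
proof (cases "x = y")
  case False
  then have "\<exists>z. x < z \<and> z < y \<and> g y - g x = (y - x) * g' z"
    using assms by (intro MVT2) auto
  then obtain z where "x < z" "z < y" "g y - g x = (y - x) * g' z" by blast
  then have "g y - g x \<ge> 0" using assms by simp
  then show ?thesis by simp
qed simp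

text \<open>Dividing the derivative by x leaves N = p x powr (p - 2) + 2 c1, strictly increasing
  since p > 2. By Rolle its zero lies between t1 and t2, so the function decreases, then increases,
  and has no zeros besides the two nodes.\<close>

lemma powr_interpolation_signs:
  fixes p :: real
  assumes p: "p > 2" and t: "0 < t1" "t1 < t2"
  obtains c0 c1 :: real where
    "\<And>x. 0 < x \<Longrightarrow> x < t1 \<Longrightarrow> x powr p + c1 * x\<^sup>2 + c0 > 0"
    "\<And>x. t1 < x \<Longrightarrow> x < t2 \<Longrightarrow> x powr p + c1 * x\<^sup>2 + c0 < 0"
    "\<And>x. t2 < x \<Longrightarrow> x powr p + c1 * x\<^sup>2 + c0 > 0"
    "t1 powr p + c1 * t1\<^sup>2 + c0 = 0" "t2 powr p + c1 * t2\<^sup>2 + c0 = 0"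
proof -
  have sq: "t1\<^sup>2 < t2\<^sup>2" using t by (intro power_strict_mono) auto
  define c1 where "c1 = - (t2 powr p - t1 powr p) / (t2\<^sup>2 - t1\<^sup>2)"
  define c0 where "c0 = - (t1 powr p) - c1 * t1\<^sup>2"
  define f where "f x = x powr p + c1 * x\<^sup>2 + c0" for x
  define N where "N x = p * x powr (p - 2) + 2 * c1" for x
  have z1: "f t1 = 0" by (simp add: f_def c0_def)
  have "c1 * (t2\<^sup>2 - t1\<^sup>2) = - (t2 powr p - t1 powr p)" using sq by (simp add: c1_def)
  then have z2: "f t2 = 0" by (simp add: f_def c0_def algebra_simps)
  have d: "(f has_real_derivative x * N x) (at x)" if "x > 0" for x
  proof -
    have e: "p * x powr (p - 1) = x * (p * x powr (p - 2))" using that powr_add[of x 1 "p - 2"] by simp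
    have "(f has_real_derivative p * x powr (p - 1) + c1 * (2 * x)) (at x)"
      unfolding f_def[abs_def] using that by (auto intro!: derivative_eq_intros)
    then show ?thesis unfolding e N_def by (simp add: algebra_simps)
  qed
  obtain \<xi> where \<xi>: "t1 < \<xi>" "\<xi> < t2" "N \<xi> = 0"
    using Rolle_pos[of t1 t2 f "\<lambda>x. x * N x"] t z1 z2 d by force
  have mono: "N x < N y" if "0 < x" "x < y" for x y
    using that p by (auto simp: N_def intro!: powr_less_mono2)
  have dec: "f y < f x" if "0 < x" "x < y" "y \<le> \<xi>" for x y
    using deriv_pos_less[of x y "\<lambda>x. - f x" "\<lambda>x. - (x * N x)"] that mono[of _ \<xi>] \<xi>(3)
    by (auto intro: DERIV_minus[OF d] simp: mult_less_0_iff)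
  have inc: "f x < f y" if "\<xi> \<le> x" "x < y" for x y
    using deriv_pos_less[of x y f "\<lambda>x. x * N x"] that mono[of \<xi>] \<xi> t
    by (auto intro: d simp: zero_less_mult_iff)
  show ?thesis
  proof (rule that[of c1 c0], goal_cases)
    case (1 x) then show ?case using dec[of x t1] \<xi> z1 by (simp add: f_def)
  next
    case (2 x) then show ?case
      using dec[of t1 x] inc[of x t2] \<xi> z1 z2 t by (cases "x \<le> \<xi>") (simp_all add: f_def)
  next
    case (3 x) then show ?case using inc[of t2 x] \<xi> z2 by (simp add: f_def)
  qed (use z1 z2 in \<open>simp_all add: f_def\<close>)
qed

text \<open>Writing \<open>\<Psi>' = x N\<close>, the three zeros of \<open>\<Psi>\<close> give two zeros of \<open>N\<close> and these one zero of \<open>N'\<close>,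
  which is the only one because \<open>N' = x powr (p - 3) * (curv p (s / x) - const)\<close>.\<close>

lemma sympow_interpolation_signs:
  fixes p s :: real
  assumes p: "p > 4" and s: "s > 0" and t: "0 < t1" "t1 < t2" "t2 < t3"
  obtains c0 c1 c2 :: real where
    "\<And>x. 0 < x \<Longrightarrow> x \<le> t1 \<Longrightarrow> sympow p s x + c2 * x powr p + c1 * x\<^sup>2 + c0 \<ge> 0"
    "\<And>x. t1 \<le> x \<Longrightarrow> x \<le> t2 \<Longrightarrow> sympow p s x + c2 * x powr p + c1 * x\<^sup>2 + c0 \<le> 0"
    "\<And>x. t2 \<le> x \<Longrightarrow> x \<le> t3 \<Longrightarrow> sympow p s x + c2 * x powr p + c1 * x\<^sup>2 + c0 \<ge> 0"
    "\<And>x. t3 \<le> x \<Longrightarrow> sympow p s x + c2 * x powr p + c1 * x\<^sup>2 + c0 \<le> 0"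
proof -
  \<comment> \<open>The three interpolation conditions are solved in two stages: a correction that
    vanishes at t1 and t2 and is positive at t3 is added with the factor c2 that repairs the value
    at t3.\<close>
  obtain b0 b1 where b: "t3 powr p + b1 * t3\<^sup>2 + b0 > 0"
    "t1 powr p + b1 * t1\<^sup>2 + b0 = 0" "t2 powr p + b1 * t2\<^sup>2 + b0 = 0"
  proof (rule powr_interpolation_signs[of p t1 t2], goal_cases)
    case (4 c0 c1)
    show ?case by (rule that[of c1 c0]) (use 4 t in auto)
  qed (use p t in auto)
  have sq: "t1\<^sup>2 < t2\<^sup>2" using t by (intro power_strict_mono) auto
  define a1 where "a1 = - (sympow p s t2 - sympow p s t1) / (t2\<^sup>2 - t1\<^sup>2)"
  define a0 where "a0 = - (sympow p s t1) - a1 * t1\<^sup>2"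
  have a12: "a1 * (t2\<^sup>2 - t1\<^sup>2) = - (sympow p s t2 - sympow p s t1)" using sq by (simp add: a1_def)
  define c2 where "c2 = - (sympow p s t3 + a1 * t3\<^sup>2 + a0) / (t3 powr p + b1 * t3\<^sup>2 + b0)"
  define c1 where "c1 = a1 + c2 * b1"
  define c0 where "c0 = a0 + c2 * b0"
  define f where "f x = sympow p s x + c2 * x powr p + c1 * x\<^sup>2 + c0" for x
  have f_alt: "f x = (sympow p s x + a1 * x\<^sup>2 + a0) + c2 * (x powr p + b1 * x\<^sup>2 + b0)" for x
    by (simp add: f_def c1_def c0_def algebra_simps)
  have z1: "f t1 = 0" unfolding f_alt b by (simp add: a0_def)
  have z2: "f t2 = 0" unfolding f_alt b using a12 by (simp add: a0_def algebra_simps)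
  have z3: "f t3 = 0" unfolding f_alt c2_def using b(1) by simp
  define N where "N x = sympow_d1 p s x / x + c2 * p * x powr (p - 2) + 2 * c1" for x
  define N' where "N' x = x powr (p - 3) * (curv p (s / x) + c2 * p * (p - 2))" for x
  have d: "(f has_real_derivative x * N x) (at x)" if "x > 0" for x
  proof -
    have e: "p * x powr (p - 1) = x * (p * x powr (p - 2))" using that powr_add[of x 1 "p - 2"] by simp
    have "(f has_real_derivative sympow_d1 p s x + c2 * (p * x powr (p - 1)) + c1 * (2 * x)) (at x)"
      unfolding f_def[abs_def] using that p
      by (auto intro!: derivative_eq_intros has_real_derivative_sympow)
    then show ?thesis unfolding e N_def using that by (simp add: algebra_simps)
  qed
  have d': "(N has_real_derivative N' x) (at x)" if "x > 0" for x
  proof -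
    have "(N has_real_derivative (sympow_d2 p s x * x - sympow_d1 p s x) / (x * x)
        + c2 * p * ((p - 2) * x powr (p - 3))) (at x)"
      unfolding N_def[abs_def] using that p
      by (auto intro!: derivative_eq_intros has_real_derivative_sympow_d1)
    moreover have "sympow_d2 p s x * x - sympow_d1 p s x = x * x * x powr (p - 3) * curv p (s / x)"
      using sympow_curv[OF that, of p s] that powr_add[of x 2 "p - 3"]
      by (simp add: power2_eq_square mult.commute)
    ultimately show ?thesis using that by (simp add: N'_def algebra_simps)
  qed
  obtain \<xi>1 where x1: "t1 < \<xi>1" "\<xi>1 < t2" "N \<xi>1 = 0"
    using Rolle_pos[of t1 t2 f "\<lambda>x. x * N x"] t z1 z2 d by force
  obtain \<xi>2 where x2: "t2 < \<xi>2" "\<xi>2 < t3" "N \<xi>2 = 0"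
    using Rolle_pos[of t2 t3 f "\<lambda>x. x * N x"] t z2 z3 d by force
  obtain x0 where x0: "\<xi>1 < x0" "x0 < \<xi>2" "N' x0 = 0"
    using Rolle_pos[of \<xi>1 \<xi>2 N N'] x1 x2 t d' by force
  then have k: "curv p (s / x0) + c2 * p * (p - 2) = 0" using x1 t by (auto simp: N'_def)
  have pos0: "0 < \<xi>1" "0 < x0" using x1 x0 t by auto
  \<comment> \<open>As x grows, s / x falls, so by monotonicity of \<open>curv\<close> the bracket
    in \<open>N'\<close> decreases and changes sign from + to - at x0. Hence N rises and then falls,
    with zeros at \<xi>1 and \<xi>2, and f falls, rises and falls again.\<close>
  have N'_pos: "N' x > 0" if "0 < x" "x < x0" for x
    using curv_strict_mono[OF p, of "s / x0" "s / x"] k that s pos0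
    unfolding N'_def by (intro mult_pos_pos) (auto simp: field_simps)
  have N'_neg: "N' x < 0" if "x0 < x" for x
    using curv_strict_mono[OF p, of "s / x" "s / x0"] k that s pos0
    unfolding N'_def by (intro mult_pos_neg) (auto simp: field_simps)
  have N_inc: "N x \<le> N y" if "0 < x" "x \<le> y" "y \<le> x0" for x y
    using that by (intro deriv_nonneg_le[of x y N N'] d') (auto intro!: less_imp_le[OF N'_pos])
  have N_dec: "N y \<le> N x" if "x0 \<le> x" "x \<le> y" for x y
  proof -
    have "- N x \<le> - N y"
      using that pos0 by (intro deriv_nonneg_le[of x y "\<lambda>x. - N x" "\<lambda>x. - N' x"] DERIV_minus d')
        (auto intro!: less_imp_le[OF N'_neg])
    then show ?thesis by simp
  qed
  have N1: "N x \<le> 0" if "0 < x" "x \<le> \<xi>1" for x using N_inc[of x \<xi>1] x1 x0 that by simp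
  have N2: "N x \<ge> 0" if "\<xi>1 \<le> x" "x \<le> \<xi>2" for x
    using N_inc[of \<xi>1 x] N_dec[of x \<xi>2] x1 x2 x0 that pos0 by (cases "x \<le> x0") simp_all
  have N3: "N x \<le> 0" if "\<xi>2 \<le> x" for x using N_dec[of \<xi>2 x] x2 x0 that by simp
  have f1: "f y \<le> f x" if "0 < x" "x \<le> y" "y \<le> \<xi>1" for x y
  proof -
    have "- f x \<le> - f y"
      using that by (intro deriv_nonneg_le[of x y "\<lambda>x. - f x" "\<lambda>x. - (x * N x)"] DERIV_minus d)
        (auto intro!: mult_nonneg_nonpos N1)
    then show ?thesis by simp
  qed
  have f2: "f x \<le> f y" if "\<xi>1 \<le> x" "x \<le> y" "y \<le> \<xi>2" for x y
    using that pos0 by (intro deriv_nonneg_le[of x y f "\<lambda>x. x * N x"] d)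
      (auto intro!: mult_nonneg_nonneg N2)
  have f3: "f y \<le> f x" if "\<xi>2 \<le> x" "x \<le> y" for x y
  proof -
    have "- f x \<le> - f y"
      using that pos0 x0
      by (intro deriv_nonneg_le[of x y "\<lambda>x. - f x" "\<lambda>x. - (x * N x)"] DERIV_minus d)
        (auto intro!: mult_nonneg_nonpos N3)
    then show ?thesis by simp
  qed
  show ?thesis
  proof (rule that[of c2 c1 c0], goal_cases)
    case (1 x) then show ?case using f1[of x t1] x1 z1 by (simp add: f_def)
  next
    case (2 x) then show ?case
      using f1[of t1 x] f2[of x t2] x1 x2 z1 z2 t by (cases "x \<le> \<xi>1") (simp_all add: f_def)
  next
    case (3 x) then show ?case
      using f2[of t2 x] f3[of x t3] x1 x2 z3 z2 t by (cases "x \<le> \<xi>2") (simp_all add: f_def)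
  next
    case (4 x) then show ?case using f3[of t3 x] x2 z3 by (simp add: f_def)
  qed
qed

section \<open>Functions with vanishing moments\<close>

text \<open>What the sign arguments retain of the difference of two even densities with equal mass,
  second moment and p-th absolute moment.\<close>

definition null_moments :: "real \<Rightarrow> (real \<Rightarrow> real) \<Rightarrow> bool" where
  "null_moments p D \<longleftrightarrow> (\<forall>x. D (- x) = D x) \<and>
     has_bochner_integral lborel D 0 \<and>
     has_bochner_integral lborel (\<lambda>x. x\<^sup>2 * D x) 0 \<and>
     has_bochner_integral lborel (\<lambda>x. \<bar>x\<bar> powr p * D x) 0"

lemma null_moments_abs: "null_moments p D \<Longrightarrow> D \<bar>x\<bar> = D x"
  by (auto simp: null_moments_def abs_if)

lemma null_moments_lincomb:
  assumes "null_moments p D"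
  shows "has_bochner_integral lborel (\<lambda>x. D x * (c2 * \<bar>x\<bar> powr p + c1 * x\<^sup>2 + c0)) 0"
proof -
  have "has_bochner_integral lborel (\<lambda>x. c2 * (\<bar>x\<bar> powr p * D x) + c1 * (x\<^sup>2 * D x) + c0 * D x)
      (c2 * 0 + c1 * 0 + c0 * 0)"
    using assms unfolding null_moments_def
    by (intro has_bochner_integral_add has_bochner_integral_mult_right) auto
  then show ?thesis by (simp add: algebra_simps)
qed

lemma AE_lborel_abs_notin:
  fixes T :: "real set"
  assumes "finite T"
  shows "AE x in lborel. x \<noteq> 0 \<and> \<bar>x\<bar> \<notin> T"
proof -
  have "AE x in lborel. x \<notin> {0} \<union> T \<union> uminus ` T"
    using assms by (intro AE_not_in finite_imp_null_set_lborel) auto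
  then show ?thesis
  proof eventually_elim
    case (elim x)
    then have "x \<noteq> 0" "x \<notin> T" "- x \<notin> T" by (auto simp: image_iff)
    then show ?case by (simp add: abs_if)
  qed
qed

text \<open>The product of D with the combination has integral 0; being nonnegative off a null set
  it vanishes almost everywhere, and then so does D. The finite set T absorbs nodes and sign
  changes, and evenness of D reduces everything to x > 0.\<close>

lemma null_moments_AE_zero:
  assumes D: "null_moments p D" and T: "finite T"
    and sgn: "\<And>x. x > 0 \<Longrightarrow> x \<notin> T \<Longrightarrow> 0 \<le> D x * (c2 * x powr p + c1 * x\<^sup>2 + c0)"
    and nz: "\<And>x. x > 0 \<Longrightarrow> x \<notin> T \<Longrightarrow> c2 * x powr p + c1 * x\<^sup>2 + c0 \<noteq> 0"
  shows "AE x in lborel. D x = 0"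
proof -
  let ?g = "\<lambda>x. c2 * \<bar>x\<bar> powr p + c1 * x\<^sup>2 + c0"
  note I = null_moments_lincomb[OF D, of c2 c1 c0]
  have ae: "AE x in lborel. 0 \<le> D x * ?g x \<and> ?g x \<noteq> 0"
    using AE_lborel_abs_notin[OF T]
  proof eventually_elim
    case (elim x)
    then show ?case using sgn[of "\<bar>x\<bar>"] nz[of "\<bar>x\<bar>"] null_moments_abs[OF D, of x] by simp
  qed
  then have "AE x in lborel. 0 \<le> D x * ?g x" by eventually_elim auto
  then have "AE x in lborel. D x * ?g x = 0"
    using I integral_nonneg_eq_0_iff_AE[of lborel "\<lambda>x. D x * ?g x"]
    unfolding has_bochner_integral_iff by blast
  with ae show ?thesis by eventually_elim auto
qed

text \<open>A sign pattern with at most two changes is matched by a nonzero combination of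
  \<open>1, x\<^sup>2, x powr p\<close> and hence impossible for a nonzero function with null moments.\<close>

lemma null_moments_interval_AE_zero:
  assumes D: "null_moments p D" and p: "p > 2" and T: "finite T"
    and P: "\<And>x y z. x \<in> P \<Longrightarrow> y \<in> P \<Longrightarrow> x \<le> z \<Longrightarrow> z \<le> y \<Longrightarrow> z \<in> P"
    and pos: "\<And>x. x > 0 \<Longrightarrow> x \<notin> T \<Longrightarrow> x \<in> P \<Longrightarrow> 0 \<le> D x"
    and neg: "\<And>x. x > 0 \<Longrightarrow> x \<notin> T \<Longrightarrow> x \<notin> P \<Longrightarrow> D x \<le> 0"
  shows "AE x in lborel. D x = 0"
proof -
  \<comment> \<open>The infimum and supremum of Q are the possible sign changes, and the shape of Q
    selects the combination: -1 if Q has no interior, x^2 - t1^2 if it is unbounded, t2^2 - x^2 if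
    it is bounded and starts at 0, and otherwise minus the interpolant with nodes t1 and t2.\<close>
  define Q where "Q = P \<inter> {0<..}"
  have Q: "bdd_below Q" unfolding Q_def by (intro bdd_belowI[of _ 0]) auto
  define t1 where "t1 = Inf Q"
  show ?thesis
  proof (cases "Q = {}")
    case True
    then show ?thesis
      by (intro null_moments_AE_zero[OF D T, of 0 0 "-1"]) (auto simp: Q_def intro: neg)
  next
    case False
    have t1: "0 \<le> t1" unfolding t1_def using False by (intro cInf_greatest) (auto simp: Q_def)
    have below: "x \<notin> P" if "0 < x" "x < t1" for x
      using cInf_lower[OF _ Q, of x] that by (auto simp: Q_def t1_def)
    show ?thesis
    proof (cases "bdd_above Q")
      case False
      have inP: "x \<in> P" if x: "t1 < x" for x
      proof -
        obtain y z where "y \<in> Q" "y < x" "z \<in> Q" "x < z"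
          using cInf_lessD[OF \<open>Q \<noteq> {}\<close>, of x] x False
          unfolding t1_def bdd_above_def by (meson not_le)
        then show ?thesis using P[of y z x] by (auto simp: Q_def)
      qed
      have sq: "t1\<^sup>2 < x\<^sup>2" if "t1 < x" for x using that t1 by (intro power_strict_mono) auto
      have sq': "x\<^sup>2 < t1\<^sup>2" if "x < t1" "0 < x" for x using that by (intro power_strict_mono) auto
      show ?thesis
      proof (rule null_moments_AE_zero[OF D, of "insert t1 T" 0 1 "- t1\<^sup>2"])
        fix x assume "0 < x" "x \<notin> insert t1 T"
        then consider "x < t1" "x \<notin> T" "0 < x" | "t1 < x" "x \<notin> T" "0 < x" by fastforce
        then show "0 \<le> D x * (0 * x powr p + 1 * x\<^sup>2 + - t1\<^sup>2)"
          by cases (use pos[of x] neg[of x] inP[of x] below[of x] sq[of x] sq'[of x]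
            in \<open>auto intro: mult_nonneg_nonneg mult_nonpos_nonpos\<close>)
        show "0 * x powr p + 1 * x\<^sup>2 + - t1\<^sup>2 \<noteq> 0"
          using \<open>0 < x\<close> \<open>x \<notin> insert t1 T\<close> sq[of x] sq'[of x] by (cases x t1 rule: linorder_cases) auto
      qed (use T in simp)
    next
      case True
      define t2 where "t2 = Sup Q"
      have t12: "t1 \<le> t2" unfolding t1_def t2_def using False Q True by (intro cInf_le_cSup) auto
      have above: "x \<notin> P" if "0 < x" "t2 < x" for x
        using cSup_upper[OF _ True, of x] that by (auto simp: Q_def t2_def)
      have inP: "x \<in> P" if x: "t1 < x" "x < t2" for x
      proof -
        obtain y z where "y \<in> Q" "y < x" "z \<in> Q" "x < z"
          using cInf_lessD[OF False, of x] less_cSupD[OF False, of x] x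
          unfolding t1_def t2_def by blast
        then show ?thesis using P[of y z x] by (auto simp: Q_def)
      qed
      consider "t1 = t2" | "t1 = 0" "t1 < t2" | "0 < t1" "t1 < t2" using t1 t12 by linarith
      then show ?thesis
      proof cases
        case 1
        show ?thesis
          by (rule null_moments_AE_zero[OF D, of "insert t1 T" 0 0 "-1"])
            (use T 1 below above neg in \<open>auto simp: not_less_iff_gr_or_eq dest!: neq_iff[THEN iffD1]\<close>)
      next
        case 2
        have sq: "t2\<^sup>2 < x\<^sup>2" if "t2 < x" for x using that 2 by (intro power_strict_mono) auto
        have sq': "x\<^sup>2 < t2\<^sup>2" if "x < t2" "0 < x" for x using that by (intro power_strict_mono) auto
        show ?thesis
        proof (rule null_moments_AE_zero[OF D, of "insert t2 T" 0 "-1" "t2\<^sup>2"])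
          fix x assume "0 < x" "x \<notin> insert t2 T"
          then consider "x < t2" "x \<notin> T" "0 < x" | "t2 < x" "x \<notin> T" "0 < x" by fastforce
          then show "0 \<le> D x * (0 * x powr p + -1 * x\<^sup>2 + t2\<^sup>2)"
            by cases (use 2 pos[of x] neg[of x] inP[of x] above[of x] sq[of x] sq'[of x]
              in \<open>auto intro: mult_nonneg_nonneg mult_nonpos_nonpos\<close>)
          show "0 * x powr p + -1 * x\<^sup>2 + t2\<^sup>2 \<noteq> 0"
            using \<open>0 < x\<close> \<open>x \<notin> insert t2 T\<close> sq[of x] sq'[of x] by (cases x t2 rule: linorder_cases) auto
        qed (use T in simp)
      next
        case 3
        obtain c0 c1 where c:
          "\<And>x. 0 < x \<Longrightarrow> x < t1 \<Longrightarrow> x powr p + c1 * x\<^sup>2 + c0 > 0"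
          "\<And>x. t1 < x \<Longrightarrow> x < t2 \<Longrightarrow> x powr p + c1 * x\<^sup>2 + c0 < 0"
          "\<And>x. t2 < x \<Longrightarrow> x powr p + c1 * x\<^sup>2 + c0 > 0"
          using powr_interpolation_signs[OF p 3] by metis
        show ?thesis
        proof (rule null_moments_AE_zero[OF D, of "insert t1 (insert t2 T)" "-1" "-c1" "-c0"])
          fix x assume x: "0 < x" "x \<notin> insert t1 (insert t2 T)"
          let ?e = "-1 * x powr p + -c1 * x\<^sup>2 + -c0"
          have e: "?e = - (x powr p + c1 * x\<^sup>2 + c0)" by simp
          consider "x < t1" | "t1 < x" "x < t2" | "t2 < x" using x by fastforce
          then have "0 \<le> D x * ?e \<and> ?e \<noteq> 0"
          proof cases
            case 1
            then have "D x \<le> 0" using below neg x by auto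
            then show ?thesis unfolding e using c(1)[OF x(1) 1] by (auto intro: mult_nonpos_nonpos)
          next
            case 2
            then have "D x \<ge> 0" using inP pos x by auto
            then show ?thesis unfolding e using c(2)[OF 2] by (auto intro: mult_nonneg_nonneg)
          next
            case 3
            then have "D x \<le> 0" using above neg x by auto
            then show ?thesis unfolding e using c(3)[OF 3] by (auto intro: mult_nonpos_nonpos)
          qed
          then show "0 \<le> D x * ?e" "?e \<noteq> 0" by auto
        qed (use T in simp)
      qed
    qed
  qed
qed

section \<open>Moments of a shifted even function\<close>

lemma sympow_abs: "sympow p s \<bar>x\<bar> = sympow p s x"
proof -
  have "\<bar>- x + s\<bar> = \<bar>x - s\<bar>" "\<bar>- x - s\<bar> = \<bar>x + s\<bar>" by arith+
  then show ?thesis by (cases "x \<ge> 0") (simp_all add: sympow_def)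
qed

lemma sympow_abs_shift: "sympow p \<bar>s\<bar> x = sympow p s x"
  by (cases "s \<ge> 0") (simp_all add: sympow_def add.commute)

lemma abs_add_powr_le:
  fixes x s p :: real
  assumes "p > 0"
  shows "\<bar>x + s\<bar> powr p \<le> 2 powr p * (\<bar>x\<bar> powr p + \<bar>s\<bar> powr p)"
proof -
  have "\<bar>x + s\<bar> powr p \<le> (2 * max \<bar>x\<bar> \<bar>s\<bar>) powr p" using assms by (intro powr_mono2) auto
  also have "\<dots> = 2 powr p * (max \<bar>x\<bar> \<bar>s\<bar>) powr p" by (simp add: powr_mult)
  also have "(max \<bar>x\<bar> \<bar>s\<bar>) powr p \<le> \<bar>x\<bar> powr p + \<bar>s\<bar> powr p" by (simp add: max_def)
  finally show ?thesis by simp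
qed

lemma integrable_abs_add_powr:
  assumes p: "p > 0" and "integrable lborel f" and "integrable lborel (\<lambda>x. \<bar>x\<bar> powr p * f x)"
  shows "integrable lborel (\<lambda>x. \<bar>x + s\<bar> powr p * f x :: real)"
proof (rule Bochner_Integration.integrable_bound)
  show "integrable lborel (\<lambda>x. 2 powr p * \<bar>\<bar>x\<bar> powr p * f x\<bar> + 2 powr p * \<bar>s\<bar> powr p * \<bar>f x\<bar>)"
    using assms by auto
  have [measurable]: "f \<in> borel_measurable lborel" using assms by auto
  show "(\<lambda>x. \<bar>x + s\<bar> powr p * f x) \<in> borel_measurable lborel" by measurable
  show "AE x in lborel. norm (\<bar>x + s\<bar> powr p * f x)
      \<le> norm (2 powr p * \<bar>\<bar>x\<bar> powr p * f x\<bar> + 2 powr p * \<bar>s\<bar> powr p * \<bar>f x\<bar>)"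
  proof (rule AE_I2)
    fix x
    have "\<bar>x + s\<bar> powr p * \<bar>f x\<bar> \<le> (2 powr p * (\<bar>x\<bar> powr p + \<bar>s\<bar> powr p)) * \<bar>f x\<bar>"
      using abs_add_powr_le[OF p] by (intro mult_right_mono) auto
    then show "norm (\<bar>x + s\<bar> powr p * f x)
      \<le> norm (2 powr p * \<bar>\<bar>x\<bar> powr p * f x\<bar> + 2 powr p * \<bar>s\<bar> powr p * \<bar>f x\<bar>)"
      by (simp add: abs_mult algebra_simps)
  qed
qed

text \<open>Reflection gives the same value for the shifts s and -s, so the integral equals the
  average of the two. As \<open>sympow\<close> is even in s, its argument may be replaced by |s|,
  which makes the interpolation lemma for positive s applicable.\<close>

lemma integral_even_abs_add_powr:
  assumes p: "p > 0" and I: "integrable lborel f" "integrable lborel (\<lambda>x. \<bar>x\<bar> powr p * f x)"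
    and even: "\<And>x. f (- x) = (f x :: real)"
  shows "has_bochner_integral lborel (\<lambda>x. f x * sympow p \<bar>s\<bar> x) (\<integral>x. \<bar>x + s\<bar> powr p * f x \<partial>lborel)"
proof -
  have 1: "integrable lborel (\<lambda>x. \<bar>x + s\<bar> powr p * f x)" for s
    by (rule integrable_abs_add_powr[OF p I])
  have 2: "(\<integral>x. \<bar>x + - s\<bar> powr p * f x \<partial>lborel) = (\<integral>x. \<bar>x + s\<bar> powr p * f x \<partial>lborel)"
  proof -
    have "\<bar>0 + -1 * x + - s\<bar> = \<bar>x + s\<bar>" for x by arith
    moreover have "f (0 + -1 * x) = f x" for x using even by simp
    moreover have "(\<integral>x. \<bar>x + - s\<bar> powr p * f x \<partial>lborel) =
        \<bar>-1\<bar> *\<^sub>R (\<integral>x. \<bar>0 + -1 * x + - s\<bar> powr p * f (0 + -1 * x) \<partial>lborel)"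
      by (rule lborel_integral_real_affine) simp
    ultimately show ?thesis by (simp only: abs_minus_cancel abs_one scaleR_one)
  qed
  have "has_bochner_integral lborel (\<lambda>x. 1 / 2 * (\<bar>x + s\<bar> powr p * f x) + 1 / 2 * (\<bar>x + - s\<bar> powr p * f x))
    (1 / 2 * (\<integral>x. \<bar>x + s\<bar> powr p * f x \<partial>lborel) + 1 / 2 * (\<integral>x. \<bar>x + - s\<bar> powr p * f x \<partial>lborel))"
    using 1[of s] 1[of "- s"]
    by (intro has_bochner_integral_add has_bochner_integral_mult_right has_bochner_integral_integrable) auto
  moreover have "1 / 2 * (\<bar>x + s\<bar> powr p * f x) + 1 / 2 * (\<bar>x + - s\<bar> powr p * f x) = f x * sympow p \<bar>s\<bar> x" for x
    unfolding sympow_abs_shift unfolding sympow_def by (simp add: algebra_simps)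
  ultimately show ?thesis unfolding 2 by simp
qed

text \<open>For three distinct positive nodes and s nonzero, D and the interpolation error have a
  nonnegative product off the nodes, and adding the interpolating combination to
  \<open>sympow\<close> does not change the integral against D. If t1 = 0 or two nodes coincide, at
  most two changes remain and D vanishes almost everywhere; for s = 0 the integral is the vanishing
  p-th moment.\<close>

lemma null_moments_three_changes:
  assumes D: "null_moments p D" and p: "p > 4" and t: "0 \<le> t1" "t1 \<le> t2" "t2 \<le> t3"
    and sg: "\<And>x. 0 < x \<Longrightarrow> x < t1 \<Longrightarrow> 0 \<le> D x" "\<And>x. t1 < x \<Longrightarrow> x < t2 \<Longrightarrow> D x \<le> 0"
      "\<And>x. t2 < x \<Longrightarrow> x < t3 \<Longrightarrow> 0 \<le> D x" "\<And>x. t3 < x \<Longrightarrow> D x \<le> 0"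
  shows "0 \<le> (\<integral>x. \<bar>x + s\<bar> powr p * D x \<partial>lborel)"
proof -
  have zero: ?thesis if "AE x in lborel. D x = 0"
  proof -
    have "AE x in lborel. \<bar>x + s\<bar> powr p * D x = 0" using that by eventually_elim auto
    then show ?thesis by (simp add: integral_eq_zero_AE)
  qed
  have p': "p > 2" "p > 0" using p by auto
  \<comment> \<open>The sign hypotheses are silent at the nodes, which therefore form the
    exceptional set.\<close>
  note itv = null_moments_interval_AE_zero[OF D p'(1), of "{t1, t2, t3}"]
  consider "s = 0" | "t1 = 0" | "t1 = t2" | "t2 = t3" | "s \<noteq> 0" "0 < t1" "t1 < t2" "t2 < t3"
    using t by linarith
  then show ?thesis
  proof cases
    case 1
    then show ?thesis using D by (simp add: null_moments_def has_bochner_integral_iff)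
  next
    case 2
    show ?thesis
    proof (rule zero[OF itv[of "{t2<..<t3}"]], goal_cases)
      case (4 x)
      then consider "x < t2" | "t3 < x" by force
      then show ?case using 4 2 sg(2)[of x] sg(4)[of x] by cases auto
    qed (use sg(3) in auto)
  next
    case 3
    show ?thesis
    proof (rule zero[OF itv[of "{..<t3}"]], goal_cases)
      case (3 x)
      then consider "x < t1" | "t2 < x" using \<open>t1 = t2\<close> by force
      then show ?case using 3 sg(1)[of x] sg(3)[of x] by cases auto
    qed (use sg(4) in auto)
  next
    case 4
    show ?thesis
    proof (rule zero[OF itv[of "{..<t1}"]], goal_cases)
      case (4 x)
      then consider "t1 < x" "x < t2" | "t3 < x" using \<open>t2 = t3\<close> by force
      then show ?case using 4 sg(2)[of x] sg(4)[of x] by cases auto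
    qed (use sg(1) in auto)
  next
    case 5
    then have s: "\<bar>s\<bar> > 0" by simp
    obtain c0 c1 c2 where c:
      "\<And>x. 0 < x \<Longrightarrow> x \<le> t1 \<Longrightarrow> sympow p \<bar>s\<bar> x + c2 * x powr p + c1 * x\<^sup>2 + c0 \<ge> 0"
      "\<And>x. t1 \<le> x \<Longrightarrow> x \<le> t2 \<Longrightarrow> sympow p \<bar>s\<bar> x + c2 * x powr p + c1 * x\<^sup>2 + c0 \<le> 0"
      "\<And>x. t2 \<le> x \<Longrightarrow> x \<le> t3 \<Longrightarrow> sympow p \<bar>s\<bar> x + c2 * x powr p + c1 * x\<^sup>2 + c0 \<ge> 0"
      "\<And>x. t3 \<le> x \<Longrightarrow> sympow p \<bar>s\<bar> x + c2 * x powr p + c1 * x\<^sup>2 + c0 \<le> 0"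
      using sympow_interpolation_signs[OF p s 5(2-4)] by metis
    let ?f = "\<lambda>x. D x * sympow p \<bar>s\<bar> x + D x * (c2 * \<bar>x\<bar> powr p + c1 * x\<^sup>2 + c0)"
    have "has_bochner_integral lborel ?f ((\<integral>x. \<bar>x + s\<bar> powr p * D x \<partial>lborel) + 0)"
      using D
      by (intro has_bochner_integral_add integral_even_abs_add_powr p' null_moments_lincomb)
        (auto simp: null_moments_def has_bochner_integral_iff)
    moreover have "finite {t1, t2, t3}" by simp
    from AE_lborel_abs_notin[OF this] have "AE x in lborel. 0 \<le> ?f x"
    proof eventually_elim
      case (elim x)
      have e: "?f x = D \<bar>x\<bar> * (sympow p \<bar>s\<bar> \<bar>x\<bar> + c2 * \<bar>x\<bar> powr p + c1 * \<bar>x\<bar>\<^sup>2 + c0)"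
        using null_moments_abs[OF D, of x] by (simp add: sympow_abs algebra_simps)
      consider "0 < \<bar>x\<bar>" "\<bar>x\<bar> < t1" | "t1 < \<bar>x\<bar>" "\<bar>x\<bar> < t2" | "t2 < \<bar>x\<bar>" "\<bar>x\<bar> < t3" | "t3 < \<bar>x\<bar>"
        using elim by fastforce
      then show ?case unfolding e
        by cases (use sg[of "\<bar>x\<bar>"] c[of "\<bar>x\<bar>"] in
          \<open>auto intro!: mult_nonneg_nonneg mult_nonpos_nonpos\<close>)
    qed
    ultimately show ?thesis
      using integral_nonneg_AE[of ?f lborel] by (simp add: has_bochner_integral_iff)
  qed
qed

section \<open>Comparison with the extremal densities\<close>

text \<open>The inequality is required only where h is positive, so that \<open>ln\<close> is never
  taken at 0. Positivity at the intermediate point, part of the conclusion, encodes convexity of the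
  set where h is positive.\<close>

definition lconc :: "(real \<Rightarrow> real) \<Rightarrow> bool" where
  "lconc h \<longleftrightarrow> (\<forall>x. 0 \<le> h x) \<and>
     (\<forall>x y t. 0 \<le> t \<longrightarrow> t \<le> 1 \<longrightarrow> 0 < h x \<longrightarrow> 0 < h y \<longrightarrow>
        0 < h ((1 - t) * x + t * y) \<and>
        (1 - t) * ln (h x) + t * ln (h y) \<le> ln (h ((1 - t) * x + t * y)))"

lemma lconcD:
  assumes "lconc h" "0 \<le> t" "t \<le> 1" "0 < h x" "0 < h y"
  shows "0 < h ((1 - t) * x + t * y)"
    "(1 - t) * ln (h x) + t * ln (h y) \<le> ln (h ((1 - t) * x + t * y))"
  using assms by (simp_all add: lconc_def)

lemma lconc_exp_neg:
  assumes "convex_ereal \<phi>"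
  shows "lconc (\<lambda>x. exp_neg (\<phi> x))"
  unfolding lconc_def
proof (intro conjI allI impI)
  fix x y t :: real
  show "0 \<le> exp_neg (\<phi> x)" by (simp add: exp_neg_def)
  assume t: "0 \<le> t" "t \<le> 1" and "0 < exp_neg (\<phi> x)" "0 < exp_neg (\<phi> y)"
  then have "\<phi> x \<noteq> \<infinity>" "\<phi> y \<noteq> \<infinity>" "\<phi> x \<noteq> -\<infinity>" "\<phi> y \<noteq> -\<infinity>"
    using assms by (auto simp: exp_neg_def convex_ereal_def)
  then obtain u v where uv: "\<phi> x = ereal u" "\<phi> y = ereal v"
    by (cases "\<phi> x"; cases "\<phi> y") auto
  have "\<phi> ((1 - t) * x + t * y) \<le> ereal (1 - t) * \<phi> x + ereal t * \<phi> y"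
    "\<phi> ((1 - t) * x + t * y) \<noteq> -\<infinity>"
    using assms t by (auto simp: convex_ereal_def)
  then obtain w where w: "\<phi> ((1 - t) * x + t * y) = ereal w" "w \<le> (1 - t) * u + t * v"
    unfolding uv by (cases "\<phi> ((1 - t) * x + t * y)") auto
  show "0 < exp_neg (\<phi> ((1 - t) * x + t * y))" by (simp add: w exp_neg_def)
  show "(1 - t) * ln (exp_neg (\<phi> x)) + t * ln (exp_neg (\<phi> y)) \<le> ln (exp_neg (\<phi> ((1 - t) * x + t * y)))"
    using w(2) by (simp add: w(1) uv exp_neg_def)
qed

text \<open>The geometric mean of h and its reflection is even at every point and, when h is even
  almost everywhere, agrees with h almost everywhere. On the logarithmic scale it is an average of
  two concave functions.\<close>

lemma lconc_symmetrize:
  assumes "lconc h"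
  shows "lconc (\<lambda>x. sqrt (h x * h (- x)))"
  unfolding lconc_def
proof (intro conjI allI impI)
  fix x y t :: real
  have h0: "0 \<le> h z" for z using assms by (auto simp: lconc_def)
  show "0 \<le> sqrt (h x * h (- x))" using h0 by simp
  assume t: "0 \<le> t" "t \<le> 1" and "0 < sqrt (h x * h (- x))" "0 < sqrt (h y * h (- y))"
  then have "0 < h x * h (- x)" "0 < h y * h (- y)" by simp_all
  then have pos: "0 < h x" "0 < h (- x)" "0 < h y" "0 < h (- y)"
    using h0[of x] h0[of "- x"] h0[of y] h0[of "- y"] by (auto simp: zero_less_mult_iff)
  have e: "- ((1 - t) * x + t * y) = (1 - t) * (- x) + t * (- y)" by (simp add: algebra_simps)
  have A: "0 < h ((1 - t) * x + t * y)"
      "(1 - t) * ln (h x) + t * ln (h y) \<le> ln (h ((1 - t) * x + t * y))"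
    using lconcD[OF assms t] pos by auto
  have B: "0 < h (- ((1 - t) * x + t * y))"
      "(1 - t) * ln (h (- x)) + t * ln (h (- y)) \<le> ln (h (- ((1 - t) * x + t * y)))"
    using lconcD[OF assms t, of "- x" "- y"] pos unfolding e by auto
  show "0 < sqrt (h ((1 - t) * x + t * y) * h (- ((1 - t) * x + t * y)))"
    using A B by simp
  show "(1 - t) * ln (sqrt (h x * h (- x))) + t * ln (sqrt (h y * h (- y)))
     \<le> ln (sqrt (h ((1 - t) * x + t * y) * h (- ((1 - t) * x + t * y))))"
    using A B pos by (simp add: ln_sqrt ln_mult field_simps)
qed

text \<open>On the logarithmic scale, a concave function that lies above an affine one at two points
  does so between them. Hence {h >= f} is an interval wherever log f is affine, and this is what
  bounds the number of sign changes.\<close>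

lemma lconc_loglinear:
  assumes h: "lconc h" and C: "C > 0" and xyz: "x \<le> z" "z \<le> y"
    and x: "C * exp (- (g * x)) \<le> h x" and y: "C * exp (- (g * y)) \<le> h y"
  shows "C * exp (- (g * z)) \<le> h z"
proof (cases "x = y")
  case False
  define t where "t = (z - x) / (y - x)"
  have t: "0 \<le> t" "t \<le> 1" using xyz False by (auto simp: t_def)
  have "t * (y - x) = z - x" using False by (simp add: t_def)
  then have z: "z = (1 - t) * x + t * y" by (simp add: algebra_simps)
  have pos: "0 < h x" "0 < h y" using less_le_trans[OF _ x] less_le_trans[OF _ y] C by simp_all
  then have hz: "0 < h z" "(1 - t) * ln (h x) + t * ln (h y) \<le> ln (h z)"
    using h t unfolding z by (auto simp: lconc_def)
  have l: "ln C - g * w \<le> ln (h w)" if "C * exp (- (g * w)) \<le> h w" for w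
    using ln_mono[OF that] C by (simp add: ln_mult)
  have "ln C - g * z = (1 - t) * (ln C - g * x) + t * (ln C - g * y)"
    unfolding z by (simp add: algebra_simps)
  also have "\<dots> \<le> (1 - t) * ln (h x) + t * ln (h y)"
    using l[OF x] l[OF y] t by (intro add_mono mult_left_mono) auto
  also have "\<dots> \<le> ln (h z)" by (rule hz)
  finally have "exp (ln C - g * z) \<le> exp (ln (h z))" by simp
  then show ?thesis using hz C by (simp add: exp_diff exp_minus field_simps)
qed (use assms in simp)

text \<open>Between -y and y, where the values agree by evenness, h stays above the constant h y;
  this is the case of slope 0 in \<open>lconc_loglinear\<close>.\<close>

lemma lconc_even_antimono:
  assumes h: "lconc h" and even: "\<And>x. h (- x) = h x" and xy: "0 \<le> x" "x \<le> y"
  shows "h y \<le> h x"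
proof (cases "h y > 0")
  case True
  then show ?thesis using lconc_loglinear[OF h True, of "- y" x y 0] even xy by simp
next
  case False
  then show ?thesis using h unfolding lconc_def by (metis linorder_not_less order_trans)
qed

section \<open>Densities with prescribed moments\<close>

definition dens :: "real \<Rightarrow> real \<Rightarrow> real \<Rightarrow> (real \<Rightarrow> real) \<Rightarrow> bool" where
  "dens p a b f \<longleftrightarrow> f \<in> borel_measurable borel \<and> (\<forall>x. 0 \<le> f x) \<and> (\<forall>x. f (- x) = f x) \<and>
     (\<integral>\<^sup>+ x. ennreal (f x) \<partial>lborel) = 1 \<and> density_moments p a b f"

lemma has_bochner_integral_dens:
  assumes "dens p a b f"
  shows "has_bochner_integral lborel f 1"
    "has_bochner_integral lborel (\<lambda>x. x\<^sup>2 * f x) (a\<^sup>2)"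
    "has_bochner_integral lborel (\<lambda>x. \<bar>x\<bar> powr p * f x) (b powr p)"
proof -
  have [measurable]: "f \<in> borel_measurable borel" and f: "\<And>x. 0 \<le> f x"
    and m: "(\<integral>\<^sup>+ x. ennreal (f x) \<partial>lborel) = ennreal 1" "density_moments p a b f"
    using assms by (auto simp: dens_def)
  show "has_bochner_integral lborel f 1"
    using m(1) f by (intro has_bochner_integral_nn_integral) auto
  show "has_bochner_integral lborel (\<lambda>x. x\<^sup>2 * f x) (a\<^sup>2)"
    using m(2) f by (intro has_bochner_integral_nn_integral) (auto simp: density_moments_def)
  show "has_bochner_integral lborel (\<lambda>x. \<bar>x\<bar> powr p * f x) (b powr p)"
    using m(2) f by (intro has_bochner_integral_nn_integral) (auto simp: density_moments_def)
qed

lemma null_moments_diff: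
  assumes h: "dens p a b h" and f: "dens p a b f"
  shows "null_moments p (\<lambda>x. h x - f x)"
  using has_bochner_integral_diff[OF has_bochner_integral_dens(1)[OF h] has_bochner_integral_dens(1)[OF f]]
    has_bochner_integral_diff[OF has_bochner_integral_dens(2)[OF h] has_bochner_integral_dens(2)[OF f]]
    has_bochner_integral_diff[OF has_bochner_integral_dens(3)[OF h] has_bochner_integral_dens(3)[OF f]]
    h f
  by (simp add: null_moments_def right_diff_distrib dens_def)

lemma nn_integral_le_of_diff_nonneg:
  assumes p: "p > 0" and h: "dens p a b h" and f: "dens p a b f"
    and le: "0 \<le> (\<integral>x. \<bar>x + s\<bar> powr p * (h x - f x) \<partial>lborel)"
  shows "(\<integral>\<^sup>+ x. ennreal (\<bar>x + s\<bar> powr p * f x) \<partial>lborel) \<le> (\<integral>\<^sup>+ x. ennreal (\<bar>x + s\<bar> powr p * h x) \<partial>lborel)"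
proof -
  have i: "integrable lborel (\<lambda>x. \<bar>x + s\<bar> powr p * k x)" if "dens p a b k" for k
    using has_bochner_integral_dens[OF that]
    by (intro integrable_abs_add_powr p) (auto simp: has_bochner_integral_iff)
  have e: "(\<integral>\<^sup>+ x. ennreal (\<bar>x + s\<bar> powr p * k x) \<partial>lborel) = ennreal (\<integral>x. \<bar>x + s\<bar> powr p * k x \<partial>lborel)"
    if "dens p a b k" for k
    using that by (intro nn_integral_eq_integral i) (auto simp: dens_def)
  have "(\<integral>x. \<bar>x + s\<bar> powr p * f x \<partial>lborel) \<le> (\<integral>x. \<bar>x + s\<bar> powr p * h x \<partial>lborel)"
    using le i[OF h] i[OF f] by (simp add: right_diff_distrib)
  then show ?thesis by (simp add: e h f ennreal_leI)
qed

lemma F_minus_cases: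
  assumes "f \<in> F_minus"
  obtains (uniform) \<alpha> C where "\<alpha> > 0" "C > 0" "\<And>x. f x = (if \<bar>x\<bar> \<le> \<alpha> then C else 0)"
  | (tail) \<alpha> g C where "\<alpha> \<ge> 0" "g > 0" "C > 0" "\<And>x. f x = C * exp (- (g * max (\<bar>x\<bar> - \<alpha>) 0))"
proof -
  from assms obtain \<alpha> \<gamma> where *: "f = f_dens \<alpha> \<gamma>" "0 \<le> \<alpha>" "0 < \<gamma>" "(\<alpha>, \<gamma>) \<noteq> (0, \<infinity>)"
    by (auto simp: F_minus_def)
  show ?thesis
  proof (cases \<gamma>)
    case (real g)
    then show ?thesis using *
      by (intro tail[of \<alpha> g "1 / (2 * (\<alpha> + 1 / g))"]) (auto simp: f_dens_def add_nonneg_pos)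
  next
    case PInf
    then show ?thesis using *
      by (intro uniform[of \<alpha> "1 / (2 * \<alpha>)"]) (auto simp: f_dens_def indicator_def abs_le_iff)
  qed (use * in auto)
qed

text \<open>Allowing A = \<infinity> and g = 0 puts the truncated exponential, the uniform and the
  two-sided exponential densities into one formula.\<close>

lemma F_plus_cases:
  assumes "f \<in> F_plus"
  obtains A :: ereal and g C where "A > 0" "g \<ge> 0" "C > 0"
    "\<And>x. f x = (if ereal \<bar>x\<bar> \<le> A then C * exp (- (g * \<bar>x\<bar>)) else 0)"
proof -
  from assms obtain \<alpha> \<gamma> where *: "f = g_dens \<alpha> \<gamma>" "0 < \<alpha>" "0 \<le> \<gamma>" "(\<alpha>, \<gamma>) \<noteq> (\<infinity>, 0)"
    by (auto simp: F_plus_def)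
  show ?thesis
  proof (cases \<alpha>)
    case (real r)
    show ?thesis
    proof (cases "\<gamma> = 0")
      case True
      then show ?thesis using * real
        by (intro that[of r 0 "1 / (2 * r)"]) (auto simp: g_dens_def indicator_def abs_le_iff)
    next
      case False
      then show ?thesis using * real
        by (intro that[of r \<gamma> "\<gamma> / (2 * (1 - exp (- (r * \<gamma>))))"]) (auto simp: g_dens_def indicator_def)
    qed
  next
    case PInf
    then show ?thesis using *
      by (intro that[of \<infinity> \<gamma> "\<gamma> / 2"]) (auto simp: g_dens_def)
  qed (use * in auto)
qed

lemma nn_integral_shift_AE_eq:
  assumes "AE x in lborel. h x - f x = (0 :: real)"
  shows "(\<integral>\<^sup>+ x. ennreal (\<bar>x + s\<bar> powr p * f x) \<partial>lborel) = (\<integral>\<^sup>+ x. ennreal (\<bar>x + s\<bar> powr p * h x) \<partial>lborel)"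
proof (rule nn_integral_cong_AE)
  show "AE x in lborel. ennreal (\<bar>x + s\<bar> powr p * f x) = ennreal (\<bar>x + s\<bar> powr p * h x)"
    using assms by eventually_elim simp
qed

text \<open>Consider the signs of h - f on the positive half-line. On the plateau f is constant and
  h is decreasing, giving + then -. On the tail log f is affine, so h is above f on an interval
  only, giving - + -. The two minus stretches join at \<alpha>, hence + - + -. For the uniform
  density, or if h is above f at arbitrarily large points, at most two changes remain and the two
  densities agree almost everywhere.\<close>

lemma F_minus_minimal:
  assumes p: "p > 4" and lc: "lconc h" and h: "dens p a b h" and F: "f \<in> F_minus" and f: "dens p a b f"
  shows "(\<integral>\<^sup>+ x. ennreal (\<bar>x + s\<bar> powr p * f x) \<partial>lborel) \<le> (\<integral>\<^sup>+ x. ennreal (\<bar>x + s\<bar> powr p * h x) \<partial>lborel)"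
proof -
  note D = null_moments_diff[OF h f]
  have D': "null_moments p (\<lambda>x. f x - h x)" by (rule null_moments_diff[OF f h])
  have p': "p > 2" "p > 0" using p by auto
  have h0: "0 \<le> h x" for x using h by (auto simp: dens_def)
  have anti: "h y \<le> h x" if "0 \<le> x" "x \<le> y" for x y
    by (rule lconc_even_antimono[OF lc _ that]) (use h in \<open>auto simp: dens_def\<close>)
  note eqI = order.eq_iff[THEN iffD1, OF nn_integral_shift_AE_eq, THEN conjunct2]
    order.eq_iff[THEN iffD1, OF nn_integral_shift_AE_eq, THEN conjunct1]
  from F show ?thesis
  proof (cases rule: F_minus_cases)
    case (uniform \<alpha> C)
    \<comment> \<open>Past \<alpha> the uniform density is 0, so f - h can be positive only on the
      part of (0, \<alpha>] where h is below C, an interval by monotonicity of h.\<close>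
    have "AE x in lborel. f x - h x = 0"
    proof (rule null_moments_interval_AE_zero[OF D' p'(1), of "{}" "{x. 0 < x \<and> x \<le> \<alpha> \<and> h x < C}"], goal_cases)
      case (2 x y z)
      then show ?case using anti[of x z] by auto
    qed (use uniform h0 in auto)
    then show ?thesis by (rule eqI(1))
  next
    case (tail \<alpha> g C)
    define S2 where "S2 = {x. \<alpha> \<le> x \<and> f x \<le> h x}"
    have f1: "f x = C" if "0 \<le> x" "x \<le> \<alpha>" for x using tail(4)[of x] that by simp
    have f2: "f x = (C * exp (g * \<alpha>)) * exp (- (g * x))" if "\<alpha> \<le> x" for x
      using tail(4)[of x] that tail(1) by (simp add: exp_add[symmetric] algebra_simps)
    have S2: "z \<in> S2" if "x \<in> S2" "y \<in> S2" "x \<le> z" "z \<le> y" for x y z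
      using that lconc_loglinear[OF lc, of "C * exp (g * \<alpha>)" x z y g] tail(3)
      by (auto simp: S2_def f2)
    show ?thesis
    proof (cases "bdd_above S2")
      case False
      have "AE x in lborel. f x - h x = 0"
      proof (rule null_moments_interval_AE_zero[OF D' p'(1), of "{}" "{x. 0 < x \<and> h x < f x}"], goal_cases)
        case (2 x y z)
        show ?case
        proof (cases "z \<le> \<alpha>")
          case True
          then show ?thesis using 2 anti[of x z] f1[of x] f1[of z] by auto
        next
          case z: False
          \<comment> \<open>A point z of \<open>S2\<close> between x and y and a point w of
            \<open>S2\<close> beyond y would force y into \<open>S2\<close>, contrary to h y < f
            y.\<close>
          show ?thesis
          proof (rule ccontr)
            assume "z \<notin> {x. 0 < x \<and> h x < f x}"
            then have "z \<in> S2" using 2 z by (auto simp: S2_def)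
            moreover obtain w where "w \<in> S2" "y < w"
              using False unfolding bdd_above_def by (meson not_le)
            ultimately have "y \<in> S2" using S2[of z w y] 2 by auto
            then show False using 2 by (auto simp: S2_def)
          qed
        qed
      qed auto
      then show ?thesis by (rule eqI(1))
    next
      case True
      \<comment> \<open>The inserted 0 keeps the set nonempty, so that t1 = 0 results when h is
        below C on the whole plateau.\<close>
      define S1 where "S1 = insert 0 {x. 0 \<le> x \<and> x \<le> \<alpha> \<and> C \<le> h x}"
      define t1 where "t1 = Sup S1"
      have b1: "bdd_above S1" unfolding S1_def using tail(1) by (intro bdd_aboveI[of _ \<alpha>]) auto
      have t1: "0 \<le> t1" "t1 \<le> \<alpha>"
        unfolding t1_def using b1 tail(1) by (auto intro!: cSup_upper cSup_least simp: S1_def)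
      have s1: "0 \<le> h x - f x" if x: "0 < x" "x < t1" for x
      proof -
        have "S1 \<noteq> {}" by (simp add: S1_def)
        then obtain w where "w \<in> S1" "x < w"
          using less_cSupD[of S1 x] x unfolding t1_def by blast
        then show ?thesis using x anti[of x w] f1[of x] by (auto simp: S1_def)
      qed
      have s2: "h x - f x \<le> 0" if "t1 < x" "x \<le> \<alpha>" for x
      proof -
        have "x \<notin> S1" using cSup_upper[OF _ b1, of x] that by (auto simp: t1_def)
        then show ?thesis using that t1 f1[of x] by (simp add: S1_def)
      qed
      have "\<exists>t2 t3. \<alpha> \<le> t2 \<and> t2 \<le> t3 \<and> (\<forall>x. \<alpha> < x \<longrightarrow> x < t2 \<longrightarrow> x \<notin> S2) \<and>
          (\<forall>x. t2 < x \<longrightarrow> x < t3 \<longrightarrow> x \<in> S2) \<and> (\<forall>x. t3 < x \<longrightarrow> x \<notin> S2)"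
      proof (cases "S2 = {}")
        case True
        then show ?thesis by (intro exI[of _ \<alpha>]) auto
      next
        case False
        have bb: "bdd_below S2" by (auto simp: S2_def intro!: bdd_belowI)
        show ?thesis
        proof (rule exI[of _ "Inf S2"], rule exI[of _ "Sup S2"], intro conjI allI impI)
          show "\<alpha> \<le> Inf S2" using False by (intro cInf_greatest) (auto simp: S2_def)
          show "Inf S2 \<le> Sup S2" using False bb True by (intro cInf_le_cSup)
          show "x \<notin> S2" if "\<alpha> < x" "x < Inf S2" for x using cInf_lower[OF _ bb, of x] that by auto
          show "x \<notin> S2" if "Sup S2 < x" for x using cSup_upper[OF _ True, of x] that by auto
          show "x \<in> S2" if "Inf S2 < x" "x < Sup S2" for x
            using cInf_lessD[OF False that(1)] less_cSupD[OF False that(2)] S2 by (meson less_imp_le)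
        qed
      qed
      then obtain t2 t3 where t: "\<alpha> \<le> t2" "t2 \<le> t3" "\<And>x. \<alpha> < x \<Longrightarrow> x < t2 \<Longrightarrow> x \<notin> S2"
        "\<And>x. t2 < x \<Longrightarrow> x < t3 \<Longrightarrow> x \<in> S2" "\<And>x. t3 < x \<Longrightarrow> x \<notin> S2" by blast
      have "0 \<le> (\<integral>x. \<bar>x + s\<bar> powr p * (h x - f x) \<partial>lborel)"
      proof (rule null_moments_three_changes[OF D p, of t1 t2 t3], goal_cases)
        case (5 x)
        then show ?case using s2[of x] t(3)[of x] by (cases "x \<le> \<alpha>") (auto simp: S2_def)
      next
        case (6 x)
        then show ?case using t(4)[of x] by (auto simp: S2_def)
      next
        case (7 x)
        then show ?case using t(5)[of x] t(1,2) by (auto simp: S2_def)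
      qed (use t1 t s1 in auto)
      then show ?thesis by (rule nn_integral_le_of_diff_nonneg[OF p'(2) h f])
    qed
  qed
qed

text \<open>Consider the signs of f - h. On the support [0, \<alpha>] log f is affine, so h is above
  f on an interval only, giving + - +; beyond \<alpha> f vanishes, giving -. The end of the support
  is the third node. With infinite support at most two changes are left, and the densities agree
  almost everywhere.\<close>

lemma F_plus_maximal:
  assumes p: "p > 4" and lc: "lconc h" and h: "dens p a b h" and F: "f \<in> F_plus" and f: "dens p a b f"
  shows "(\<integral>\<^sup>+ x. ennreal (\<bar>x + s\<bar> powr p * h x) \<partial>lborel) \<le> (\<integral>\<^sup>+ x. ennreal (\<bar>x + s\<bar> powr p * f x) \<partial>lborel)"
proof -
  note D = null_moments_diff[OF f h]
  have D': "null_moments p (\<lambda>x. h x - f x)" by (rule null_moments_diff[OF h f])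
  have p': "p > 2" "p > 0" using p by auto
  have h0: "0 \<le> h x" for x using h by (auto simp: dens_def)
  from F obtain A g C where A: "A > 0" "g \<ge> 0" "C > 0"
    "\<And>x. f x = (if ereal \<bar>x\<bar> \<le> A then C * exp (- (g * \<bar>x\<bar>)) else 0)"
    by (rule F_plus_cases) blast
  define S where "S = {x. 0 \<le> x \<and> ereal x \<le> A \<and> f x \<le> h x}"
  have S: "z \<in> S" if "x \<in> S" "y \<in> S" "x \<le> z" "z \<le> y" for x y z
  proof -
    have z: "0 \<le> z" "ereal z \<le> A" using that by (auto simp: S_def intro: order_trans[of _ "ereal y"])
    then show ?thesis using that lconc_loglinear[OF lc, of C x z y g] A(3)
      by (auto simp: S_def A(4))
  qed
  show ?thesis
  proof (cases A)
    case PInf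
    have "AE x in lborel. h x - f x = 0"
    proof (rule null_moments_interval_AE_zero[OF D' p'(1), of "{}" S], goal_cases)
      case (2 x y z)
      then show ?case by (rule S)
    qed (use PInf in \<open>auto simp: S_def\<close>)
    then show ?thesis using nn_integral_shift_AE_eq[of h f s p] by simp
  next
    case (real \<alpha>)
    have f0: "f x = 0" if "\<alpha> < x" for x using A(1) that real by (simp add: A(4))
    have "\<exists>t1 t2. 0 \<le> t1 \<and> t1 \<le> t2 \<and> t2 \<le> \<alpha> \<and> (\<forall>x. 0 < x \<longrightarrow> x < t1 \<longrightarrow> x \<notin> S) \<and>
          (\<forall>x. t1 < x \<longrightarrow> x < t2 \<longrightarrow> x \<in> S) \<and> (\<forall>x. t2 < x \<longrightarrow> x < \<alpha> \<longrightarrow> x \<notin> S)"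
    proof (cases "S = {}")
      case True
      then show ?thesis using A(1) real by (intro exI[of _ \<alpha>]) auto
    next
      case False
      have bb: "bdd_below S" "bdd_above S" by (auto simp: S_def real intro!: bdd_belowI bdd_aboveI)
      show ?thesis
      proof (rule exI[of _ "Inf S"], rule exI[of _ "Sup S"], intro conjI allI impI)
        show "0 \<le> Inf S" using False by (intro cInf_greatest) (auto simp: S_def)
        show "Sup S \<le> \<alpha>" using False by (intro cSup_least) (auto simp: S_def real)
        show "Inf S \<le> Sup S" using False bb by (intro cInf_le_cSup)
        show "x \<notin> S" if "0 < x" "x < Inf S" for x using cInf_lower[OF _ bb(1), of x] that by auto
        show "x \<notin> S" if "Sup S < x" "x < \<alpha>" for x using cSup_upper[OF _ bb(2), of x] that by auto
        show "x \<in> S" if "Inf S < x" "x < Sup S" for x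
          using cInf_lessD[OF False that(1)] less_cSupD[OF False that(2)] S by (meson less_imp_le)
      qed
    qed
    then obtain t1 t2 where t: "0 \<le> t1" "t1 \<le> t2" "t2 \<le> \<alpha>" "\<And>x. 0 < x \<Longrightarrow> x < t1 \<Longrightarrow> x \<notin> S"
      "\<And>x. t1 < x \<Longrightarrow> x < t2 \<Longrightarrow> x \<in> S" "\<And>x. t2 < x \<Longrightarrow> x < \<alpha> \<Longrightarrow> x \<notin> S" by blast
    have "0 \<le> (\<integral>x. \<bar>x + s\<bar> powr p * (f x - h x) \<partial>lborel)"
    proof (rule null_moments_three_changes[OF D p, of t1 t2 \<alpha>], goal_cases)
      case (4 x)
      then show ?case using t(4)[of x] t(2,3) by (auto simp: S_def real)
    next
      case (5 x)
      then show ?case using t(5)[of x] by (auto simp: S_def)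
    next
      case (6 x)
      then show ?case using t(6)[of x] t(1,2) by (auto simp: S_def real)
    next
      case (7 x)
      then show ?case using f0[of x] h0[of x] by simp
    qed (use t in auto)
    then show ?thesis by (rule nn_integral_le_of_diff_nonneg[OF p'(2) f h])
  qed (use A in auto)
qed

section \<open>Log-concavity of the extremal densities\<close>

lemma convex_ereal_truncation:
  assumes u: "convex_on UNIV u"
  shows "convex_ereal (\<lambda>x. if ereal \<bar>x\<bar> \<le> A then ereal (u x) else \<infinity>)"
    (is "convex_ereal ?\<phi>")
  unfolding convex_ereal_def
proof (intro conjI allI impI)
  fix x y t :: real
  show "?\<phi> x \<noteq> -\<infinity>" by simp
  assume t: "0 \<le> t" "t \<le> 1"
  \<comment> \<open>The end values of t are treated apart: in \<open>ereal\<close> the product of 0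
    and \<infinity> is 0, so only for 0 < t < 1 does an infinite value at x or y make the right side
    infinite.\<close>
  consider "t = 0" | "t = 1" | "0 < t" "t < 1" using t by linarith
  then show "?\<phi> ((1 - t) * x + t * y) \<le> ereal (1 - t) * ?\<phi> x + ereal t * ?\<phi> y"
  proof cases
    case 3
    show ?thesis
    proof (cases "ereal \<bar>x\<bar> \<le> A \<and> ereal \<bar>y\<bar> \<le> A")
      case True
      have "\<bar>(1 - t) * x + t * y\<bar> \<le> (1 - t) * \<bar>x\<bar> + t * \<bar>y\<bar>"
        using t abs_triangle_ineq[of "(1 - t) * x" "t * y"] by (simp add: abs_mult)
      also have "\<dots> \<le> max \<bar>x\<bar> \<bar>y\<bar>"
        using t by (intro convex_bound_le) auto
      finally have "ereal \<bar>(1 - t) * x + t * y\<bar> \<le> ereal (max \<bar>x\<bar> \<bar>y\<bar>)"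
        by (simp only: ereal_less_eq)
      also have "\<dots> \<le> A" using True by (simp add: max_def)
      finally have z: "ereal \<bar>(1 - t) * x + t * y\<bar> \<le> A" .
      have "u ((1 - t) * x + t * y) \<le> (1 - t) * u x + t * u y"
        using convex_onD[OF u, of t x y] t by simp
      then show ?thesis using True z by simp
    next
      case False
      then have "ereal (1 - t) * ?\<phi> x + ereal t * ?\<phi> y = \<infinity>" using 3 by auto
      then show ?thesis by (simp only: ereal_less_eq)
    qed
  qed auto
qed

lemma convex_on_scaled_max: "0 \<le> (g::real) \<Longrightarrow> convex_on UNIV (\<lambda>x::real. g * max (\<bar>x\<bar> - \<alpha>) 0 - c)"
proof (intro convex_onI)
  fix t x y :: real
  assume g: "0 \<le> g" and t: "0 < t" "t < 1"
  have "\<bar>(1 - t) * x + t * y\<bar> \<le> (1 - t) * \<bar>x\<bar> + t * \<bar>y\<bar>"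
    using t abs_triangle_ineq[of "(1 - t) * x" "t * y"] by (simp add: abs_mult)
  then have "\<bar>(1 - t) * x + t * y\<bar> - \<alpha> \<le> (1 - t) * (\<bar>x\<bar> - \<alpha>) + t * (\<bar>y\<bar> - \<alpha>)"
    by (simp add: algebra_simps)
  also have "\<dots> \<le> (1 - t) * max (\<bar>x\<bar> - \<alpha>) 0 + t * max (\<bar>y\<bar> - \<alpha>) 0"
    using t by (intro add_mono mult_left_mono) auto
  finally have "max (\<bar>(1 - t) * x + t * y\<bar> - \<alpha>) 0 \<le> (1 - t) * max (\<bar>x\<bar> - \<alpha>) 0 + t * max (\<bar>y\<bar> - \<alpha>) 0"
    using t by simp
  from mult_left_mono[OF this g]
  show "g * max (\<bar>(1 - t) *\<^sub>R x + t *\<^sub>R y\<bar> - \<alpha>) 0 - c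
      \<le> (1 - t) * (g * max (\<bar>x\<bar> - \<alpha>) 0 - c) + t * (g * max (\<bar>y\<bar> - \<alpha>) 0 - c)"
    by (simp add: algebra_simps)
qed simp

lemma convex_on_scaled_abs: "0 \<le> (g::real) \<Longrightarrow> convex_on UNIV (\<lambda>x::real. g * \<bar>x\<bar> - c)"
  using convex_on_scaled_max[of g 0 c] by simp

lemma F_minus_convex_potential:
  assumes "f \<in> F_minus"
  obtains \<phi> where "convex_ereal \<phi>" "\<And>x. f x = exp_neg (\<phi> x)"
  using assms
proof (cases rule: F_minus_cases)
  case (uniform \<alpha> C)
  show ?thesis
    by (rule that[OF convex_ereal_truncation[of "\<lambda>x. - ln C" "ereal \<alpha>"]])
      (use uniform in \<open>auto intro: convex_on_scaled_abs[of 0, simplified] simp: exp_neg_def\<close>)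
next
  case (tail \<alpha> g C)
  show ?thesis
    by (rule that[OF convex_ereal_truncation[of "\<lambda>x. g * max (\<bar>x\<bar> - \<alpha>) 0 - ln C" "\<infinity>"]])
      (use tail in \<open>auto intro: convex_on_scaled_max simp: exp_neg_def exp_diff exp_minus field_simps\<close>)
qed

lemma F_plus_convex_potential:
  assumes "f \<in> F_plus"
  obtains \<phi> where "convex_ereal \<phi>" "\<And>x. f x = exp_neg (\<phi> x)"
proof -
  from assms obtain A g C where A: "A > 0" "g \<ge> 0" "C > 0"
    "\<And>x. f x = (if ereal \<bar>x\<bar> \<le> A then C * exp (- (g * \<bar>x\<bar>)) else 0)"
    by (rule F_plus_cases) blast
  show ?thesis
    by (rule that[OF convex_ereal_truncation[of "\<lambda>x. g * \<bar>x\<bar> - ln C" A]])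
      (use A in \<open>auto intro: convex_on_scaled_abs simp: exp_neg_def exp_diff exp_minus field_simps\<close>)
qed

section \<open>Moments of one-parameter families\<close>

text \<open>The explicit integrals over the half-line are gauge integrals; nonnegativity turns them
  into Lebesgue integrals, and evenness doubles them.\<close>

lemma has_bochner_integral_even_has_integral:
  fixes f :: "real \<Rightarrow> real"
  assumes [measurable]: "f \<in> borel_measurable borel" and nn: "\<And>x. 0 \<le> f x" and even: "\<And>x. f (- x) = f x"
    and I: "(f has_integral I) {0..}"
  shows "has_bochner_integral lborel f (2 * I)"
proof -
  let ?g = "\<lambda>x. indicator {0..} x *\<^sub>R f x"
  have I0: "0 \<le> I" using has_integral_nonneg[OF I] nn by simp
  have "?g = (\<lambda>x. if x \<in> {0..} then f x else 0)" by (auto simp: indicator_def)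
  then have "(?g has_integral I) UNIV" using I by (simp only: has_integral_restrict_UNIV)
  then have "(\<integral>\<^sup>+ x. ennreal (?g x) \<partial>lborel) = ennreal I"
    by (intro nn_integral_has_integral_lborel) (auto simp: nn)
  then have "has_bochner_integral lborel ?g I"
    using I0 nn by (intro has_bochner_integral_nn_integral) auto
  from has_bochner_integral_even_function[OF this even] show ?thesis by simp
qed

lemma has_integral_exp_minus_Ici:
  fixes g c :: real
  assumes "g > 0"
  shows "((\<lambda>x. exp (- (g * x))) has_integral exp (- (g * c)) / g) {c..}"
  using has_integral_exp_minus_to_infinity[OF assms, of c] by simp

lemma has_integral_Ici_of_Icc:
  fixes f :: "real \<Rightarrow> real"
  assumes I: "(f has_integral I) {a..b}" and z: "\<And>x. b < x \<Longrightarrow> f x = 0" and ab: "a \<le> b"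
  shows "(f has_integral I) {a..}"
proof -
  have "(f has_integral 0) {b<..}" by (rule has_integral_is_0) (simp add: z)
  moreover have "{a..b} \<inter> {b<..} = {}" by auto
  ultimately have "(f has_integral I) ({a..b} \<union> {b<..})"
    using has_integral_Un[OF I, of 0 "{b<..}"] by simp
  moreover have "{a..b} \<union> {b<..} = {a..}" using ab by auto
  ultimately show ?thesis by simp
qed

lemma f_dens_borel_measurable [measurable]: "f_dens \<alpha> \<gamma> \<in> borel_measurable borel"
  unfolding f_dens_def[abs_def] by measurable

lemma g_dens_borel_measurable [measurable]: "g_dens \<alpha> \<gamma> \<in> borel_measurable borel"
  unfolding g_dens_def[abs_def] by measurable

lemma F_minus_properties:
  assumes F: "f \<in> F_minus"
  shows "f \<in> borel_measurable borel" "0 \<le> f x" "f (- x) = f x"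
    "(\<integral>\<^sup>+ x. ennreal (f x) \<partial>lborel) = 1"
proof -
  show m: "f \<in> borel_measurable borel" using F by (auto simp: F_minus_def)
  show nn: "0 \<le> f x" and ev: "f (- x) = f x" for x using F by (cases rule: F_minus_cases; simp)+
  have "\<exists>I. (f has_integral I) {0..} \<and> 2 * I = 1"
  proof -
    from F obtain \<alpha> \<gamma> where f: "f = f_dens \<alpha> \<gamma>" "0 \<le> \<alpha>" "0 < \<gamma>" "(\<alpha>, \<gamma>) \<noteq> (0, \<infinity>)"
      by (auto simp: F_minus_def)
    show ?thesis
    proof (cases \<gamma>)
      case PInf
      have "((\<lambda>x. 1 / (2 * \<alpha>)) has_integral (1 / (2 * \<alpha>)) * (\<alpha> - 0)) {0..\<alpha>}"
        using has_integral_const_real[of "1 / (2 * \<alpha>)" 0 \<alpha>] f by simp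
      then have "(f has_integral (1 / (2 * \<alpha>)) * (\<alpha> - 0)) {0..\<alpha>}"
        by (rule has_integral_eq[rotated]) (auto simp: f f_dens_def PInf)
      then have "(f has_integral (1 / (2 * \<alpha>)) * (\<alpha> - 0)) {0..}"
        by (rule has_integral_Ici_of_Icc) (use f in \<open>auto simp: f_dens_def PInf indicator_def\<close>)
      then show ?thesis using f PInf by (intro exI conjI) auto
    next
      case (real g)
      then have g: "g > 0" using f by simp
      define C where "C = 1 / (2 * (\<alpha> + 1 / g))"
      have fC: "f x = C * exp (- (g * max (\<bar>x\<bar> - \<alpha>) 0))" for x
        by (simp add: f f_dens_def real C_def)
      have "((\<lambda>x. C) has_integral C * (\<alpha> - 0)) {0..\<alpha>}"
        using has_integral_const_real[of C 0 \<alpha>] f by (simp add: mult.commute)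
      then have 1: "(f has_integral C * (\<alpha> - 0)) {0..\<alpha>}"
        by (rule has_integral_eq[rotated]) (auto simp: fC)
      have "((\<lambda>x. C * exp (g * \<alpha>) * exp (- (g * x))) has_integral C * exp (g * \<alpha>) * (exp (- (g * \<alpha>)) / g)) {\<alpha>..}"
        by (intro has_integral_mult_right has_integral_exp_minus_Ici g)
      then have 2: "(f has_integral C * exp (g * \<alpha>) * (exp (- (g * \<alpha>)) / g)) {\<alpha>..}"
        by (rule has_integral_eq[rotated]) (use f(2) in \<open>auto simp: fC exp_add[symmetric] algebra_simps\<close>)
      have "(f has_integral C * (\<alpha> - 0) + C * exp (g * \<alpha>) * (exp (- (g * \<alpha>)) / g)) ({0..\<alpha>} \<union> {\<alpha>..})"
        by (rule has_integral_Un[OF 1 2])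
          (rule negligible_subset[of "{\<alpha>}"], auto)
      moreover have "{0..\<alpha>} \<union> {\<alpha>..} = {0..}" using f by auto
      moreover have "2 * (C * (\<alpha> - 0) + C * exp (g * \<alpha>) * (exp (- (g * \<alpha>)) / g)) = 1"
      proof -
        have "\<alpha> * g + 1 > 0" using f g by (simp add: add_nonneg_pos)
        then show ?thesis using g unfolding C_def by (simp add: exp_minus field_simps)
      qed
      ultimately show ?thesis by auto
    qed (use f in auto)
  qed
  then obtain I where "(f has_integral I) {0..}" "2 * I = 1" by blast
  from has_bochner_integral_even_has_integral[OF m nn ev this(1)] this(2)
  have "has_bochner_integral lborel f 1" by simp
  then show "(\<integral>\<^sup>+ x. ennreal (f x) \<partial>lborel) = 1"
    using nn by (simp add: has_bochner_integral_iff nn_integral_eq_integral)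
qed

lemma F_plus_properties:
  assumes F: "f \<in> F_plus"
  shows "f \<in> borel_measurable borel" "0 \<le> f x" "f (- x) = f x"
    "(\<integral>\<^sup>+ x. ennreal (f x) \<partial>lborel) = 1"
proof -
  show m: "f \<in> borel_measurable borel" using F by (auto simp: F_plus_def)
  show nn: "0 \<le> f x" and ev: "f (- x) = f x" for x using F by (rule F_plus_cases; simp)+
  have "\<exists>I. (f has_integral I) {0..} \<and> 2 * I = 1"
  proof -
    from F obtain \<alpha> \<gamma> where f: "f = g_dens \<alpha> \<gamma>" "0 < \<alpha>" "0 \<le> \<gamma>" "(\<alpha>, \<gamma>) \<noteq> (\<infinity>, 0)"
      by (auto simp: F_plus_def)
    show ?thesis
    proof (cases \<alpha>)
      case PInf
      then have g: "\<gamma> > 0" using f by auto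
      have "((\<lambda>x. \<gamma> / 2 * exp (- (\<gamma> * x))) has_integral \<gamma> / 2 * (exp (- (\<gamma> * 0)) / \<gamma>)) {0..}"
        by (intro has_integral_mult_right has_integral_exp_minus_Ici g)
      then have "(f has_integral \<gamma> / 2 * (exp (- (\<gamma> * 0)) / \<gamma>)) {0..}"
        by (rule has_integral_eq[rotated]) (auto simp: f g_dens_def PInf)
      then show ?thesis using g by (intro exI conjI) auto
    next
      case (real r)
      have r: "r > 0" using f real by simp
      show ?thesis
      proof (cases "\<gamma> = 0")
        case True
        have "((\<lambda>x. 1 / (2 * r)) has_integral (1 / (2 * r)) * (r - 0)) {0..r}"
          using has_integral_const_real[of "1 / (2 * r)" 0 r] r by simp
        then have "(f has_integral (1 / (2 * r)) * (r - 0)) {0..r}"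
          by (rule has_integral_eq[rotated]) (auto simp: f g_dens_def real True)
        then have "(f has_integral (1 / (2 * r)) * (r - 0)) {0..}"
          by (rule has_integral_Ici_of_Icc) (use r in \<open>auto simp: f g_dens_def real True indicator_def\<close>)
        then show ?thesis using r by (intro exI conjI) auto
      next
        case False
        then have g: "\<gamma> > 0" using f by simp
        define C where "C = \<gamma> / (2 * (1 - exp (- (r * \<gamma>))))"
        have "((\<lambda>x. C * exp (- (\<gamma> * x))) has_integral (- (C / \<gamma>) * exp (- (\<gamma> * r)) - - (C / \<gamma>) * exp (- (\<gamma> * 0)))) {0..r}"
          using r g by (intro fundamental_theorem_of_calculus)
            (auto intro!: derivative_eq_intros simp: has_real_derivative_iff_has_vector_derivative[symmetric])
        then have "(f has_integral (- (C / \<gamma>) * exp (- (\<gamma> * r)) - - (C / \<gamma>) * exp (- (\<gamma> * 0)))) {0..r}"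
          by (rule has_integral_eq[rotated]) (auto simp: f g_dens_def real False C_def)
        then have "(f has_integral (- (C / \<gamma>) * exp (- (\<gamma> * r)) - - (C / \<gamma>) * exp (- (\<gamma> * 0)))) {0..}"
          by (rule has_integral_Ici_of_Icc) (use r in \<open>auto simp: f g_dens_def real False indicator_def\<close>)
        moreover have "2 * (- (C / \<gamma>) * exp (- (\<gamma> * r)) - - (C / \<gamma>) * exp (- (\<gamma> * 0))) = 1"
        proof -
          have e: "exp (- (\<gamma> * r)) < 1" using g r by simp
          have "C / \<gamma> = 1 / (2 * (1 - exp (- (\<gamma> * r))))" using g by (simp add: C_def mult.commute)
          then have "2 * (C / \<gamma>) * (1 - exp (- (\<gamma> * r))) = 1" using e g r by simp
          then show ?thesis by (simp add: right_diff_distrib)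
        qed
        ultimately show ?thesis by blast
      qed
    qed (use f in auto)
  qed
  then obtain I where "(f has_integral I) {0..}" "2 * I = 1" by blast
  from has_bochner_integral_even_has_integral[OF m nn ev this(1)] this(2)
  have "has_bochner_integral lborel f 1" by simp
  then show "(\<integral>\<^sup>+ x. ennreal (f x) \<partial>lborel) = 1"
    using nn by (simp add: has_bochner_integral_iff nn_integral_eq_integral)
qed

lemma dens_F_minus: "f \<in> F_minus \<Longrightarrow> density_moments p a b f \<Longrightarrow> dens p a b f"
  by (simp add: dens_def F_minus_properties)

lemma dens_F_plus: "f \<in> F_plus \<Longrightarrow> density_moments p a b f \<Longrightarrow> dens p a b f"
  by (simp add: dens_def F_plus_properties)

section \<open>Reference integrals and domination\<close>

lemma has_bochner_integral_abs_powr_exp: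
  fixes q :: real
  assumes "q > -1"
  shows "has_bochner_integral lborel (\<lambda>x::real. \<bar>x\<bar> powr q * exp (- \<bar>x\<bar>)) (2 * Gamma (q + 1))"
proof (rule has_bochner_integral_even_has_integral)
  show "((\<lambda>x. \<bar>x\<bar> powr q * exp (- \<bar>x\<bar>)) has_integral Gamma (q + 1)) {0..}"
    using Gamma_integral_real[of "q + 1"] assms
    by (subst has_integral_cong[where g = "\<lambda>t. t powr (q + 1 - 1) / exp t"]) (auto simp: exp_minus field_simps)
qed auto

lemma has_bochner_integral_exp_abs: "has_bochner_integral lborel (\<lambda>x::real. exp (- \<bar>x\<bar>)) 2"
proof -
  have "((\<lambda>x::real. exp (- \<bar>x\<bar>)) has_integral 1) {0..}"
    using has_integral_exp_minus_Ici[of 1 0] by (subst has_integral_cong[where g = "\<lambda>x. exp (- (1 * x))"]) auto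
  from has_bochner_integral_even_has_integral[OF _ _ _ this] show ?thesis by simp
qed

lemma has_bochner_integral_abs_powr_unit:
  fixes q :: real
  assumes "q > -1"
  shows "has_bochner_integral lborel (\<lambda>x::real. \<bar>x\<bar> powr q * indicator {-1..1} x) (2 / (q + 1))"
proof -
  have "((\<lambda>x. \<bar>x\<bar> powr q * indicator {-1..1} x) has_integral 1 / (q + 1)) {0..1}"
    using has_integral_powr_from_0[of q 1] assms
    by (subst has_integral_cong[where g = "\<lambda>x. x powr q"]) auto
  then have "((\<lambda>x. \<bar>x\<bar> powr q * indicator {-1..1} x) has_integral 1 / (q + 1)) {0..}"
    by (rule has_integral_Ici_of_Icc) (auto simp: indicator_def)
  then have "has_bochner_integral lborel (\<lambda>x. \<bar>x\<bar> powr q * indicator {-1..1} x) (2 * (1 / (q + 1)))"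
    by (intro has_bochner_integral_even_has_integral) (auto simp: indicator_def)
  then show ?thesis by simp
qed

lemma has_bochner_integral_unit: "has_bochner_integral lborel (\<lambda>x::real. indicator {-1..1} x) (2 :: real)"
proof -
  have "has_bochner_integral lborel (indicator {-1..1::real}) (measure lborel {-1..1::real})"
    by (rule has_bochner_integral_real_indicator) auto
  then show ?thesis by (simp add: measure_lborel_Icc)
qed

text \<open>Dominated convergence along sequences. Convergence is asked only almost everywhere
  because the profiles jump at the ends of their supports, where it can fail.\<close>

lemma continuous_on_param_integral:
  fixes k :: "real \<Rightarrow> real \<Rightarrow> real"
  assumes [measurable]: "\<And>\<theta>. k \<theta> \<in> borel_measurable borel" "\<phi> \<in> borel_measurable borel"
    and bound: "\<And>\<theta> x. \<theta> \<in> {0..1} \<Longrightarrow> \<bar>k \<theta> x\<bar> \<le> w x" and int: "integrable lborel (\<lambda>x. \<phi> x * w x)"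
    and lim: "\<And>u \<theta>. (\<And>n. u n \<in> {0..1}) \<Longrightarrow> \<theta> \<in> {0..1} \<Longrightarrow> u \<longlonglongrightarrow> \<theta> \<Longrightarrow>
      AE x in lborel. (\<lambda>n. k (u n) x) \<longlonglongrightarrow> k \<theta> x"
  shows "continuous_on {0..1} (\<lambda>\<theta>. \<integral>x. \<phi> x * k \<theta> x \<partial>lborel)"
  unfolding continuous_on_sequentially
proof (intro allI ballI impI; elim conjE)
  fix u \<theta> assume u: "\<forall>n. u n \<in> {0..1::real}" "u \<longlonglongrightarrow> \<theta>" and \<theta>: "\<theta> \<in> {0..1}"
  have "(\<lambda>n. \<integral>x. \<phi> x * k (u n) x \<partial>lborel) \<longlonglongrightarrow> (\<integral>x. \<phi> x * k \<theta> x \<partial>lborel)"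
  proof (rule integral_dominated_convergence)
    show "integrable lborel (\<lambda>x. \<bar>\<phi> x * w x\<bar>)" using int by auto
    have "AE x in lborel. (\<lambda>n. k (u n) x) \<longlonglongrightarrow> k \<theta> x" using u \<theta> by (intro lim) auto
    then show "AE x in lborel. (\<lambda>n. \<phi> x * k (u n) x) \<longlonglongrightarrow> \<phi> x * k \<theta> x"
      by eventually_elim (auto intro: tendsto_intros)
    have "\<bar>\<phi> x * k (u n) x\<bar> \<le> \<bar>\<phi> x * w x\<bar>" for x n
      using bound[of "u n" x] u by (auto simp: abs_mult intro!: mult_left_mono intro: order_trans)
    then show "AE x in lborel. norm (\<phi> x * k (u n) x) \<le> \<bar>\<phi> x * w x\<bar>" for n by simp
  qed auto
  then show "((\<lambda>\<theta>. \<integral>x. \<phi> x * k \<theta> x \<partial>lborel) \<circ> u) \<longlonglongrightarrow> (\<integral>x. \<phi> x * k \<theta> x \<partial>lborel)"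
    by (simp add: o_def)
qed

text \<open>The factor exp (1 - |x| / 2) is the common majorant of both one-parameter families of
  profiles; its rate 1/2 is dictated by \<open>cut_profile_bound\<close>.\<close>

lemma integrable_abs_powr_exp_half:
  fixes q :: real
  assumes "q > -1"
  shows "integrable lborel (\<lambda>x::real. \<bar>x\<bar> powr q * exp (1 - \<bar>x\<bar> / 2))"
proof -
  have "integrable lborel (\<lambda>x. \<bar>x\<bar> powr q * exp (- \<bar>x\<bar>))"
    using has_bochner_integral_abs_powr_exp[OF assms] by (simp add: has_bochner_integral_iff)
  from lborel_integrable_real_affine[OF this, of "1/2" 0]
  have "integrable lborel (\<lambda>x. (2 powr q * exp 1) * (\<bar>1 / 2 * x\<bar> powr q * exp (- \<bar>1 / 2 * x\<bar>)))"
    by (intro integrable_mult_right) simp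
  moreover have "(2 powr q * exp 1) * (\<bar>1 / 2 * x\<bar> powr q * exp (- \<bar>1 / 2 * x\<bar>)) = \<bar>x\<bar> powr q * exp (1 - \<bar>x\<bar> / 2)" for x
  proof -
    have "2 powr q * \<bar>1 / 2 * x\<bar> powr q = \<bar>x\<bar> powr q" by (simp add: powr_mult[symmetric] abs_mult)
    moreover have "exp 1 * exp (- \<bar>1 / 2 * x\<bar>) = exp (1 - \<bar>x\<bar> / 2)" by (simp add: exp_add[symmetric] abs_mult)
    ultimately show ?thesis by (metis mult.assoc mult.left_commute)
  qed
  ultimately show ?thesis by (simp only:)
qed

text \<open>The two bounds on \<open>b / a\<close> are its values for the uniform and the two-sided exponential law.\<close>

lemma exists_scaled_profile:
  fixes k :: "real \<Rightarrow> real \<Rightarrow> real"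
  assumes p: "p > 2" and ab: "a > 0" "b > 0"
    and lower: "3 powr (1/2) * (p + 1) powr (- 1 / p) \<le> b / a"
    and upper: "b / a \<le> 2 powr (- 1/2) * Gamma (p + 1) powr (1 / p)"
    and k [measurable]: "\<And>\<theta>. k \<theta> \<in> borel_measurable borel" and nn: "\<And>\<theta> x. 0 \<le> k \<theta> x"
    and bound: "\<And>\<theta> x. \<theta> \<in> {0..1} \<Longrightarrow> k \<theta> x \<le> exp (1 - \<bar>x\<bar> / 2)"
    and lim: "\<And>u \<theta>. (\<And>n. u n \<in> {0..1}) \<Longrightarrow> \<theta> \<in> {0..1} \<Longrightarrow> u \<longlonglongrightarrow> \<theta> \<Longrightarrow>
      AE x in lborel. (\<lambda>n. k (u n) x) \<longlonglongrightarrow> k \<theta> x"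
    and pos: "\<And>\<theta> x. \<theta> \<in> {0..1} \<Longrightarrow> \<bar>x\<bar> < 1 \<Longrightarrow> k \<theta> x > 0"
    and U: "\<theta>u \<in> {0..1}" "\<And>x. k \<theta>u x = indicator {-1..1} x"
    and E: "\<theta>e \<in> {0..1}" "\<And>x. k \<theta>e x = exp (- \<bar>x\<bar>)"
  obtains \<theta> l c where "\<theta> \<in> {0..1}" "l > 0" "c > 0"
    "(\<integral>\<^sup>+ x. ennreal (c * k \<theta> (x / l)) \<partial>lborel) = 1" "density_moments p a b (\<lambda>x. c * k \<theta> (x / l))"
proof -
  define m0 where "m0 \<theta> = (\<integral>x. 1 * k \<theta> x \<partial>lborel)" for \<theta>
  define m2 where "m2 \<theta> = (\<integral>x. x\<^sup>2 * k \<theta> x \<partial>lborel)" for \<theta>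
  define mp where "mp \<theta> = (\<integral>x. \<bar>x\<bar> powr p * k \<theta> x \<partial>lborel)" for \<theta>
  let ?w = "\<lambda>x::real. exp (1 - \<bar>x\<bar> / 2)"
  have w2: "integrable lborel (\<lambda>x. x\<^sup>2 * ?w x)"
    using integrable_abs_powr_exp_half[of 2] by simp
  have wp: "integrable lborel (\<lambda>x. \<bar>x\<bar> powr p * ?w x)"
    using p by (intro integrable_abs_powr_exp_half) simp
  have w0: "integrable lborel (\<lambda>x. 1 * ?w x)"
  proof -
    have "integrable lborel (\<lambda>x::real. exp (- \<bar>x\<bar>))"
      using has_bochner_integral_exp_abs by (simp add: has_bochner_integral_iff)
    from lborel_integrable_real_affine[OF this, of "1/2" 0]
    have "integrable lborel (\<lambda>x::real. exp 1 * exp (- \<bar>1 / 2 * x\<bar>))"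
      by (intro integrable_mult_right) simp
    then show ?thesis by (simp add: exp_add[symmetric] abs_mult)
  qed
  have bound': "\<bar>k \<theta> x\<bar> \<le> ?w x" if "\<theta> \<in> {0..1}" for \<theta> x
    using bound[OF that] nn by simp
  have cont: "continuous_on {0..1} m0" "continuous_on {0..1} m2" "continuous_on {0..1} mp"
    unfolding m0_def m2_def mp_def
    by (rule continuous_on_param_integral[OF k _ bound' w0 lim]
        continuous_on_param_integral[OF k _ bound' w2 lim]
        continuous_on_param_integral[OF k _ bound' wp lim]; simp)+
  have int: "integrable lborel (\<lambda>x. \<phi> x * k \<theta> x)"
    if "integrable lborel (\<lambda>x. \<phi> x * ?w x)" "\<theta> \<in> {0..1}" "\<phi> \<in> borel_measurable borel" for \<phi> \<theta>
  proof (rule Bochner_Integration.integrable_bound[OF that(1)])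
    show "AE x in lborel. norm (\<phi> x * k \<theta> x) \<le> norm (\<phi> x * ?w x)"
      using bound[OF that(2)] nn by (auto simp: abs_mult intro!: mult_left_mono)
  qed (use that in measurable)
  have mpos: "(\<integral>x. \<phi> x * k \<theta> x \<partial>lborel) > 0"
    if "integrable lborel (\<lambda>x. \<phi> x * ?w x)" "\<theta> \<in> {0..1}" "\<phi> \<in> borel_measurable borel"
      "\<And>x. 0 \<le> \<phi> x" "\<And>x. x \<noteq> 0 \<Longrightarrow> 0 < \<phi> x" for \<phi> \<theta>
  proof -
    note I = int[OF that(1-3)]
    \<comment> \<open>A vanishing integral would make the integrand zero almost everywhere, although
      it is positive on (0, 1).\<close>
    have nz: "(\<integral>x. \<phi> x * k \<theta> x \<partial>lborel) \<noteq> 0"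
    proof
      assume "(\<integral>x. \<phi> x * k \<theta> x \<partial>lborel) = 0"
      then have "AE x in lborel. \<phi> x * k \<theta> x = 0"
        using integral_nonneg_eq_0_iff_AE[OF I] that(4) nn by simp
      then have "AE x in lborel. x \<notin> {0<..<1::real}"
      proof eventually_elim
        case (elim x)
        then show ?case using that(5)[of x] pos[OF that(2), of x] by auto
      qed
      then have "emeasure lborel {0<..<1::real} = 0"
        using AE_iff_measurable[of "{0<..<1::real}" lborel "\<lambda>x. x \<notin> {0<..<1}"] by fastforce
      then show False by simp
    qed
    moreover have "(\<integral>x. \<phi> x * k \<theta> x \<partial>lborel) \<ge> 0" using that(4) nn by (intro integral_nonneg_AE) auto
    ultimately show ?thesis by simp
  qed
  have P: "m0 \<theta> > 0" "m2 \<theta> > 0" "mp \<theta> > 0" if "\<theta> \<in> {0..1}" for \<theta>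
    unfolding m0_def m2_def mp_def
    by (rule mpos[OF w0 that] mpos[OF w2 that] mpos[OF wp that]; simp)+
  \<comment> \<open>The quotient of mp m0 powr (p / 2 - 1) by m2 powr (p / 2) is unchanged when the
    profile is rescaled or multiplied by a constant, and for a density with the prescribed moments
    it equals (b / a) powr p. Hence r \<theta> = 0 says that the profile, suitably scaled and
    normalised, has both moments.\<close>
  define \<rho> where "\<rho> = (b / a) powr p"
  define r where "r \<theta> = mp \<theta> * m0 \<theta> powr (p / 2 - 1) - \<rho> * m2 \<theta> powr (p / 2)" for \<theta>
  have rc: "continuous_on {0..1} r"
    unfolding r_def using P by (intro continuous_intros cont) (auto simp: less_imp_neq[symmetric])
  have ba: "b / a > 0" using ab by simp
  have rU: "r \<theta>u \<le> 0"
  proof -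
    have e0: "m0 \<theta>u = 2" using has_bochner_integral_unit by (simp add: m0_def U has_bochner_integral_iff)
    have e2: "m2 \<theta>u = 2 / 3" using has_bochner_integral_abs_powr_unit[of 2]
      by (simp add: m2_def U has_bochner_integral_iff)
    have ep: "mp \<theta>u = 2 / (p + 1)" using has_bochner_integral_abs_powr_unit[of p] p
      by (simp add: mp_def U has_bochner_integral_iff)
    have "(3 powr (1/2) * (p + 1) powr (- 1 / p)) powr p \<le> \<rho>"
      unfolding \<rho>_def using lower p by (intro powr_mono2) auto
    also have "(3 powr (1/2) * (p + 1) powr (- 1 / p)) powr p = (3 powr (1/2)) powr p * ((p + 1) powr (- 1 / p)) powr p"
      by (simp only: powr_mult)
    also have "\<dots> = 3 powr (1/2 * p) * (p + 1) powr (- 1 / p * p)" by (simp only: powr_powr)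
    also have "\<dots> = 3 powr (p / 2) / (p + 1)" using p by (simp add: powr_minus_divide)
    finally have "3 powr (p / 2) / (p + 1) \<le> \<rho>" .
    then have "(2 / 3) powr (p / 2) * (3 powr (p / 2) / (p + 1)) \<le> (2 / 3) powr (p / 2) * \<rho>"
      by (intro mult_left_mono) auto
    moreover have "(2 / 3) powr (p / 2) * (3 powr (p / 2) / (p + 1)) = 2 powr (p / 2) / (p + 1)"
      by (simp add: powr_divide)
    moreover have "2 / (p + 1) * 2 powr (p / 2 - 1) = 2 * 2 powr (p / 2 - 1) / (p + 1)"
      by simp
    moreover have "2 * 2 powr (p / 2 - 1) = (2 powr (p / 2) :: real)"
      by (simp add: powr_diff)
    ultimately show ?thesis unfolding r_def e0 e2 ep using p by (simp add: mult.commute)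
  qed
  have rE: "0 \<le> r \<theta>e"
  proof -
    have e0: "m0 \<theta>e = 2" using has_bochner_integral_exp_abs by (simp add: m0_def E has_bochner_integral_iff)
    have G: "Gamma (3::real) = 2" using Gamma_fact[of 2, where 'a = real] by (simp add: fact_numeral)
    have e2: "m2 \<theta>e = 4" using has_bochner_integral_abs_powr_exp[of 2] G
      by (simp add: m2_def E has_bochner_integral_iff)
    have ep: "mp \<theta>e = 2 * Gamma (p + 1)" using has_bochner_integral_abs_powr_exp[of p] p
      by (simp add: mp_def E has_bochner_integral_iff)
    have Gp: "Gamma (p + 1) > 0" using p by (intro Gamma_real_pos) simp
    have "\<rho> \<le> (2 powr (- 1/2) * Gamma (p + 1) powr (1 / p)) powr p"
      unfolding \<rho>_def using upper ba p by (intro powr_mono2) auto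
    also have "\<dots> = (2 powr (- 1/2)) powr p * (Gamma (p + 1) powr (1 / p)) powr p"
      by (simp only: powr_mult)
    also have "\<dots> = 2 powr (- 1/2 * p) * Gamma (p + 1) powr (1 / p * p)" by (simp only: powr_powr)
    also have "\<dots> = Gamma (p + 1) / 2 powr (p / 2)" using p Gp by (simp add: powr_minus_divide)
    finally have "\<rho> \<le> Gamma (p + 1) / 2 powr (p / 2)" .
    then have "\<rho> * 2 powr (p / 2) * 2 powr (p / 2) \<le> Gamma (p + 1) * 2 powr (p / 2)"
      by (simp add: field_simps)
    moreover have "(4::real) powr (p / 2) = 2 powr (p / 2) * 2 powr (p / 2)"
      using powr_mult[of 2 2 "p / 2"] by simp
    moreover have "2 * Gamma (p + 1) * 2 powr (p / 2 - 1) = Gamma (p + 1) * 2 powr (p / 2)"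
      by (simp add: powr_diff)
    ultimately show ?thesis unfolding r_def e0 e2 ep by (simp only: mult.assoc)
  qed
  have "connected (r ` {0..1})" by (intro connected_continuous_image rc) simp
  then have "0 \<in> r ` {0..1}"
    using rU rE U(1) E(1) unfolding connected_iff_interval by blast
  then obtain \<theta> where \<theta>: "\<theta> \<in> {0..1}" "r \<theta> = 0" by auto
  note P = P[OF \<theta>(1)]
  \<comment> \<open>The second moment fixes l by l^2 m2 / m0 = a^2, and the total mass fixes c by c
    l m0 = 1; the p-th moment is then forced by r \<theta> = 0.\<close>
  define l where "l = a * sqrt (m0 \<theta> / m2 \<theta>)"
  have l: "l > 0" using ab P by (simp add: l_def)
  define c where "c = 1 / (l * m0 \<theta>)"
  have c: "c > 0" using l P by (simp add: c_def)
  \<comment> \<open>The homogeneous weights 1, x^2 and |x| powr p are handled at once; s is the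
    factor 1, l^2 or l powr p that scaling by l produces.\<close>
  have scale: "(\<integral>\<^sup>+ x. ennreal (\<phi> x * (c * k \<theta> (x / l))) \<partial>lborel) = ennreal (s / m0 \<theta> * (\<integral>x. \<psi> x * k \<theta> x \<partial>lborel))"
    if "\<And>x. \<phi> (l * x) = s * \<psi> x" "\<phi> \<in> borel_measurable borel" "\<psi> \<in> borel_measurable borel"
      "\<And>x. 0 \<le> \<psi> x" "0 \<le> s" "integrable lborel (\<lambda>x. \<psi> x * ?w x)" for \<phi> \<psi> :: "real \<Rightarrow> real" and s
  proof -
    have [measurable]: "\<phi> \<in> borel_measurable borel" by fact
    have "(\<integral>\<^sup>+ x. ennreal (\<phi> x * (c * k \<theta> (x / l))) \<partial>lborel)
      = ennreal \<bar>l\<bar> * (\<integral>\<^sup>+ x. ennreal (\<phi> (0 + l * x) * (c * k \<theta> ((0 + l * x) / l))) \<partial>lborel)"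
      using l by (intro nn_integral_real_affine) auto
    also have "\<dots> = (\<integral>\<^sup>+ x. ennreal l * ennreal (\<phi> (0 + l * x) * (c * k \<theta> ((0 + l * x) / l))) \<partial>lborel)"
      using l by (subst nn_integral_cmult) auto
    also have "\<dots> = (\<integral>\<^sup>+ x. ennreal (s / m0 \<theta> * (\<psi> x * k \<theta> x)) \<partial>lborel)"
      using l P by (intro nn_integral_cong) (simp add: that(1) that(1)[unfolded mult.commute[of l]] c_def ennreal_mult'[symmetric] field_simps)
    also have "\<dots> = ennreal (s / m0 \<theta> * (\<integral>x. \<psi> x * k \<theta> x \<partial>lborel))"
      using int[OF that(6) \<theta>(1) that(3)] that(4,5) P(1) nn
      by (subst nn_integral_eq_integral) (auto simp del: times_divide_eq_left)
    finally show ?thesis .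
  qed
  have l2: "l\<^sup>2 = a\<^sup>2 * (m0 \<theta> / m2 \<theta>)" using P by (simp add: l_def power_mult_distrib)
  have lp: "l powr p = a powr p * (m0 \<theta> powr (p / 2) / m2 \<theta> powr (p / 2))"
    using P ab unfolding l_def by (simp add: powr_mult powr_half_sqrt[symmetric] powr_powr powr_divide)
  show ?thesis
  proof (rule that[OF \<theta>(1) l c])
    show "(\<integral>\<^sup>+ x. ennreal (c * k \<theta> (x / l)) \<partial>lborel) = 1"
      using scale[of "\<lambda>_. 1" 1 "\<lambda>_. 1"] w0 P(1) by (simp add: m0_def)
    show "density_moments p a b (\<lambda>x. c * k \<theta> (x / l))"
      unfolding density_moments_def
    proof
      have "l\<^sup>2 / m0 \<theta> * m2 \<theta> = a\<^sup>2" unfolding l2 using P by simp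
      then show "(\<integral>\<^sup>+ x. ennreal (x\<^sup>2 * (c * k \<theta> (x / l))) \<partial>lborel) = ennreal (a\<^sup>2)"
        using scale[of "\<lambda>x. x\<^sup>2" "l\<^sup>2" "\<lambda>x. x\<^sup>2"] w2 by (simp add: m2_def power_mult_distrib)
      have "m0 \<theta> powr (p / 2) = m0 \<theta> * m0 \<theta> powr (p / 2 - 1)" using P powr_add[of "m0 \<theta>" 1 "p / 2 - 1"] by simp
      then have "l powr p / m0 \<theta> * mp \<theta> = a powr p * (mp \<theta> * m0 \<theta> powr (p / 2 - 1)) / m2 \<theta> powr (p / 2)"
        unfolding lp using P by simp
      also have "mp \<theta> * m0 \<theta> powr (p / 2 - 1) = \<rho> * m2 \<theta> powr (p / 2)" using \<theta>(2) by (simp add: r_def)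
      also have "a powr p * (\<rho> * m2 \<theta> powr (p / 2)) / m2 \<theta> powr (p / 2) = b powr p"
        using P ab by (simp add: \<rho>_def powr_divide)
      finally show "(\<integral>\<^sup>+ x. ennreal (\<bar>x\<bar> powr p * (c * k \<theta> (x / l))) \<partial>lborel) = ennreal (b powr p)"
        using scale[of "\<lambda>x. \<bar>x\<bar> powr p" "l powr p" "\<lambda>x. \<bar>x\<bar> powr p"] wp l
        by (simp add: mp_def abs_mult powr_mult)
    qed
  qed
qed

section \<open>Existence and uniqueness of the extremal densities\<close>

text \<open>A scaled profile of unit mass and the member of the family with the same shape must
  coincide, so the moments pass to the latter without a comparison of normalising constants.\<close>

lemma proportional_densities:
  fixes K :: "real \<Rightarrow> real"
  assumes [measurable]: "K \<in> borel_measurable borel" and K: "\<And>x. 0 \<le> K x" and c: "c > 0" "c' > 0"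
    and 1: "(\<integral>\<^sup>+ x. ennreal (c * K x) \<partial>lborel) = 1" "(\<integral>\<^sup>+ x. ennreal (c' * K x) \<partial>lborel) = 1"
  shows "c = c'"
proof -
  have "(\<integral>\<^sup>+ x. ennreal (c' * K x) \<partial>lborel) = (\<integral>\<^sup>+ x. ennreal (c' / c) * ennreal (c * K x) \<partial>lborel)"
    using c K by (intro nn_integral_cong) (simp add: ennreal_mult'[symmetric])
  also have "\<dots> = ennreal (c' / c) * (\<integral>\<^sup>+ x. ennreal (c * K x) \<partial>lborel)"
    by (rule nn_integral_cmult) measurable
  finally have "ennreal (c' / c) = 1" using 1 by simp
  then show ?thesis using c by (simp add: ennreal_eq_1)
qed

text \<open>Up to scaling, \<open>tail_profile \<theta>\<close> is \<open>f_dens\<close> with \<open>\<alpha> = \<theta>\<close>, \<open>\<gamma> = 1 / (1 - \<theta>)\<close>, and \<open>cut_profile \<theta>\<close> is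
  \<open>g_dens\<close> with \<open>\<alpha> = 1 / (1 - \<theta>)\<close>, \<open>\<gamma> = \<theta>\<close>. These parametrisations are continuous up to the
  degenerate ends.\<close>

definition tail_profile :: "real \<Rightarrow> real \<Rightarrow> real" where
  "tail_profile \<theta> x = (if \<theta> < 1 then exp (- (max (\<bar>x\<bar> - \<theta>) 0 / (1 - \<theta>))) else indicator {-1..1} x)"

definition cut_profile :: "real \<Rightarrow> real \<Rightarrow> real" where
  "cut_profile \<theta> x = (if (1 - \<theta>) * \<bar>x\<bar> \<le> 1 then exp (- (\<theta> * \<bar>x\<bar>)) else 0)"

lemma tail_profile_measurable: "tail_profile \<theta> \<in> borel_measurable borel"
  unfolding tail_profile_def[abs_def] by measurable

lemma cut_profile_measurable: "cut_profile \<theta> \<in> borel_measurable borel"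
  unfolding cut_profile_def[abs_def] by measurable

lemma tail_profile_tendsto:
  assumes u: "\<And>n. u n \<in> {0..1}" and \<theta>: "\<theta> \<in> {0..1}" and lim: "u \<longlonglongrightarrow> \<theta>"
  shows "AE x in lborel. (\<lambda>n. tail_profile (u n) x) \<longlonglongrightarrow> tail_profile \<theta> x"
proof -
  have "finite {1::real}" by simp
  from AE_lborel_abs_notin[OF this] show ?thesis
  proof eventually_elim
    case (elim x)
    show ?case
    proof (cases "\<theta> < 1")
      case True
      have "(\<lambda>n. exp (- (max (\<bar>x\<bar> - u n) 0 / (1 - u n)))) \<longlonglongrightarrow> exp (- (max (\<bar>x\<bar> - \<theta>) 0 / (1 - \<theta>)))"
        using True by (intro tendsto_intros lim) auto
      moreover have "\<forall>\<^sub>F n in sequentially. exp (- (max (\<bar>x\<bar> - u n) 0 / (1 - u n))) = tail_profile (u n) x"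
        using order_tendstoD(2)[OF lim True] by eventually_elim (simp add: tail_profile_def)
      ultimately show ?thesis using True by (auto simp: tail_profile_def[of \<theta>] intro: Lim_transform_eventually)
    next
      case False
      then have \<theta>1: "\<theta> = 1" using \<theta> by simp
      consider "\<bar>x\<bar> < 1" | "1 < \<bar>x\<bar>" using elim by fastforce
      then show ?thesis
      proof cases
        case 1
        then have i: "x \<in> {-1..1}" by auto
        have "\<forall>\<^sub>F n in sequentially. 1 = tail_profile (u n) x"
          using order_tendstoD(1)[OF lim, of "\<bar>x\<bar>"] 1 \<theta>1 i
          by (auto elim!: eventually_mono simp: tail_profile_def)
        then show ?thesis using i \<theta>1
          by (auto simp: tail_profile_def[of 1] intro: Lim_transform_eventually[OF tendsto_const])
      next
        case 2
        then have i: "x \<notin> {-1..1}" by auto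
        \<comment> \<open>Outside the limiting interval the exponent is at least y = (|x| - 1) / (1
          - u n), and exp (- y) <= 1 / y gives a bound that is linear in 1 - u n and also holds for
          u n = 1.\<close>
        have le: "norm (tail_profile (u n) x) \<le> (1 - u n) / (\<bar>x\<bar> - 1)" for n
        proof (cases "u n < 1")
          case True
          define y where "y = (\<bar>x\<bar> - 1) / (1 - u n)"
          have y: "y > 0" using 2 True by (simp add: y_def)
          have "y \<le> max (\<bar>x\<bar> - u n) 0 / (1 - u n)"
            unfolding y_def using True by (intro divide_right_mono) auto
          then have "tail_profile (u n) x \<le> exp (- y)" using True by (simp add: tail_profile_def)
          also have "\<dots> \<le> 1 / y"
          proof -
            have "y \<le> exp y" using exp_ge_add_one_self[of y] by linarith
            then show ?thesis using y by (simp add: exp_minus field_simps)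
          qed
          finally show ?thesis using True by (simp add: y_def tail_profile_def)
        next
          case False
          then have "u n = 1" using u[of n] by simp
          then show ?thesis using i by (simp add: tail_profile_def)
        qed
        have "(\<lambda>n. (1 - u n) / (\<bar>x\<bar> - 1)) \<longlonglongrightarrow> (1 - \<theta>) / (\<bar>x\<bar> - 1)"
          using 2 by (intro tendsto_intros lim) auto
        then have "(\<lambda>n. (1 - u n) / (\<bar>x\<bar> - 1)) \<longlonglongrightarrow> 0" using \<theta>1 by simp
        with always_eventually[OF allI[OF le]] have "(\<lambda>n. tail_profile (u n) x) \<longlonglongrightarrow> 0"
          by (rule Lim_null_comparison)
        then show ?thesis using i \<theta>1 by (simp add: tail_profile_def[of 1])
      qed
    qed
  qed
qed

lemma cut_profile_tendsto:
  assumes u: "\<And>n. u n \<in> {0..1}" and \<theta>: "\<theta> \<in> {0..1}" and lim: "u \<longlonglongrightarrow> \<theta>"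
  shows "AE x in lborel. (\<lambda>n. cut_profile (u n) x) \<longlonglongrightarrow> cut_profile \<theta> x"
proof -
  \<comment> \<open>The jump of the limit sits at 1 / (1 - \<theta>). For \<theta> = 1 there is no
    jump, and the convention 1 / 0 = 0 makes this the set {0}.\<close>
  have "finite {1 / (1 - \<theta>)}" by simp
  from AE_lborel_abs_notin[OF this] show ?thesis
  proof eventually_elim
    case (elim x)
    have l: "(\<lambda>n. (1 - u n) * \<bar>x\<bar>) \<longlonglongrightarrow> (1 - \<theta>) * \<bar>x\<bar>" by (intro tendsto_intros lim)
    have "(1 - \<theta>) * \<bar>x\<bar> \<noteq> 1"
    proof
      assume e: "(1 - \<theta>) * \<bar>x\<bar> = 1"
      then have "1 - \<theta> \<noteq> 0" by auto
      with e have "\<bar>x\<bar> = 1 / (1 - \<theta>)" by (simp add: eq_divide_eq mult.commute)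
      then show False using elim by simp
    qed
    then consider "(1 - \<theta>) * \<bar>x\<bar> < 1" | "1 < (1 - \<theta>) * \<bar>x\<bar>" by linarith
    then show ?case
    proof cases
      case 1
      have "(\<lambda>n. exp (- (u n * \<bar>x\<bar>))) \<longlonglongrightarrow> exp (- (\<theta> * \<bar>x\<bar>))" by (intro tendsto_intros lim)
      moreover have "\<forall>\<^sub>F n in sequentially. exp (- (u n * \<bar>x\<bar>)) = cut_profile (u n) x"
        using order_tendstoD(2)[OF l 1] by eventually_elim (simp add: cut_profile_def)
      ultimately show ?thesis using 1 by (auto simp: cut_profile_def[of \<theta>] intro: Lim_transform_eventually)
    next
      case 2
      have "\<forall>\<^sub>F n in sequentially. 0 = cut_profile (u n) x"
        using order_tendstoD(1)[OF l 2] by eventually_elim (simp add: cut_profile_def)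
      then show ?thesis using 2
        by (auto simp: cut_profile_def[of \<theta>] intro: Lim_transform_eventually[OF tendsto_const])
    qed
  qed
qed

lemma tail_profile_bound:
  assumes "\<theta> \<in> {0..1}"
  shows "tail_profile \<theta> x \<le> exp (1 - \<bar>x\<bar> / 2)"
proof (cases "\<theta> < 1")
  case True
  have "\<bar>x\<bar> - 1 \<le> max (\<bar>x\<bar> - \<theta>) 0 / (1 - \<theta>)"
  proof (cases "\<bar>x\<bar> \<le> 1")
    case True
    moreover have "0 \<le> max (\<bar>x\<bar> - \<theta>) 0 / (1 - \<theta>)" using \<open>\<theta> < 1\<close> by simp
    ultimately show ?thesis by linarith
  next
    case False
    have "(\<bar>x\<bar> - 1) * (1 - \<theta>) \<le> \<bar>x\<bar> - \<theta>"
      using False assms mult_left_mono[of 1 "\<bar>x\<bar>" \<theta>] by (simp add: algebra_simps)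
    also have "\<dots> \<le> max (\<bar>x\<bar> - \<theta>) 0" by simp
    finally show ?thesis using True by (simp add: pos_le_divide_eq)
  qed
  then have "tail_profile \<theta> x \<le> exp (1 - \<bar>x\<bar>)" using True by (simp add: tail_profile_def)
  also have "\<dots> \<le> exp (1 - \<bar>x\<bar> / 2)" by simp
  finally show ?thesis .
qed (auto simp: tail_profile_def indicator_def)

text \<open>Here the rate 1/2 originates: for \<theta> <= 1/2 the support is contained in |x| <= 2,
  where the bound is at least 1, and for \<theta> > 1/2 the profile itself decays at a rate above
  1/2.\<close>

lemma cut_profile_bound:
  assumes "\<theta> \<in> {0..1}"
  shows "cut_profile \<theta> x \<le> exp (1 - \<bar>x\<bar> / 2)"
proof (cases "(1 - \<theta>) * \<bar>x\<bar> \<le> 1")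
  case True
  have "\<bar>x\<bar> / 2 - 1 \<le> \<theta> * \<bar>x\<bar>"
  proof (cases "\<theta> \<le> 1 / 2")
    case True
    then have "1 / 2 * \<bar>x\<bar> \<le> (1 - \<theta>) * \<bar>x\<bar>" by (intro mult_right_mono) auto
    then have "\<bar>x\<bar> / 2 - 1 \<le> 0" using \<open>(1 - \<theta>) * \<bar>x\<bar> \<le> 1\<close> by simp
    also have "0 \<le> \<theta> * \<bar>x\<bar>" using assms by simp
    finally show ?thesis .
  next
    case False
    then have "1 / 2 * \<bar>x\<bar> \<le> \<theta> * \<bar>x\<bar>" by (intro mult_right_mono) auto
    then show ?thesis by simp
  qed
  then show ?thesis using True by (simp add: cut_profile_def)
qed (simp add: cut_profile_def)

lemma F_minusI: "0 \<le> \<alpha> \<Longrightarrow> 0 < \<gamma> \<Longrightarrow> (\<alpha>, \<gamma>) \<noteq> (0, \<infinity>) \<Longrightarrow> f_dens \<alpha> \<gamma> \<in> F_minus"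
  unfolding F_minus_def by blast

lemma F_plusI: "0 < \<alpha> \<Longrightarrow> 0 \<le> \<gamma> \<Longrightarrow> (\<alpha>, \<gamma>) \<noteq> (\<infinity>, 0) \<Longrightarrow> g_dens \<alpha> \<gamma> \<in> F_plus"
  unfolding F_plus_def by blast

lemma F_minus_exists:
  assumes p: "p > 2" and ab: "a > 0" "b > 0"
    and lower: "3 powr (1/2) * (p + 1) powr (- 1 / p) \<le> b / a"
    and upper: "b / a \<le> 2 powr (- 1/2) * Gamma (p + 1) powr (1 / p)"
  shows "\<exists>f. f \<in> F_minus \<and> density_moments p a b f"
proof -
  obtain \<theta> l c where *: "\<theta> \<in> {0..1}" "l > 0" "c > 0"
    "(\<integral>\<^sup>+ x. ennreal (c * tail_profile \<theta> (x / l)) \<partial>lborel) = 1"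
    "density_moments p a b (\<lambda>x. c * tail_profile \<theta> (x / l))"
  proof (rule exists_scaled_profile[OF p ab lower upper, of tail_profile 1 0], goal_cases)
    case (4 u \<theta>)
    then show ?case by (intro tail_profile_tendsto)
  next
    case (5 \<theta> x)
    then show ?case by (auto simp: tail_profile_def indicator_def)
  next
    case (10 \<theta> l c)
    show ?case by (rule 10(1)[OF 10(2-)])
  qed (auto simp: tail_profile_measurable tail_profile_bound, auto simp: tail_profile_def)
  have "\<exists>f c'. f \<in> F_minus \<and> c' > 0 \<and> f = (\<lambda>x. c' * tail_profile \<theta> (x / l))"
  proof (cases "\<theta> < 1")
    case True
    \<comment> \<open>Passing to x / l turns the plateau end \<theta> into l \<theta> and the rate 1
      / (1 - \<theta>) into g.\<close>
    define g where "g = 1 / (l * (1 - \<theta>))"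
    have g: "g > 0" using True *(2) by (simp add: g_def)
    have e: "max (\<bar>x / l\<bar> - \<theta>) 0 / (1 - \<theta>) = g * max (\<bar>x\<bar> - l * \<theta>) 0" for x
    proof -
      have "max (\<bar>x / l\<bar> - \<theta>) 0 = max (\<bar>x\<bar> - l * \<theta>) 0 / l"
        using *(2) by (auto simp: max_def field_simps)
      then show ?thesis by (simp add: g_def)
    qed
    have "f_dens (l * \<theta>) (ereal g) \<in> F_minus"
      by (rule F_minusI) (use * g in auto)
    moreover have "f_dens (l * \<theta>) (ereal g) = (\<lambda>x. 1 / (2 * (l * \<theta> + 1 / g)) * tail_profile \<theta> (x / l))"
      unfolding tail_profile_def e by (rule ext) (simp add: f_dens_def True)
    moreover have "1 / (2 * (l * \<theta> + 1 / g)) > 0" using * g by (auto intro!: add_nonneg_pos)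
    ultimately show ?thesis by blast
  next
    case False
    have "f_dens l \<infinity> \<in> F_minus" by (rule F_minusI) (use * in auto)
    moreover have "f_dens l \<infinity> = (\<lambda>x. 1 / (2 * l) * tail_profile \<theta> (x / l))"
      using False * by (intro ext) (auto simp: f_dens_def tail_profile_def indicator_def field_simps)
    ultimately show ?thesis using * by (intro exI[of _ "f_dens l \<infinity>"] exI[of _ "1 / (2 * l)"]) auto
  qed
  then obtain f c' where f: "f \<in> F_minus" "c' > 0" "f = (\<lambda>x. c' * tail_profile \<theta> (x / l))" by blast
  have [measurable]: "tail_profile \<theta> \<in> borel_measurable borel" by (rule tail_profile_measurable)
  have "c = c'"
    by (rule proportional_densities[of "\<lambda>x. tail_profile \<theta> (x / l)"])
      (use * F_minus_properties(4)[OF f(1)] f in \<open>auto simp: tail_profile_def\<close>)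
  then show ?thesis using f * by auto
qed

lemma F_plus_exists:
  assumes p: "p > 2" and ab: "a > 0" "b > 0"
    and lower: "3 powr (1/2) * (p + 1) powr (- 1 / p) \<le> b / a"
    and upper: "b / a \<le> 2 powr (- 1/2) * Gamma (p + 1) powr (1 / p)"
  shows "\<exists>f. f \<in> F_plus \<and> density_moments p a b f"
proof -
  obtain \<theta> l c where *: "\<theta> \<in> {0..1}" "l > 0" "c > 0"
    "(\<integral>\<^sup>+ x. ennreal (c * cut_profile \<theta> (x / l)) \<partial>lborel) = 1"
    "density_moments p a b (\<lambda>x. c * cut_profile \<theta> (x / l))"
  proof (rule exists_scaled_profile[OF p ab lower upper, of cut_profile 0 1], goal_cases)
    case (4 u \<theta>)
    then show ?case by (intro cut_profile_tendsto)
  next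
    case (5 \<theta> x)
    then have "(1 - \<theta>) * \<bar>x\<bar> \<le> 1" using mult_mono[of "1 - \<theta>" 1 "\<bar>x\<bar>" 1] by simp
    then show ?case by (simp add: cut_profile_def)
  next
    case (10 \<theta> l c)
    show ?case by (rule 10(1)[OF 10(2-)])
  qed (auto simp: cut_profile_measurable cut_profile_bound, auto simp: cut_profile_def indicator_def)
  have "\<exists>f c'. f \<in> F_plus \<and> c' > 0 \<and> f = (\<lambda>x. c' * cut_profile \<theta> (x / l))"
  proof (cases "\<theta> < 1")
    case False
    then have \<theta>: "\<theta> = 1" using * by simp
    have "g_dens \<infinity> (1 / l) \<in> F_plus" by (rule F_plusI) (use * in auto)
    moreover have "g_dens \<infinity> (1 / l) = (\<lambda>x. 1 / l / 2 * cut_profile \<theta> (x / l))"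
      using \<theta> * by (intro ext) (auto simp: g_dens_def cut_profile_def)
    moreover have "1 / l / 2 > 0" using * by simp
    ultimately show ?thesis by blast
  next
    case True
    \<comment> \<open>Passing to x / l turns the cut 1 / (1 - \<theta>) into r and the rate \<theta>
      into \<theta> / l.\<close>
    define r where "r = l / (1 - \<theta>)"
    have r: "r > 0" using True * by (simp add: r_def)
    have mem: "g_dens (ereal r) (\<theta> / l) \<in> F_plus" by (rule F_plusI) (use * r in auto)
    have cond: "(1 - \<theta>) * \<bar>x / l\<bar> \<le> 1 \<longleftrightarrow> \<bar>x\<bar> \<le> r" for x
      using * True by (simp add: r_def field_simps)
    have cp: "cut_profile \<theta> (x / l) = (if \<bar>x\<bar> \<le> r then exp (- (\<theta> * \<bar>x / l\<bar>)) else 0)" for x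
      by (simp only: cut_profile_def cond)
    have ind: "indicator {-r..r} x = (if \<bar>x\<bar> \<le> r then 1 else 0 :: real)"
      "indicator {x. \<bar>x\<bar> \<le> r} x = (if \<bar>x\<bar> \<le> r then 1 else 0 :: real)" for x
      by (auto simp: indicator_def abs_le_iff)
    \<comment> \<open>The case \<theta> = 0 is separated because \<open>g_dens\<close> gives the
      rate 0 a branch of its own.\<close>
    show ?thesis
    proof (cases "\<theta> = 0")
      case True
      have "g_dens (ereal r) (\<theta> / l) = (\<lambda>x. 1 / (2 * r) * cut_profile \<theta> (x / l))"
        unfolding cp by (rule ext) (simp add: g_dens_def ind True)
      moreover have "1 / (2 * r) > 0" using r by simp
      ultimately show ?thesis using mem by blast
    next
      case False
      then have t: "\<theta> / l > 0" using * by simp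
      have "g_dens (ereal r) (\<theta> / l) = (\<lambda>x. \<theta> / l / (2 * (1 - exp (- (r * (\<theta> / l))))) * cut_profile \<theta> (x / l))"
        unfolding cp using t *(2) False by (intro ext) (simp add: g_dens_def ind)
      moreover have "\<theta> / l / (2 * (1 - exp (- (r * (\<theta> / l))))) > 0"
        using mult_pos_pos[OF r t] by (intro divide_pos_pos[OF t]) simp
      ultimately show ?thesis using mem by blast
    qed
  qed
  then obtain f c' where f: "f \<in> F_plus" "c' > 0" "f = (\<lambda>x. c' * cut_profile \<theta> (x / l))" by blast
  have [measurable]: "cut_profile \<theta> \<in> borel_measurable borel" by (rule cut_profile_measurable)
  have "c = c'"
    by (rule proportional_densities[of "\<lambda>x. cut_profile \<theta> (x / l)"])
      (use * F_plus_properties(4)[OF f(1)] f in \<open>auto simp: cut_profile_def\<close>)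
  then show ?thesis using f * by auto
qed

section \<open>From equality almost everywhere to equality at every point\<close>

lemma AE_lborel_open_witness:
  fixes S :: "real set"
  assumes "AE x in lborel. P x" "open S" "S \<noteq> {}"
  shows "\<exists>x\<in>S. P x"
proof (rule ccontr)
  assume "\<not> (\<exists>x\<in>S. P x)"
  then have "AE x in lborel. x \<notin> S" using assms(1) by (auto elim!: eventually_mono)
  then have "S \<in> null_sets lborel"
    using assms(2) by (subst AE_iff_null_sets) auto
  then have "negligible S" unfolding negligible_iff_null_sets by (rule null_sets_completionI)
  then show False using open_not_negligible assms by blast
qed

text \<open>The supports end at the same place, since on a gap one density would vanish and the
  other be positive on an open set. Inside, the continuous factors agree because the set where they
  differ is open; at the edge, a null set, equality follows by passing to the limit from
  inside.\<close>

lemma truncated_AE_eq_imp_eq: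
  fixes u u' :: "real \<Rightarrow> real" and A A' :: ereal
  assumes f: "\<And>x. f x = (if ereal \<bar>x\<bar> \<le> A then u x else 0)" and f': "\<And>x. f' x = (if ereal \<bar>x\<bar> \<le> A' then u' x else 0)"
    and u: "continuous_on UNIV u" "\<And>x. 0 < u x" "continuous_on UNIV u'" "\<And>x. 0 < u' x"
    and A: "0 < A" "0 < A'" and ae: "AE x in lborel. f x = f' x"
  shows "f = f'"
proof -
  have no: "\<not> B < B'" if B: "0 < B" "\<And>x. h x = (if ereal \<bar>x\<bar> \<le> B then v x else 0)"
    "\<And>x. h' x = (if ereal \<bar>x\<bar> \<le> B' then v' x else 0)" "AE x in lborel. h x = h' x"
    "\<And>x. 0 < v' x" for B B' :: ereal and h h' v v' :: "real \<Rightarrow> real"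
  proof
    assume lt: "B < B'"
    then obtain b c where b: "B = ereal b" "B < ereal c" "ereal c < B'"
      using B(1) ereal_dense2[OF lt] by (cases B) auto
    obtain x where "x \<in> {b<..<c}" "h x = h' x"
      using AE_lborel_open_witness[OF B(4), of "{b<..<c}"] b by auto
    moreover have "ereal x \<le> B'" using b \<open>x \<in> _\<close> by (intro less_imp_le) (auto intro: less_trans[of _ "ereal c"])
    ultimately show False using B(5)[of x] B(1) b by (auto simp: B(2,3))
  qed
  have "AE x in lborel. f' x = f x" using ae by eventually_elim simp
  then have AA: "A = A'"
    using no[OF A(1) f f' ae u(4)] no[OF A(2) f' f _ u(2)] by (meson linorder_less_linear)
  have op: "open {x. ereal \<bar>x\<bar> < A \<and> u x \<noteq> u' x}"
  proof -
    have "open {x. ereal \<bar>x\<bar> < A}" by (intro open_Collect_less continuous_intros)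
    moreover have "open {x. u x \<noteq> u' x}" using u by (intro open_Collect_neq) auto
    ultimately show ?thesis by (simp add: Collect_conj_eq open_Int)
  qed
  have in_eq: "u x = u' x" if lt: "ereal \<bar>x\<bar> < A" for x
  proof (rule ccontr)
    assume "u x \<noteq> u' x"
    then obtain y where "ereal \<bar>y\<bar> < A" "u y \<noteq> u' y" "f y = f' y"
      using AE_lborel_open_witness[OF ae op] lt by auto
    then show False by (simp add: f f' AA less_imp_le)
  qed
  have "u x = u' x" if x: "ereal \<bar>x\<bar> \<le> A" for x
  proof (cases "x = 0")
    case True
    then show ?thesis using in_eq[of 0] A by (simp add: zero_ereal_def)
  next
    case False
    \<comment> \<open>These points tend to x and are strictly closer to 0, hence in the interior;
      for n = 0 the point is 0 itself.\<close>
    let ?y = "\<lambda>n. (1 - inverse (real (Suc n))) * x"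
    have y: "?y \<longlonglongrightarrow> (1 - 0) * x" by (intro tendsto_intros LIMSEQ_inverse_real_of_nat)
    have "ereal \<bar>?y n\<bar> < ereal \<bar>x\<bar>" for n
      using False by (simp add: abs_mult field_simps)
    from less_le_trans[OF this x] have "u (?y n) = u' (?y n)" for n by (rule in_eq)
    moreover have "(\<lambda>n. u (?y n)) \<longlonglongrightarrow> u x" "(\<lambda>n. u' (?y n)) \<longlonglongrightarrow> u' x"
      using continuous_on_tendsto_compose[OF u(1) y] continuous_on_tendsto_compose[OF u(3) y] by simp_all
    ultimately show ?thesis using LIMSEQ_unique by simp
  qed
  then show ?thesis by (auto simp: f f' AA)
qed

lemma F_minus_truncated:
  assumes "f \<in> F_minus"
  obtains A u where "0 < A" "continuous_on UNIV u" "\<And>x. 0 < u x" "\<And>x. f x = (if ereal \<bar>x\<bar> \<le> A then u x else 0)"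
  using assms
proof (cases rule: F_minus_cases)
  case (uniform \<alpha> C)
  then show ?thesis by (intro that[of "ereal \<alpha>" "\<lambda>_. C"]) auto
next
  case (tail \<alpha> g C)
  then show ?thesis
    by (intro that[of \<infinity> "\<lambda>x. C * exp (- (g * max (\<bar>x\<bar> - \<alpha>) 0))"]) (auto intro!: continuous_intros)
qed

lemma F_minus_plateau:
  assumes "f \<in> F_minus"
  obtains \<alpha> C where "0 \<le> \<alpha>" "0 < C" "\<And>x. \<bar>x\<bar> \<le> \<alpha> \<Longrightarrow> f x = C"
    "(\<forall>x>\<alpha>. f x = 0) \<or> (\<exists>g. \<forall>x\<ge>\<alpha>. f x = C * exp (g * \<alpha>) * exp (- (g * x)))"
  using assms
proof (cases rule: F_minus_cases)
  case (uniform \<alpha> C)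
  then show ?thesis by (intro that[of \<alpha> C]) auto
next
  case (tail \<alpha> g C)
  then show ?thesis
    by (intro that[of \<alpha> C] disjI2 exI[of _ g]) (auto simp: exp_add[symmetric] algebra_simps)
qed

lemma F_minus_lconc:
  assumes "f \<in> F_minus"
  shows "lconc f"
proof -
  have "\<exists>\<phi>. convex_ereal \<phi> \<and> (\<forall>x. f x = exp_neg (\<phi> x))"
    by (rule F_minus_convex_potential[OF assms]) blast
  then obtain \<phi> where \<phi>: "convex_ereal \<phi>" "\<And>x. f x = exp_neg (\<phi> x)" by blast
  have "f = (\<lambda>x. exp_neg (\<phi> x))" by (rule ext) (rule \<phi>(2))
  then show ?thesis using lconc_exp_neg[OF \<phi>(1)] by simp
qed

text \<open>Let h have the longer plateau. Up to \<alpha> both densities are constant, and past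
  \<alpha> f vanishes or is log-affine while h is log-concave. So {f <= h} meets the positive
  half-line in an interval, and \<open>null_moments_interval_AE_zero\<close> applies.\<close>

lemma F_minus_unique:
  assumes p: "p > 2" and f: "f \<in> F_minus" "density_moments p a b f" and h: "h \<in> F_minus" "density_moments p a b h"
  shows "f = h"
proof -
  have key: "AE x in lborel. h x - f x = 0"
    if f: "dens p a b f" "\<And>x. \<bar>x\<bar> \<le> \<alpha> \<Longrightarrow> f x = C" "0 < C" "0 \<le> \<alpha>"
      "(\<forall>x>\<alpha>. f x = 0) \<or> (\<exists>g. \<forall>x\<ge>\<alpha>. f x = C * exp (g * \<alpha>) * exp (- (g * x)))"
    and h: "dens p a b h" "lconc h" "\<And>x. \<bar>x\<bar> \<le> \<beta> \<Longrightarrow> h x = B" "\<alpha> \<le> \<beta>" for f h :: "real \<Rightarrow> real" and \<alpha> \<beta> B C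
  proof (rule null_moments_interval_AE_zero[OF null_moments_diff[OF h(1) f(1)] p, of "{}" "{x. 0 < x \<and> f x \<le> h x}"], goal_cases)
    case (2 x y z)
    have hz: "0 \<le> h z" using h(1) by (simp add: dens_def)
    have flat: "f w = C" "h w = B" if "0 \<le> w" "w \<le> \<alpha>" for w using f(2) h(3,4) that by auto
    show ?case
    proof (cases "z \<le> \<alpha>")
      case True
      then show ?thesis using 2 flat[of x] flat[of z] by simp
    next
      case False
      from f(5) show ?thesis
      proof (elim disjE exE)
        assume "\<forall>x>\<alpha>. f x = 0"
        then show ?thesis using False 2 hz by simp
      next
        fix g assume g: "\<forall>x\<ge>\<alpha>. f x = C * exp (g * \<alpha>) * exp (- (g * x))"
        \<comment> \<open>The tail formula holds only from \<alpha> on; for x on the common plateau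
          the comparison at x is the same as at \<alpha>.\<close>
        have "f (max x \<alpha>) \<le> h (max x \<alpha>)"
          using 2 flat[of x] flat[of \<alpha>] f(4) by (auto simp: max_def)
        then have "C * exp (g * \<alpha>) * exp (- (g * z)) \<le> h z"
          using g False 2 f(3) by (intro lconc_loglinear[OF h(2), of _ "max x \<alpha>" z y]) auto
        then show ?thesis using g False 2 by simp
      qed
    qed
  qed auto
  have ff: "dens p a b f" "dens p a b h" "lconc f" "lconc h"
    using f h by (auto intro: dens_F_minus F_minus_lconc)
  obtain \<alpha> C where 1: "0 \<le> \<alpha>" "0 < C" "\<And>x. \<bar>x\<bar> \<le> \<alpha> \<Longrightarrow> f x = C"
    "(\<forall>x>\<alpha>. f x = 0) \<or> (\<exists>g. \<forall>x\<ge>\<alpha>. f x = C * exp (g * \<alpha>) * exp (- (g * x)))"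
    using F_minus_plateau[OF f(1)] by metis
  obtain \<beta> B where 2: "0 \<le> \<beta>" "0 < B" "\<And>x. \<bar>x\<bar> \<le> \<beta> \<Longrightarrow> h x = B"
    "(\<forall>x>\<beta>. h x = 0) \<or> (\<exists>g. \<forall>x\<ge>\<beta>. h x = B * exp (g * \<beta>) * exp (- (g * x)))"
    using F_minus_plateau[OF h(1)] by metis
  have "AE x in lborel. f x = h x"
  proof (cases "\<alpha> \<le> \<beta>")
    case True
    have "AE x in lborel. h x - f x = 0" by (rule key[of f \<alpha> C h \<beta> B]) (use 1 2 ff True in auto)
    then show ?thesis by eventually_elim simp
  next
    case False
    then have "\<beta> \<le> \<alpha>" by simp
    have "AE x in lborel. f x - h x = 0" by (rule key[of h \<beta> B f \<alpha> C]) (use 1 2 ff \<open>\<beta> \<le> \<alpha>\<close> in auto)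
    then show ?thesis by eventually_elim simp
  qed
  moreover obtain A u where "0 < A" "continuous_on UNIV u" "\<And>x. 0 < u x"
      "\<And>x. f x = (if ereal \<bar>x\<bar> \<le> A then u x else 0)"
    by (rule F_minus_truncated[OF f(1)]) blast
  moreover obtain A' u' where "0 < A'" "continuous_on UNIV u'" "\<And>x. 0 < u' x"
      "\<And>x. h x = (if ereal \<bar>x\<bar> \<le> A' then u' x else 0)"
    by (rule F_minus_truncated[OF h(1)]) blast
  ultimately show ?thesis by (intro truncated_AE_eq_imp_eq[of f A u h A' u'])
qed

text \<open>Let f have the shorter support. There the difference of the logarithms is affine in |x|,
  and elsewhere f vanishes; so {h < f} meets the positive half-line in an interval.\<close>

lemma F_plus_unique:
  assumes p: "p > 2" and f: "f \<in> F_plus" "density_moments p a b f" and h: "h \<in> F_plus" "density_moments p a b h"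
  shows "f = h"
proof -
  have key: "AE x in lborel. f x - h x = 0"
    if f: "dens p a b f" "0 < C" "\<And>x. f x = (if ereal \<bar>x\<bar> \<le> A then C * exp (- (g * \<bar>x\<bar>)) else 0)"
    and h: "dens p a b h" "0 < C'" "\<And>x. h x = (if ereal \<bar>x\<bar> \<le> A' then C' * exp (- (g' * \<bar>x\<bar>)) else 0)"
    and AA: "A \<le> A'" for f h :: "real \<Rightarrow> real" and A A' C C' g g'
  proof (rule null_moments_interval_AE_zero[OF null_moments_diff[OF f(1) h(1)] p, of "{}" "{x. 0 < x \<and> h x < f x}"], goal_cases)
    case (2 x y z)
    have h0: "0 \<le> h w" for w using h(1) by (simp add: dens_def)
    have y: "ereal y \<le> A" using 2 h0[of y] by (auto simp: f(3) split: if_splits)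
    have lin: "h w < f w \<longleftrightarrow> ln C' - g' * w < ln C - g * w" if "0 \<le> w" "w \<le> y" for w
    proof -
      have w: "ereal w \<le> A" "ereal w \<le> A'" using y AA that by (auto intro: order_trans[of _ "ereal y"] order_trans[of _ A])
      have "h w < f w \<longleftrightarrow> exp (ln C' - g' * w) < exp (ln C - g * w)"
        using that w f(2) h(2) by (simp add: f(3) h(3) exp_diff exp_minus divide_inverse)
      then show ?thesis by simp
    qed
    have "ln C' - g' * z < ln C - g * z"
    proof (cases "g' \<le> g")
      case True
      then have "(g - g') * z \<le> (g - g') * y" using 2 by (intro mult_left_mono) auto
      then show ?thesis using 2 lin[of y] by (simp add: algebra_simps)
    next
      case False
      then have "(g' - g) * x \<le> (g' - g) * z" using 2 by (intro mult_left_mono) auto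
      then show ?thesis using 2 lin[of x] by (simp add: algebra_simps)
    qed
    then show ?case using lin[of z] 2 by simp
  qed auto
  obtain A g C where 1: "A > 0" "g \<ge> 0" "C > 0"
    "\<And>x. f x = (if ereal \<bar>x\<bar> \<le> A then C * exp (- (g * \<bar>x\<bar>)) else 0)"
    using F_plus_cases[OF f(1)] by metis
  obtain A' g' C' where 2: "A' > 0" "g' \<ge> 0" "C' > 0"
    "\<And>x. h x = (if ereal \<bar>x\<bar> \<le> A' then C' * exp (- (g' * \<bar>x\<bar>)) else 0)"
    using F_plus_cases[OF h(1)] by metis
  have ff: "dens p a b f" "dens p a b h" using f h by (auto intro: dens_F_plus)
  have ae: "AE x in lborel. f x = h x"
  proof (cases "A \<le> A'")
    case True
    from key[OF ff(1) 1(3,4) ff(2) 2(3,4) True] show ?thesis by eventually_elim simp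
  next
    case False
    then have "A' \<le> A" by simp
    from key[OF ff(2) 2(3,4) ff(1) 1(3,4) this] show ?thesis by eventually_elim simp
  qed
  show ?thesis
    by (rule truncated_AE_eq_imp_eq[OF 1(4) 2(4) _ _ _ _ 1(1) 2(1) ae])
      (use 1 2 in \<open>auto intro!: continuous_intros\<close>)
qed

section \<open>Sums of independent variables\<close>

lemma distr_lborel_eq: "distr M lborel X = distr M borel X"
  by (rule distr_cong) auto

lemma AE_even_of_distr_symmetric:
  fixes h :: "real \<Rightarrow> ennreal"
  assumes [measurable]: "h \<in> borel_measurable borel" and "prob_space M"
    and X: "distributed M lborel X h" and sym: "distr M borel X = distr M borel (\<lambda>\<omega>. - X \<omega>)"
  shows "AE x in lborel. h x = h (- x)"
proof -
  have "distributed M lborel (\<lambda>\<omega>. 0 + (-1) * X \<omega>) (\<lambda>x. h ((x - 0) / (-1)) / ennreal \<bar>-1\<bar>)"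
    by (rule prob_space.distributed_affine[OF assms(2) X]) simp
  then have "distributed M lborel (\<lambda>\<omega>. - X \<omega>) (\<lambda>x. h (- x))" by (simp add: divide_ennreal_def)
  then have "distr M lborel (\<lambda>\<omega>. - X \<omega>) = density lborel (\<lambda>x. h (- x))"
    by (simp add: distributed_def)
  moreover have "distr M lborel X = density lborel h" using X by (simp add: distributed_def)
  moreover have "distr M lborel X = distr M lborel (\<lambda>\<omega>. - X \<omega>)"
    using sym by (simp only: distr_lborel_eq)
  ultimately have "density lborel h = density lborel (\<lambda>x. h (- x))" by (simp add: divide_ennreal_def)
  then show ?thesis by (subst (asm) sigma_finite_measure.density_unique_iff[OF sigma_finite_lborel]) auto
qed

lemma exp_neg_nonneg: "0 \<le> exp_neg u"
  by (simp add: exp_neg_def)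

text \<open>The given log-concave density is replaced by its geometric mean with the reflection:
  this is still a density of X, and it is even at every point, as \<open>dens\<close>
  demands.\<close>

lemma admissible_density:
  assumes M: "prob_space M" and sym: "symmetric_rv M X" and lc: "log_concave_rv M X"
    and m: "second_moment M X = ennreal (a\<^sup>2)" "abs_moment M p X = ennreal (b powr p)"
  shows "\<exists>h. lconc h \<and> dens p a b h \<and> distributed M lborel X (\<lambda>x. ennreal (h x))"
proof -
  interpret prob_space M by fact
  obtain \<phi> where \<phi>: "convex_ereal \<phi>" "distributed M lborel X (\<lambda>x. ennreal (exp_neg (\<phi> x)))"
    using lc by (auto simp: log_concave_rv_def)
  define k where "k x = exp_neg (\<phi> x)" for x
  have k0: "0 \<le> k x" for x by (simp add: k_def exp_neg_nonneg)
  have kd: "distributed M lborel X (\<lambda>x. ennreal (k x))" using \<phi>(2) by (simp add: k_def)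
  \<comment> \<open>\<open>distributed\<close> gives measurability of the
    \<open>ennreal\<close>-valued density; composing with \<open>enn2real\<close> recovers it for
    k.\<close>
  have "(\<lambda>x. enn2real (ennreal (k x))) \<in> borel_measurable borel"
    using kd by (auto simp: distributed_def)
  then have km [measurable]: "k \<in> borel_measurable borel" using k0 by simp
  have klc: "lconc k" using lconc_exp_neg[OF \<phi>(1)] by (simp add: k_def[abs_def])
  have "AE x in lborel. ennreal (k x) = ennreal (k (- x))"
    using AE_even_of_distr_symmetric[OF _ M kd] sym by (simp add: symmetric_rv_def)
  then have ae: "AE x in lborel. sqrt (k x * k (- x)) = k x"
    by eventually_elim (simp add: k0)
  define h where "h x = sqrt (k x * k (- x))" for x
  have hm [measurable]: "h \<in> borel_measurable borel" unfolding h_def by measurable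
  have h0: "0 \<le> h x" for x using k0 by (simp add: h_def)
  have "AE x in lborel. ennreal (h x) = ennreal (k x)" using ae by eventually_elim (simp add: h_def)
  then have "density lborel (\<lambda>x. ennreal (h x)) = density lborel (\<lambda>x. ennreal (k x))"
    by (intro density_cong) auto
  then have hd: "distributed M lborel X (\<lambda>x. ennreal (h x))"
    using kd by (auto simp: distributed_def)
  have "(\<integral>\<^sup>+ x. ennreal (h x) * 1 \<partial>lborel) = (\<integral>\<^sup>+ \<omega>. 1 \<partial>M)"
    by (rule distributed_nn_integral[OF hd]) simp
  then have 1: "(\<integral>\<^sup>+ x. ennreal (h x) \<partial>lborel) = 1" by (simp add: emeasure_space_1)
  have 2: "(\<integral>\<^sup>+ x. ennreal (x\<^sup>2 * h x) \<partial>lborel) = second_moment M X"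
    unfolding second_moment_def
    by (subst distributed_nn_integral[OF hd, symmetric])
      (auto simp: h0 ennreal_mult mult.commute)
  have 3: "(\<integral>\<^sup>+ x. ennreal (\<bar>x\<bar> powr p * h x) \<partial>lborel) = abs_moment M p X"
    unfolding abs_moment_def
    by (subst distributed_nn_integral[OF hd, symmetric])
      (auto simp: h0 ennreal_mult mult.commute)
  have "lconc h" using lconc_symmetrize[OF klc] by (simp add: h_def[abs_def])
  moreover have "dens p a b h"
    unfolding dens_def density_moments_def using hm h0 1 2 3 m by (simp add: h_def mult.commute)
  ultimately show ?thesis using hd by blast
qed

text \<open>Makes the extremal variables competitors, so that the infimum and the supremum are
  attained.\<close>

lemma distributed_density_admissible:
  assumes Y: "distributed M lborel Y (\<lambda>x. ennreal (f x))" and M: "prob_space M" and f: "dens p a b f"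
    and \<phi>: "convex_ereal \<phi>" "\<And>x. f x = exp_neg (\<phi> x)"
  shows "symmetric_rv M Y" "log_concave_rv M Y" "second_moment M Y = ennreal (a\<^sup>2)" "abs_moment M p Y = ennreal (b powr p)"
proof -
  have [measurable]: "f \<in> borel_measurable borel" and f0: "\<And>x. 0 \<le> f x" and ev: "\<And>x. f (- x) = f x"
    and m: "density_moments p a b f" using f by (auto simp: dens_def)
  have "distributed M lborel (\<lambda>\<omega>. 0 + (-1) * Y \<omega>) (\<lambda>x. ennreal (f ((x - 0) / (-1))) / ennreal \<bar>-1\<bar>)"
    by (rule prob_space.distributed_affine[OF M Y]) simp
  then have "distributed M lborel (\<lambda>\<omega>. - Y \<omega>) (\<lambda>x. ennreal (f x))" by (simp add: ev divide_ennreal_def)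
  then have "distr M lborel Y = distr M lborel (\<lambda>\<omega>. - Y \<omega>)" using Y by (simp add: distributed_def)
  then show "symmetric_rv M Y" by (simp only: symmetric_rv_def distr_lborel_eq)
  show "log_concave_rv M Y" using Y \<phi> unfolding log_concave_rv_def by (intro exI[of _ \<phi>]) simp
  show "second_moment M Y = ennreal (a\<^sup>2)"
    unfolding second_moment_def using m
    by (subst distributed_nn_integral[OF Y, symmetric])
      (auto simp: f0 ennreal_mult mult.commute density_moments_def)
  show "abs_moment M p Y = ennreal (b powr p)"
    unfolding abs_moment_def using m
    by (subst distributed_nn_integral[OF Y, symmetric])
      (auto simp: f0 ennreal_mult mult.commute density_moments_def)
qed

text \<open>The free shift s carries the induction: with coordinate i fixed at y, the remaining sum
  is treated with the shift y + s; after an exchange of the integrals the remaining coordinates are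
  fixed and form the shift in the comparison of coordinate i.\<close>

lemma PiM_sum_powr_mono:
  fixes \<mu> \<nu> :: "'i \<Rightarrow> real measure"
  assumes "finite I" and \<mu>: "\<And>i. prob_space (\<mu> i)" "\<And>i. sets (\<mu> i) = sets borel"
    and \<nu>: "\<And>i. prob_space (\<nu> i)" "\<And>i. sets (\<nu> i) = sets borel"
    and le: "\<And>i s. i \<in> I \<Longrightarrow> (\<integral>\<^sup>+ x. ennreal (\<bar>x + s\<bar> powr p) \<partial>\<mu> i) \<le> (\<integral>\<^sup>+ x. ennreal (\<bar>x + s\<bar> powr p) \<partial>\<nu> i)"
  shows "(\<integral>\<^sup>+ x. ennreal (\<bar>(\<Sum>i\<in>I. x i) + s\<bar> powr p) \<partial>PiM I \<mu>) \<le> (\<integral>\<^sup>+ x. ennreal (\<bar>(\<Sum>i\<in>I. x i) + s\<bar> powr p) \<partial>PiM I \<nu>)"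
  using assms(1) le
proof (induction I arbitrary: s rule: finite_induct)
  case empty
  then show ?case by (simp add: PiM_empty)
next
  case (insert i I)
  interpret \<mu>: product_sigma_finite \<mu>
    using \<mu>(1) by (intro product_sigma_finite.intro prob_space_imp_sigma_finite)
  interpret \<nu>: product_sigma_finite \<nu>
    using \<nu>(1) by (intro product_sigma_finite.intro prob_space_imp_sigma_finite)
  note [measurable_cong] = \<mu>(2) \<nu>(2)
  have mm [measurable]: "(\<lambda>x. ennreal (\<bar>(\<Sum>j\<in>insert i I. x j) + s\<bar> powr p)) \<in> borel_measurable (PiM (insert i I) \<mu>)"
    "(\<lambda>x. ennreal (\<bar>(\<Sum>j\<in>insert i I. x j) + s\<bar> powr p)) \<in> borel_measurable (PiM (insert i I) \<nu>)"
    by measurable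
  have upd: "(\<Sum>j\<in>insert i I. (x(i := y)) j) + s = y + ((\<Sum>j\<in>I. x j) + s)" for x :: "'i \<Rightarrow> real" and y
  proof -
    have "(\<Sum>j\<in>I. (x(i := y)) j) = (\<Sum>j\<in>I. x j)" using insert.hyps by (intro sum.cong) auto
    then show ?thesis using insert.hyps by simp
  qed
  have "(\<integral>\<^sup>+ x. ennreal (\<bar>(\<Sum>j\<in>insert i I. x j) + s\<bar> powr p) \<partial>PiM (insert i I) \<mu>)
      = (\<integral>\<^sup>+ y. (\<integral>\<^sup>+ x. ennreal (\<bar>y + ((\<Sum>j\<in>I. x j) + s)\<bar> powr p) \<partial>PiM I \<mu>) \<partial>\<mu> i)"
    using \<mu>.product_nn_integral_insert_rev[OF insert.hyps mm(1)] unfolding upd .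
  also have "\<dots> = (\<integral>\<^sup>+ y. (\<integral>\<^sup>+ x. ennreal (\<bar>(\<Sum>j\<in>I. x j) + (y + s)\<bar> powr p) \<partial>PiM I \<mu>) \<partial>\<mu> i)"
    by (simp add: algebra_simps)
  also have "\<dots> \<le> (\<integral>\<^sup>+ y. (\<integral>\<^sup>+ x. ennreal (\<bar>(\<Sum>j\<in>I. x j) + (y + s)\<bar> powr p) \<partial>PiM I \<nu>) \<partial>\<mu> i)"
    using insert.prems by (intro nn_integral_mono insert.IH) auto
  \<comment> \<open>The hypothesis \<open>le\<close> integrates over one coordinate with all others
    fixed, so coordinate i has to become innermost.\<close>
  also have "\<dots> = (\<integral>\<^sup>+ x. (\<integral>\<^sup>+ y. ennreal (\<bar>(\<Sum>j\<in>I. x j) + (y + s)\<bar> powr p) \<partial>\<mu> i) \<partial>PiM I \<nu>)"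
  proof -
    interpret \<nu>I: finite_product_sigma_finite \<nu> I using insert.hyps by unfold_locales
    interpret \<mu>i: prob_space "\<mu> i" by (rule \<mu>)
    interpret pair_sigma_finite "PiM I \<nu>" "\<mu> i" ..
    show ?thesis by (rule Fubini') measurable
  qed
  also have "\<dots> = (\<integral>\<^sup>+ x. (\<integral>\<^sup>+ y. ennreal (\<bar>y + ((\<Sum>j\<in>I. x j) + s)\<bar> powr p) \<partial>\<mu> i) \<partial>PiM I \<nu>)"
    by (simp add: algebra_simps)
  also have "\<dots> \<le> (\<integral>\<^sup>+ x. (\<integral>\<^sup>+ y. ennreal (\<bar>y + ((\<Sum>j\<in>I. x j) + s)\<bar> powr p) \<partial>\<nu> i) \<partial>PiM I \<nu>)"
    using insert.prems by (intro nn_integral_mono) auto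
  also have "\<dots> = (\<integral>\<^sup>+ x. ennreal (\<bar>(\<Sum>j\<in>insert i I. x j) + s\<bar> powr p) \<partial>PiM (insert i I) \<nu>)"
    using \<nu>.product_nn_integral_insert[OF insert.hyps mm(2)] unfolding upd ..
  finally show ?case .
qed

text \<open>Independence makes the joint law the product of the marginals. The summand 0 is the
  shift of \<open>PiM_sum_powr_mono\<close>.\<close>

lemma abs_moment_sum_eq_PiM:
  fixes n :: nat
  assumes M: "prob_space M" and ind: "prob_space.indep_vars M (\<lambda>_. borel) X {1..n}" and n: "n \<ge> 1"
    and \<mu>: "\<And>j. j \<in> {1..n} \<Longrightarrow> distr M borel (X j) = \<mu> j"
  shows "abs_moment M p (\<lambda>\<omega>. \<Sum>j\<in>{1..n}. X j \<omega>) = (\<integral>\<^sup>+ x. ennreal (\<bar>(\<Sum>j\<in>{1..n}. x j) + 0\<bar> powr p) \<partial>PiM {1..n} \<mu>)"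
proof -
  let ?I = "{1..n}"
  let ?P = "\<Pi>\<^sub>M i\<in>?I. (borel :: real measure)"
  let ?J = "\<lambda>\<omega>. \<lambda>j\<in>?I. X j \<omega>"
  interpret prob_space M by fact
  have rv [measurable]: "X j \<in> borel_measurable M" if "j \<in> ?I" for j
    using ind that by (auto simp: indep_vars_def)
  have J: "?J \<in> measurable M ?P" by (rule measurable_restrict) (use rv in auto)
  have ne: "?I \<noteq> {}" using n by auto
  have "distr M ?P ?J = (\<Pi>\<^sub>M i\<in>?I. distr M borel (X i))"
    using indep_vars_iff_distr_eq_PiM'[OF ne, of X "\<lambda>_. borel"] ind rv by auto
  also have "\<dots> = PiM ?I \<mu>" by (intro PiM_cong) (simp_all add: \<mu>)
  finally have d: "distr M ?P ?J = PiM ?I \<mu>" .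
  have "(\<lambda>x. ennreal (\<bar>(\<Sum>j\<in>?I. x j) + 0\<bar> powr p)) \<in> borel_measurable ?P" by measurable
  then show ?thesis
    unfolding d[symmetric] abs_moment_def
    by (subst nn_integral_distr[OF J]) (auto intro!: nn_integral_cong)
qed

text \<open>The two sequences may live on unrelated sample spaces, since each side depends only on a
  product law.\<close>

lemma abs_moment_sum_mono:
  fixes n :: nat
  assumes M: "prob_space M" "prob_space.indep_vars M (\<lambda>_. borel) X {1..n}"
    and N: "prob_space N" "prob_space.indep_vars N (\<lambda>_. borel) Y {1..n}" and n: "n \<ge> 1"
    and X: "\<And>j. j \<in> {1..n} \<Longrightarrow> distributed M lborel (X j) (\<lambda>x. ennreal (h j x))"
    and Y: "\<And>j. j \<in> {1..n} \<Longrightarrow> distributed N lborel (Y j) (\<lambda>x. ennreal (f j x))"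
    and nn: "\<And>j x. j \<in> {1..n} \<Longrightarrow> 0 \<le> h j x" "\<And>j x. j \<in> {1..n} \<Longrightarrow> 0 \<le> f j x"
    and le: "\<And>j s. j \<in> {1..n} \<Longrightarrow>
      (\<integral>\<^sup>+ x. ennreal (\<bar>x + s\<bar> powr p * h j x) \<partial>lborel) \<le> (\<integral>\<^sup>+ x. ennreal (\<bar>x + s\<bar> powr p * f j x) \<partial>lborel)"
  shows "abs_moment M p (\<lambda>\<omega>. \<Sum>j\<in>{1..n}. X j \<omega>) \<le> abs_moment N p (\<lambda>\<omega>. \<Sum>j\<in>{1..n}. Y j \<omega>)"
proof -
  \<comment> \<open>Outside {1..n} a point mass serves as a default, since
    \<open>PiM_sum_powr_mono\<close> asks for a probability measure at every index.\<close>
  define law where "law k j = (if j \<in> {1..n} then density lborel (\<lambda>x. ennreal (k j x)) else return borel 0)"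
    for k :: "nat \<Rightarrow> real \<Rightarrow> real" and j :: nat
  have law: "distr M' borel (Z j) = law k j" "prob_space (law k j)"
    if "prob_space M'" "distributed M' lborel (Z j) (\<lambda>x. ennreal (k j x))" "j \<in> {1..n}"
    for M' :: "'c measure" and Z k j
  proof -
    have "distr M' lborel (Z j) = density lborel (\<lambda>x. ennreal (k j x))"
      and m: "Z j \<in> measurable M' lborel" using that by (auto simp: distributed_def)
    then show e: "distr M' borel (Z j) = law k j" using that by (simp add: law_def distr_lborel_eq)
    show "prob_space (law k j)" unfolding e[symmetric] using that m by (intro prob_space.prob_space_distr) auto
  qed
  have ps: "prob_space (law k j)"
    if "\<And>j. j \<in> {1..n} \<Longrightarrow> prob_space (law k j)" for k j
    using that by (cases "j \<in> {1..n}") (auto simp: law_def prob_space_return)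
  have sets: "sets (law k j) = sets borel" for k j by (simp add: law_def)
  have int: "(\<integral>\<^sup>+ x. ennreal (\<bar>x + s\<bar> powr p) \<partial>law k j) = (\<integral>\<^sup>+ x. ennreal (\<bar>x + s\<bar> powr p * k j x) \<partial>lborel)"
    if "(\<lambda>x. ennreal (k j x)) \<in> borel_measurable lborel" "j \<in> {1..n}" "\<And>x. 0 \<le> k j x" for k j s
    using that by (simp add: law_def nn_integral_density ennreal_mult mult.commute)
  have "(\<integral>\<^sup>+ x. ennreal (\<bar>(\<Sum>j\<in>{1..n}. x j) + 0\<bar> powr p) \<partial>PiM {1..n} (law h))
     \<le> (\<integral>\<^sup>+ x. ennreal (\<bar>(\<Sum>j\<in>{1..n}. x j) + 0\<bar> powr p) \<partial>PiM {1..n} (law f))"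
  proof (rule PiM_sum_powr_mono)
    show "prob_space (law h j)" for j by (rule ps) (rule law(2)[OF M(1) X])
    show "prob_space (law f j)" for j by (rule ps) (rule law(2)[OF N(1) Y])
    fix j s assume j: "j \<in> {1..n}"
    show "(\<integral>\<^sup>+ x. ennreal (\<bar>x + s\<bar> powr p) \<partial>law h j) \<le> (\<integral>\<^sup>+ x. ennreal (\<bar>x + s\<bar> powr p) \<partial>law f j)"
      using X[OF j] Y[OF j] nn j le[OF j] by (subst (1 2) int) (auto simp: distributed_def)
  qed (simp_all add: sets)
  also have "(\<integral>\<^sup>+ x. ennreal (\<bar>(\<Sum>j\<in>{1..n}. x j) + 0\<bar> powr p) \<partial>PiM {1..n} (law h)) = abs_moment M p (\<lambda>\<omega>. \<Sum>j\<in>{1..n}. X j \<omega>)"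
    by (rule abs_moment_sum_eq_PiM[OF M n, symmetric]) (rule law(1)[OF M(1) X])
  also have "(\<integral>\<^sup>+ x. ennreal (\<bar>(\<Sum>j\<in>{1..n}. x j) + 0\<bar> powr p) \<partial>PiM {1..n} (law f)) = abs_moment N p (\<lambda>\<omega>. \<Sum>j\<in>{1..n}. Y j \<omega>)"
    by (rule abs_moment_sum_eq_PiM[OF N n, symmetric]) (rule law(1)[OF N(1) Y])
  finally show ?thesis .
qed

lemma admissible_densities:
  assumes "admissible p n a b M X"
  obtains h where "\<And>j. j \<in> {1..n} \<Longrightarrow> lconc (h j)" "\<And>j. j \<in> {1..n} \<Longrightarrow> dens p (a j) (b j) (h j)"
    "\<And>j. j \<in> {1..n} \<Longrightarrow> distributed M lborel (X j) (\<lambda>x. ennreal (h j x))"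
proof -
  have "\<forall>j\<in>{1..n}. \<exists>h. lconc h \<and> dens p (a j) (b j) h \<and> distributed M lborel (X j) (\<lambda>x. ennreal (h x))"
    using assms by (auto simp: admissible_def intro!: admissible_density)
  then show ?thesis using that by metis
qed

theorem theorem6:
  fixes p :: real and n :: nat and a b :: "nat \<Rightarrow> real"
  assumes "p > 4" and "n \<ge> 1"
    and "\<And>j. j \<in> {1..n} \<Longrightarrow> a j > 0"
    and "\<And>j. j \<in> {1..n} \<Longrightarrow> b j > 0"
    and "\<And>j. j \<in> {1..n} \<Longrightarrow> 3 powr (1/2) * (p + 1) powr (- 1 / p) \<le> b j / a j"
    and "\<And>j. j \<in> {1..n} \<Longrightarrow> b j / a j \<le> 2 powr (- 1/2) * Gamma (p + 1) powr (1 / p)"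
  shows
    "(\<forall>j\<in>{1..n}. \<exists>!f. f \<in> F_minus \<and> density_moments p (a j) (b j) f) \<and>
     (\<forall>j\<in>{1..n}. \<exists>!f. f \<in> F_plus \<and> density_moments p (a j) (b j) f) \<and>
     (\<forall>(M :: 'w measure) Y.
        prob_space M \<longrightarrow> prob_space.indep_vars M (\<lambda>_. borel) Y {1..n} \<longrightarrow>
        (\<forall>j\<in>{1..n}. \<exists>f. f \<in> F_minus \<and> density_moments p (a j) (b j) f \<and>
           distributed M lborel (Y j) (\<lambda>x. ennreal (f x))) \<longrightarrow>
        Inf (sum_moments p n a b) = abs_moment M p (\<lambda>\<omega>. \<Sum>j\<in>{1..n}. Y j \<omega>)) \<and>
     (\<forall>(M :: 'w measure) Y.
        prob_space M \<longrightarrow> prob_space.indep_vars M (\<lambda>_. borel) Y {1..n} \<longrightarrow>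
        (\<forall>j\<in>{1..n}. \<exists>f. f \<in> F_plus \<and> density_moments p (a j) (b j) f \<and>
           distributed M lborel (Y j) (\<lambda>x. ennreal (f x))) \<longrightarrow>
        Sup (sum_moments p n a b) = abs_moment M p (\<lambda>\<omega>. \<Sum>j\<in>{1..n}. Y j \<omega>))"
proof (intro conjI ballI allI impI)
  have p: "p > 2" using assms(1) by simp
  fix j assume j: "j \<in> {1..n}"
  show "\<exists>!f. f \<in> F_minus \<and> density_moments p (a j) (b j) f"
    using F_minus_exists[OF p assms(3-6)[OF j]] F_minus_unique[OF p] by blast
  show "\<exists>!f. f \<in> F_plus \<and> density_moments p (a j) (b j) f"
    using F_plus_exists[OF p assms(3-6)[OF j]] F_plus_unique[OF p] by blast
next
  fix M :: "'w measure" and Y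
  assume M: "prob_space M" "prob_space.indep_vars M (\<lambda>_. borel) Y {1..n}"
    and "\<forall>j\<in>{1..n}. \<exists>f. f \<in> F_minus \<and> density_moments p (a j) (b j) f \<and>
           distributed M lborel (Y j) (\<lambda>x. ennreal (f x))"
  then obtain f where f: "\<And>j. j \<in> {1..n} \<Longrightarrow> f j \<in> F_minus"
    "\<And>j. j \<in> {1..n} \<Longrightarrow> dens p (a j) (b j) (f j)"
    "\<And>j. j \<in> {1..n} \<Longrightarrow> distributed M lborel (Y j) (\<lambda>x. ennreal (f j x))"
    using dens_F_minus by metis
  have adm: "admissible p n a b M Y"
    unfolding admissible_def
  proof (intro conjI ballI M)
    fix j assume j: "j \<in> {1..n}"
    obtain \<phi> where \<phi>: "convex_ereal \<phi>" "\<And>x. f j x = exp_neg (\<phi> x)"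
      using F_minus_convex_potential[OF f(1)[OF j]] by metis
    note * = distributed_density_admissible[OF f(3)[OF j] M(1) f(2)[OF j] \<phi>]
    show "symmetric_rv M (Y j)" "log_concave_rv M (Y j)" "second_moment M (Y j) = ennreal ((a j)\<^sup>2)"
      "abs_moment M p (Y j) = ennreal (b j powr p)" by (rule *)+
  qed
  show "Inf (sum_moments p n a b) = abs_moment M p (\<lambda>\<omega>. \<Sum>j\<in>{1..n}. Y j \<omega>)"
  proof (rule antisym)
    \<comment> \<open>Y lives on a sample space of arbitrary type;
      \<open>admissible_in_sum_moments\<close> moves its value into the set over which the infimum
      is taken.\<close>
    show "Inf (sum_moments p n a b) \<le> abs_moment M p (\<lambda>\<omega>. \<Sum>j\<in>{1..n}. Y j \<omega>)"
      by (intro Inf_lower admissible_in_sum_moments[OF assms(2) adm])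
    show "abs_moment M p (\<lambda>\<omega>. \<Sum>j\<in>{1..n}. Y j \<omega>) \<le> Inf (sum_moments p n a b)"
    proof (rule Inf_greatest)
      fix m assume "m \<in> sum_moments p n a b"
      then obtain N :: "(nat \<Rightarrow> real) measure" and X where
        m: "m = abs_moment N p (\<lambda>\<omega>. \<Sum>j\<in>{1..n}. X j \<omega>)" and X: "admissible p n a b N X"
        unfolding sum_moments_def by blast
      obtain h where h: "\<And>j. j \<in> {1..n} \<Longrightarrow> lconc (h j)" "\<And>j. j \<in> {1..n} \<Longrightarrow> dens p (a j) (b j) (h j)"
        "\<And>j. j \<in> {1..n} \<Longrightarrow> distributed N lborel (X j) (\<lambda>x. ennreal (h j x))"
        using admissible_densities[OF X] by metis
      have N: "prob_space N" "prob_space.indep_vars N (\<lambda>_. borel) X {1..n}"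
        using X by (auto simp: admissible_def)
      show "abs_moment M p (\<lambda>\<omega>. \<Sum>j\<in>{1..n}. Y j \<omega>) \<le> m"
        unfolding m
      proof (rule abs_moment_sum_mono[OF M N assms(2) f(3) h(3)])
        fix j s assume j: "j \<in> {1..n}"
        show "(\<integral>\<^sup>+ x. ennreal (\<bar>x + s\<bar> powr p * f j x) \<partial>lborel) \<le> (\<integral>\<^sup>+ x. ennreal (\<bar>x + s\<bar> powr p * h j x) \<partial>lborel)"
          by (rule F_minus_minimal[OF assms(1) h(1,2)[OF j] f(1,2)[OF j]])
      qed (use f(2) h(2) in \<open>auto simp: dens_def\<close>)
    qed
  qed
next
  fix M :: "'w measure" and Y
  assume M: "prob_space M" "prob_space.indep_vars M (\<lambda>_. borel) Y {1..n}"
    and "\<forall>j\<in>{1..n}. \<exists>f. f \<in> F_plus \<and> density_moments p (a j) (b j) f \<and>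
           distributed M lborel (Y j) (\<lambda>x. ennreal (f x))"
  then obtain f where f: "\<And>j. j \<in> {1..n} \<Longrightarrow> f j \<in> F_plus"
    "\<And>j. j \<in> {1..n} \<Longrightarrow> dens p (a j) (b j) (f j)"
    "\<And>j. j \<in> {1..n} \<Longrightarrow> distributed M lborel (Y j) (\<lambda>x. ennreal (f j x))"
    using dens_F_plus by metis
  have adm: "admissible p n a b M Y"
    unfolding admissible_def
  proof (intro conjI ballI M)
    fix j assume j: "j \<in> {1..n}"
    obtain \<phi> where \<phi>: "convex_ereal \<phi>" "\<And>x. f j x = exp_neg (\<phi> x)"
      using F_plus_convex_potential[OF f(1)[OF j]] by metis
    note * = distributed_density_admissible[OF f(3)[OF j] M(1) f(2)[OF j] \<phi>]
    show "symmetric_rv M (Y j)" "log_concave_rv M (Y j)" "second_moment M (Y j) = ennreal ((a j)\<^sup>2)"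
      "abs_moment M p (Y j) = ennreal (b j powr p)" by (rule *)+
  qed
  show "Sup (sum_moments p n a b) = abs_moment M p (\<lambda>\<omega>. \<Sum>j\<in>{1..n}. Y j \<omega>)"
  proof (rule antisym)
    show "abs_moment M p (\<lambda>\<omega>. \<Sum>j\<in>{1..n}. Y j \<omega>) \<le> Sup (sum_moments p n a b)"
      by (intro Sup_upper admissible_in_sum_moments[OF assms(2) adm])
    show "Sup (sum_moments p n a b) \<le> abs_moment M p (\<lambda>\<omega>. \<Sum>j\<in>{1..n}. Y j \<omega>)"
    proof (rule Sup_least)
      fix m assume "m \<in> sum_moments p n a b"
      then obtain N :: "(nat \<Rightarrow> real) measure" and X where
        m: "m = abs_moment N p (\<lambda>\<omega>. \<Sum>j\<in>{1..n}. X j \<omega>)" and X: "admissible p n a b N X"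
        unfolding sum_moments_def by blast
      obtain h where h: "\<And>j. j \<in> {1..n} \<Longrightarrow> lconc (h j)" "\<And>j. j \<in> {1..n} \<Longrightarrow> dens p (a j) (b j) (h j)"
        "\<And>j. j \<in> {1..n} \<Longrightarrow> distributed N lborel (X j) (\<lambda>x. ennreal (h j x))"
        using admissible_densities[OF X] by metis
      have N: "prob_space N" "prob_space.indep_vars N (\<lambda>_. borel) X {1..n}"
        using X by (auto simp: admissible_def)
      show "m \<le> abs_moment M p (\<lambda>\<omega>. \<Sum>j\<in>{1..n}. Y j \<omega>)"
        unfolding m
      proof (rule abs_moment_sum_mono[OF N M assms(2) h(3) f(3)])
        fix j s assume j: "j \<in> {1..n}"
        show "(\<integral>\<^sup>+ x. ennreal (\<bar>x + s\<bar> powr p * h j x) \<partial>lborel) \<le> (\<integral>\<^sup>+ x. ennreal (\<bar>x + s\<bar> powr p * f j x) \<partial>lborel)"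
          by (rule F_plus_maximal[OF assms(1) h(1,2)[OF j] f(1,2)[OF j]])
      qed (use f(2) h(2) in \<open>auto simp: dens_def\<close>)
    qed
  qed
qed

end
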